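(* Let $T$ be a finite non-abelian simple group and $x,y\in T$ with $|x|=2$, $|y|$ an odd prime, and $T=\langle x,y\rangle$. Let $X=T\wr\mathrm{S}_6=T^6{:}\mathrm{S}_6$ with $(t_1,\dots,t_6)^\sigma=(t_{1^{\sigma^{-1}}},\dots,t_{6^{\sigma^{-1}}})$ for $\sigma\in\mathrm{S}_6$. Let $h_1=(146)(235)$, $h_2=(13)(24)(56)$, $\delta=(14)(23)(56)$ in $\mathrm{S}_6$, $H=\langle h_1,h_2\rangle$, $f=(y,y^{-1},y,y^{-1},x,x)\in T^6$, $g=f\delta$, $Y=\langle H,g\rangle$ and $\Gamma=\mathrm{Cos}(Y,H,HgH)$. Define $\Phi_1=\{\varphi\in\mathrm{Aut}(T):\varphi(x)=x,\ \varphi(y)=y^{-1}\}$ and $\Phi_2=\{\varphi\in\mathrm{Aut}(T):\varphi(yxy)=y^2x,\ \varphi(y^2x)=yxy,\ \varphi(xy^2)=y^{-2}x\}$. Then $Y$ has a minimal normal subgroup $M\cong T^d$ with $Y/M\cong\mathrm{S}_4$ (so $Y\cong T^d.\mathrm{S}_4$), and $\Gamma$ is a connected $(Y,2)$-arc-transitive $M$-cover of $\mathrm{K}_4$. Moreover $d\in\{1,3,6\}$ and exactly one of the following holds: (1) $d=1$, which happens if and only if both $\Phi_1$ and $\Phi_2$ are non-empty; (2) $d=3$, which happens if and only if $\Phi_1$ is non-empty and $\Phi_2$ is empty; (3) $d=6$, which happens if and only if $\Phi_1$ is empty.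
   Context: For a group $G$, subgroup $H$ and $g\in G$, the coset graph $\mathrm{Cos}(G,H,HgH)$ has vertex set the right cosets $Hz$ ($z\in G$), with $(Hz,Hw)$ an arc iff $wz^{-1}\in HgH$; $G$ acts by right multiplication. An $s$-arc is a sequence of $s+1$ vertices, consecutive ones adjacent, any three consecutive distinct; $\Gamma$ is $(G,2)$-arc-transitive if $G$ acts transitively on its $2$-arcs. For $N\trianglelefteq G$, the normal quotient $\Gamma_N$ has vertices the $N$-orbits, two adjacent iff they contain adjacent vertices of $\Gamma$; $\Gamma$ is an $N$-cover of $\Gamma_N$ if $N$ has at least $3$ orbits and $\Gamma$, $\Gamma_N$ have the same valency. $\mathrm{K}_4$ is the complete graph on $4$ vertices. Permutations act on the right. *)

theory Defs
  imports
    "HOL-Algebra.SimpleGroups"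
    "HOL-Algebra.Sym_Groups"
    "HOL-Algebra.Product_Groups"
    "HOL-Algebra.Multiplicative_Group"
    "HOL-Algebra.Bij"
    "HOL-Combinatorics.Cycles"
    "Graph_Theory.Graph_Theory"
begin

definition minimal_normal :: "'a set \<Rightarrow> ('a, 'b) monoid_scheme \<Rightarrow> bool" where
  "minimal_normal M G \<longleftrightarrow> M \<lhd> G \<and> M \<noteq> {\<one>\<^bsub>G\<^esub>} \<and>
     (\<forall>N. N \<lhd> G \<longrightarrow> N \<subseteq> M \<longrightarrow> N = {\<one>\<^bsub>G\<^esub>} \<or> N = M)"


text \<open>Wreath product \<open>T wr S\<^sub>n = T\<^sup>n : S\<^sub>n\<close>. Permutations act on the right, so the product of
  \<open>\<sigma>\<close> and \<open>\<tau>\<close> (first \<open>\<sigma>\<close>, then \<open>\<tau>\<close>) is the function \<open>\<tau> \<circ> \<sigma>\<close>. The pair \<open>(t, \<sigma>)\<close> stands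
  for the product \<open>t \<sigma>\<close>.\<close>

text \<open>\<open>coord_perm n t \<sigma>\<close> is \<open>t\<^sup>\<sigma>\<close>: its \<open>i\<close>-th coordinate is the coordinate of \<open>t\<close> at the image of
  \<open>i\<close> under the inverse of \<open>\<sigma>\<close>.\<close>

definition coord_perm :: "nat \<Rightarrow> (nat \<Rightarrow> 'a) \<Rightarrow> (nat \<Rightarrow> nat) \<Rightarrow> nat \<Rightarrow> 'a" where
  "coord_perm n t \<sigma> = (\<lambda>i\<in>{1..n}. t (inv_into UNIV \<sigma> i))"

text \<open>Since \<open>t\<^sup>\<sigma>\<close> is the conjugate of \<open>t\<close> by \<open>\<sigma>\<close>, moving \<open>\<sigma>\<close> past \<open>u\<close> in \<open>t \<sigma> u \<tau>\<close> replaces \<open>u\<close>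
  by its image under the inverse of \<open>\<sigma>\<close>.\<close>

definition wreath_sym :: "nat \<Rightarrow> ('a, 'b) monoid_scheme \<Rightarrow> ((nat \<Rightarrow> 'a) \<times> (nat \<Rightarrow> nat)) monoid" where
  "wreath_sym n T =
    \<lparr>carrier = carrier (product_group {1..n} (\<lambda>_. T)) \<times> {\<sigma>. \<sigma> permutes {1..n}},
     monoid.mult = (\<lambda>(t, \<sigma>) (u, \<tau>).
       (t \<otimes>\<^bsub>product_group {1..n} (\<lambda>_. T)\<^esub> coord_perm n u (inv_into UNIV \<sigma>), \<tau> \<circ> \<sigma>)),
     one = (\<one>\<^bsub>product_group {1..n} (\<lambda>_. T)\<^esub>, id)\<rparr>"

definition wr_base :: "(nat \<Rightarrow> 'a) \<Rightarrow> (nat \<Rightarrow> 'a) \<times> (nat \<Rightarrow> nat)" where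
  "wr_base t = (t, id)"

definition wr_top :: "nat \<Rightarrow> ('a, 'b) monoid_scheme \<Rightarrow> (nat \<Rightarrow> nat) \<Rightarrow> (nat \<Rightarrow> 'a) \<times> (nat \<Rightarrow> nat)" where
  "wr_top n T \<sigma> = (\<one>\<^bsub>product_group {1..n} (\<lambda>_. T)\<^esub>, \<sigma>)"


definition coset_graph :: "('a, 'b) monoid_scheme \<Rightarrow> 'a set \<Rightarrow> 'a \<Rightarrow> 'a set pair_pre_digraph" where
  "coset_graph G H g =
    \<lparr>pverts = rcosets\<^bsub>G\<^esub> H,
     parcs = {(H #>\<^bsub>G\<^esub> z, H #>\<^bsub>G\<^esub> w) | z w. z \<in> carrier G \<and> w \<in> carrier G \<and>
                w \<otimes>\<^bsub>G\<^esub> inv\<^bsub>G\<^esub> z \<in> (H #>\<^bsub>G\<^esub> g) <#>\<^bsub>G\<^esub> H}\<rparr>"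

text \<open>Below, \<open>act v a\<close> is the image of the vertex \<open>v\<close> under the group element \<open>a\<close>, and a group is
  given by its set of elements \<open>A\<close>. For coset graphs \<open>act\<close> is \<open>r_coset G\<close>, that is, right
  multiplication.\<close>

definition s_arcs :: "nat \<Rightarrow> 'v pair_pre_digraph \<Rightarrow> 'v list set" where
  "s_arcs s \<Gamma> = {p. length p = s + 1 \<and> set p \<subseteq> pverts \<Gamma> \<and>
     (\<forall>i. i + 1 < length p \<longrightarrow> (p ! i, p ! (i + 1)) \<in> parcs \<Gamma>) \<and>
     (\<forall>i. i + 2 < length p \<longrightarrow> distinct [p ! i, p ! (i + 1), p ! (i + 2)])}"

definition s_arc_transitive ::
  "nat \<Rightarrow> 'g set \<Rightarrow> ('v \<Rightarrow> 'g \<Rightarrow> 'v) \<Rightarrow> 'v pair_pre_digraph \<Rightarrow> bool" where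
  "s_arc_transitive s A act \<Gamma> \<longleftrightarrow>
     (\<forall>p\<in>s_arcs s \<Gamma>. \<forall>q\<in>s_arcs s \<Gamma>. \<exists>a\<in>A. map (\<lambda>v. act v a) p = q)"

definition normal_quotient ::
  "'v pair_pre_digraph \<Rightarrow> 'g set \<Rightarrow> ('v \<Rightarrow> 'g \<Rightarrow> 'v) \<Rightarrow> 'v set pair_pre_digraph" where
  "normal_quotient \<Gamma> N act =
    (let orbs = (\<lambda>v. act v ` N) ` pverts \<Gamma>
     in \<lparr>pverts = orbs,
         parcs = {(B, C). B \<in> orbs \<and> C \<in> orbs \<and> B \<noteq> C \<and> (\<exists>u\<in>B. \<exists>v\<in>C. (u, v) \<in> parcs \<Gamma>)}\<rparr>)"

definition has_valency :: "'v pair_pre_digraph \<Rightarrow> nat \<Rightarrow> bool" where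
  "has_valency \<Gamma> k \<longleftrightarrow> (\<forall>v\<in>pverts \<Gamma>. out_degree (with_proj \<Gamma>) v = k)"

definition is_normal_cover :: "'v pair_pre_digraph \<Rightarrow> 'g set \<Rightarrow> ('v \<Rightarrow> 'g \<Rightarrow> 'v) \<Rightarrow> bool" where
  "is_normal_cover \<Gamma> N act \<longleftrightarrow>
     3 \<le> card (pverts (normal_quotient \<Gamma> N act)) \<and>
     (\<exists>k. has_valency \<Gamma> k \<and> has_valency (normal_quotient \<Gamma> N act) k)"


abbreviation h1_perm :: "nat \<Rightarrow> nat" where
  "h1_perm \<equiv> cycle_of_list [1, 4, 6] \<circ> cycle_of_list [2, 3, 5]"

abbreviation h2_perm :: "nat \<Rightarrow> nat" where
  "h2_perm \<equiv> cycle_of_list [1, 3] \<circ> cycle_of_list [2, 4] \<circ> cycle_of_list [5, 6]"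

abbreviation delta_perm :: "nat \<Rightarrow> nat" where
  "delta_perm \<equiv> cycle_of_list [1, 4] \<circ> cycle_of_list [2, 3] \<circ> cycle_of_list [5, 6]"

definition H_grp :: "('a, 'b) monoid_scheme \<Rightarrow> ((nat \<Rightarrow> 'a) \<times> (nat \<Rightarrow> nat)) set" where
  "H_grp T = generate (wreath_sym 6 T) {wr_top 6 T h1_perm, wr_top 6 T h2_perm}"

definition f_elt :: "('a, 'b) monoid_scheme \<Rightarrow> 'a \<Rightarrow> 'a \<Rightarrow> nat \<Rightarrow> 'a" where
  "f_elt T x y = (\<lambda>i\<in>{1..6}. [y, inv\<^bsub>T\<^esub> y, y, inv\<^bsub>T\<^esub> y, x, x] ! (i - 1))"

definition g_elt :: "('a, 'b) monoid_scheme \<Rightarrow> 'a \<Rightarrow> 'a \<Rightarrow> (nat \<Rightarrow> 'a) \<times> (nat \<Rightarrow> nat)" where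
  "g_elt T x y = wr_base (f_elt T x y) \<otimes>\<^bsub>wreath_sym 6 T\<^esub> wr_top 6 T delta_perm"

definition Y_grp :: "('a, 'b) monoid_scheme \<Rightarrow> 'a \<Rightarrow> 'a \<Rightarrow> ((nat \<Rightarrow> 'a) \<times> (nat \<Rightarrow> nat)) monoid" where
  "Y_grp T x y = subgroup_generated (wreath_sym 6 T) (H_grp T \<union> {g_elt T x y})"

definition Gamma :: "('a, 'b) monoid_scheme \<Rightarrow> 'a \<Rightarrow> 'a \<Rightarrow>
    ((nat \<Rightarrow> 'a) \<times> (nat \<Rightarrow> nat)) set pair_pre_digraph" where
  "Gamma T x y = coset_graph (Y_grp T x y) (H_grp T) (g_elt T x y)"

definition Phi1 :: "('a, 'b) monoid_scheme \<Rightarrow> 'a \<Rightarrow> 'a \<Rightarrow> ('a \<Rightarrow> 'a) set" where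
  "Phi1 T x y = {\<phi> \<in> auto T. \<phi> x = x \<and> \<phi> y = inv\<^bsub>T\<^esub> y}"

definition Phi2 :: "('a, 'b) monoid_scheme \<Rightarrow> 'a \<Rightarrow> 'a \<Rightarrow> ('a \<Rightarrow> 'a) set" where
  "Phi2 T x y = {\<phi> \<in> auto T.
     \<phi> (y \<otimes>\<^bsub>T\<^esub> x \<otimes>\<^bsub>T\<^esub> y) = y [^]\<^bsub>T\<^esub> (2::nat) \<otimes>\<^bsub>T\<^esub> x \<and>
     \<phi> (y [^]\<^bsub>T\<^esub> (2::nat) \<otimes>\<^bsub>T\<^esub> x) = y \<otimes>\<^bsub>T\<^esub> x \<otimes>\<^bsub>T\<^esub> y \<and>
     \<phi> (x \<otimes>\<^bsub>T\<^esub> y [^]\<^bsub>T\<^esub> (2::nat)) = y [^]\<^bsub>T\<^esub> (-2::int) \<otimes>\<^bsub>T\<^esub> x}"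

end

theory Submission
  imports Defs
begin

text \<open>The images of \<open>h\<^sub>1\<close>, \<open>h\<^sub>2\<close>, \<open>g\<close> in \<open>S\<^sub>6\<close> generate a copy of \<open>S\<^sub>4\<close>, and \<open>M\<close> is the intersection
  of \<open>Y\<close> with the base group. Under this \<open>S\<^sub>4\<close> the subgroup \<open>H\<close> becomes a point stabilizer, so the
  position of that point under \<open>z\<close> describes the \<open>M\<close>-orbit of the vertex \<open>H z\<close>, and the three
  neighbours of a vertex occupy the three other positions.

  All \<open>h \<in> H\<close> permute the coordinates without twist, and conjugation by \<open>g\<close> twists the \<open>i\<close>-th
  coordinate by \<open>f\<^sub>i\<close>; as \<open>x\<close>, \<open>y\<close> generate \<open>T\<close>, a nontrivial normal subgroup of \<open>Y\<close> in \<open>M\<close> projects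
  onto \<open>T\<close> in every coordinate. Hence \<open>M\<close> is a subdirect power of \<open>T\<close>, determined by which
  coordinates are linked, i.e. related by an automorphism of \<open>T\<close> on \<open>M\<close>. Linkage is an
  \<open>S\<^sub>4\<close>-invariant equivalence relation, so the classes have size 1, 2 or 6. Comparing the twists \<open>f\<^sub>i\<close>
  shows that coordinates 1 and 2 are linked iff \<open>Phi1\<close> is nonempty. If 2 and 6 are linked too, the
  element \<open>(h\<^sub>1 h\<^sub>2 g)\<^sup>3\<close> of \<open>M\<close> shows that the linking automorphism is in \<open>Phi2\<close>. Conversely, elements of
  \<open>Phi1\<close> and \<open>Phi2\<close> generate a copy of \<open>S\<^sub>3\<close> in \<open>Aut(T)\<close>, which conjugates \<open>M\<close> into the diagonal.\<close>

section \<open>Subdirect powers of a simple group\<close>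

context group
begin

lemma inv_cancel_left:
  assumes "a \<in> carrier G" "b \<in> carrier G"
  shows "a \<otimes> (inv a \<otimes> b) = b" "inv a \<otimes> (a \<otimes> b) = b"
  using assms by (simp_all flip: m_assoc)

lemma commute_mult:
  assumes "a \<in> carrier G" "b \<in> carrier G" "c \<in> carrier G"
    and ac: "a \<otimes> c = c \<otimes> a" and bc: "b \<otimes> c = c \<otimes> b"
  shows "(a \<otimes> b) \<otimes> c = c \<otimes> (a \<otimes> b)"
proof -
  have "(a \<otimes> b) \<otimes> c = a \<otimes> (c \<otimes> b)" using assms by (simp add: m_assoc)
  also have "\<dots> = (c \<otimes> a) \<otimes> b" using assms(1-3) by (simp add: ac flip: m_assoc)
  finally show ?thesis using assms(1-3) by (simp add: m_assoc)
qed

lemma commute_inv: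
  assumes "a \<in> carrier G" "c \<in> carrier G" "a \<otimes> c = c \<otimes> a"
  shows "inv a \<otimes> c = c \<otimes> inv a"
proof -
  have "inv a \<otimes> c = inv a \<otimes> (c \<otimes> a) \<otimes> inv a" using assms(1,2) by (simp add: m_assoc)
  also have "\<dots> = inv a \<otimes> (a \<otimes> c) \<otimes> inv a" by (simp add: assms(3))
  finally show ?thesis using assms(1,2) by (simp add: inv_cancel_left)
qed

lemma hom_eq_on_generate:
  assumes "group H" and f: "f \<in> hom G H" and g: "g \<in> hom G H"
    and S: "S \<subseteq> carrier G" and eq: "\<And>s. s \<in> S \<Longrightarrow> f s = g s"
    and t: "t \<in> generate G S"
  shows "f t = g t"
proof -
  interpret f: group_hom G H f
    by (intro group_hom.intro group_hom_axioms.intro is_group assms(1) f)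
  interpret g: group_hom G H g
    by (intro group_hom.intro group_hom_axioms.intro is_group assms(1) g)
  show ?thesis
    using t
  proof induction
    case (inv h)
    then show ?case using S eq by (auto simp: subset_iff)
  next
    case (eng h1 h2)
    then have "h1 \<in> carrier G" "h2 \<in> carrier G" using generate_incl[OF S] by auto
    then show ?case using eng.IH by simp
  qed (use eq in auto)
qed

end

locale simple_nonabelian = simple_group G for G (structure) +
  assumes nonabelian: "\<not> comm_group G"
begin

lemma non_commuting:
  obtains a b where "a \<in> carrier G" "b \<in> carrier G" "a \<otimes> b \<noteq> b \<otimes> a"
  using nonabelian group_comm_groupI by blast

lemma normal_eq_carrier:
  assumes "H \<lhd> G" "a \<in> H" "a \<noteq> \<one>"
  shows "H = carrier G"
  using no_real_normal_subgroup[OF assms(1)] assms(2,3) by blast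

text \<open>The centre is normal, so a nontrivial central element would make it the whole group,
  which is not commutative.\<close>

lemma central_eq_one:
  assumes a: "a \<in> carrier G" and comm: "\<And>b. b \<in> carrier G \<Longrightarrow> a \<otimes> b = b \<otimes> a"
  shows "a = \<one>"
proof (rule ccontr)
  assume "a \<noteq> \<one>"
  define Z where "Z = {c \<in> carrier G. \<forall>b\<in>carrier G. c \<otimes> b = b \<otimes> c}"
  have "subgroup Z G"
  proof (rule subgroupI)
    show "Z \<noteq> {}" using a comm unfolding Z_def by blast
    show "inv c \<in> Z" if "c \<in> Z" for c
      using that unfolding Z_def mem_Collect_eq by (intro conjI ballI commute_inv) blast+
    show "c \<otimes> d \<in> Z" if "c \<in> Z" "d \<in> Z" for c d
      using that unfolding Z_def mem_Collect_eq by (intro conjI ballI commute_mult) blast+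
  qed (use Z_def in blast)
  then have "Z \<lhd> G"
  proof (rule normal_invI)
    show "a \<otimes> z \<otimes> inv a \<in> Z" if "a \<in> carrier G" "z \<in> Z" for a z
    proof -
      have "z \<otimes> a = a \<otimes> z" "z \<in> carrier G" using that unfolding Z_def by blast+
      then have "a \<otimes> z \<otimes> inv a = z" using that(1) by (metis inv_solve_right m_closed)
      then show ?thesis using that by simp
    qed
  qed
  moreover have "a \<in> Z"
    using a comm unfolding Z_def by blast
  ultimately have "Z = carrier G"
    using \<open>a \<noteq> \<one>\<close> by (rule normal_eq_carrier)
  then show False
    using non_commuting unfolding Z_def by blast
qed

text \<open>Commutators upgrade pairwise independence of coordinates to full independence: an
  element trivial at j and one trivial on J have a commutator trivial on \<open>insert j J\<close>,
  and noncommuting values at i keep it nontrivial there.\<close>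

lemma subdirect_product_full:
  assumes fin: "finite I" and S: "subgroup S (product_group I (\<lambda>_. G))"
    and surj: "\<And>i a. i \<in> I \<Longrightarrow> a \<in> carrier G \<Longrightarrow> \<exists>s\<in>S. s i = a"
    and indep: "\<And>i j. i \<in> I \<Longrightarrow> j \<in> I \<Longrightarrow> i \<noteq> j \<Longrightarrow> \<exists>s\<in>S. s j = \<one> \<and> s i \<noteq> \<one>"
  shows "S = carrier (product_group I (\<lambda>_. G))"
proof -
  interpret P: group "product_group I (\<lambda>_. G)"
    by (simp add: is_group)
  interpret S: subgroup S "product_group I (\<lambda>_. G)"
    by (rule S)
  have in_G [simp]: "s i \<in> carrier G" if "s \<in> S" "i \<in> I" for s i
    using S.subset that by (force simp: PiE_iff)
  have mult_S: "\<exists>r\<in>S. \<forall>i\<in>I. r i = s i \<otimes> t i" if "s \<in> S" "t \<in> S" for s t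
    using S.m_closed[OF that] by (intro bexI[of _ "\<lambda>i\<in>I. s i \<otimes> t i"]) auto
  have inv_S: "\<exists>r\<in>S. \<forall>i\<in>I. r i = inv (s i)" if "s \<in> S" for s
    using S.m_inv_closed[OF that] S.mem_carrier[OF that] 
    by (intro bexI[of _ "\<lambda>i\<in>I. inv (s i)"]) (auto simp: inv_product_group is_group)
  have one_S: "\<exists>r\<in>S. \<forall>i\<in>I. r i = \<one>"
    using S.one_closed by (intro bexI[of _ "\<lambda>i\<in>I. \<one>"]) auto
  \<comment> \<open>Conjugating elements lift to S through coordinate i, so \<open>Q i J\<close> is
    normal in G; by simplicity one nontrivial value makes it all of G.\<close>
  define Q where "Q i J = (\<lambda>s. s i) ` {s \<in> S. \<forall>j\<in>J. s j = \<one>}" for i J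
  have Q_I: "r i \<in> Q i J" if "r \<in> S" "\<And>j. j \<in> J \<Longrightarrow> r j = \<one>" for r i J
    using that unfolding Q_def by (intro imageI) simp
  have Q_E: thesis
    if "a \<in> Q i J" "\<And>s. s \<in> S \<Longrightarrow> \<forall>j\<in>J. s j = \<one> \<Longrightarrow> a = s i \<Longrightarrow> thesis" for a i J thesis
    using that unfolding Q_def by auto
  have Q_normal: "Q i J \<lhd> G" if i: "i \<in> I" and J: "J \<subseteq> I" for i J
  proof -
    have "subgroup (Q i J) G"
    proof (rule subgroupI)
      show "Q i J \<subseteq> carrier G" using i by (auto simp: Q_def)
      show "Q i J \<noteq> {}" using one_S J by (auto simp: Q_def)
      show "inv a \<in> Q i J" if a: "a \<in> Q i J" for a
      proof -
        obtain s where s: "s \<in> S" "\<forall>j\<in>J. s j = \<one>" "a = s i"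
          by (rule Q_E[OF a])
        then obtain r where r: "r \<in> S" "\<forall>i\<in>I. r i = inv (s i)" using inv_S[OF s(1)] by blast
        then have "r i \<in> Q i J" using s J by (intro Q_I[of r]) auto
        then show ?thesis using r s i by simp
      qed
      show "a \<otimes> b \<in> Q i J" if a: "a \<in> Q i J" and b: "b \<in> Q i J" for a b
      proof -
        obtain s where s: "s \<in> S" "\<forall>j\<in>J. s j = \<one>" "a = s i"
          by (rule Q_E[OF a])
        obtain t where t: "t \<in> S" "\<forall>j\<in>J. t j = \<one>" "b = t i"
          by (rule Q_E[OF b])
        obtain r where r: "r \<in> S" "\<forall>i\<in>I. r i = s i \<otimes> t i" using mult_S[OF s(1) t(1)] by blast
        then have "r i \<in> Q i J" using s t J by (intro Q_I[of r]) auto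
        then show ?thesis using r s t i by simp
      qed
    qed
    moreover have "c \<otimes> a \<otimes> inv c \<in> Q i J" if c: "c \<in> carrier G" and a: "a \<in> Q i J" for a c
    proof -
      obtain s where s: "s \<in> S" "\<forall>j\<in>J. s j = \<one>" "a = s i"
        by (rule Q_E[OF a])
      obtain t where t: "t \<in> S" "t i = c" using surj[OF i c] by auto
      obtain t' where t': "t' \<in> S" "\<forall>i\<in>I. t' i = inv (t i)" using inv_S[OF t(1)] by blast
      obtain r where r: "r \<in> S" "\<forall>i\<in>I. r i = t i \<otimes> s i" using mult_S[OF t(1) s(1)] by blast
      obtain q where q: "q \<in> S" "\<forall>i\<in>I. q i = r i \<otimes> t' i" using mult_S[OF r(1) t'(1)] by blast
      have "q i \<in> Q i J" using q r t' s t J by (intro Q_I[of q]) (auto simp: subset_iff)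
      moreover have "q i = c \<otimes> a \<otimes> inv c" using q r t' s t i by simp
      ultimately show ?thesis by simp
    qed
    ultimately show ?thesis by (simp add: normal_inv_iff)
  qed
  have Q_full: "Q i J = carrier G" if "finite J" "i \<in> I" "J \<subseteq> I - {i}" for i J
    using that
  proof (induction J)
    case empty
    then show ?case using surj by (auto simp: Q_def)
  next
    case (insert j J)
    have j: "j \<in> I" "j \<noteq> i" and J: "J \<subseteq> I" using insert.prems by auto
    obtain s where "s \<in> S" "s j = \<one>" "s i \<noteq> \<one>"
      using indep[of i j] insert.prems by auto
    then have Qj: "Q i {j} = carrier G"
      using normal_eq_carrier[OF Q_normal[of i "{j}"], of "s i"] Q_I[of s "{j}" i] insert.prems by auto
    have QJ: "Q i J = carrier G" using insert by auto
    obtain a b where ab: "a \<in> carrier G" "b \<in> carrier G" "a \<otimes> b \<noteq> b \<otimes> a"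
      by (rule non_commuting)
    obtain s where s: "s \<in> S" "s j = \<one>" "s i = a" using ab unfolding Qj[symmetric] by (auto elim: Q_E)
    obtain t where t: "t \<in> S" "\<forall>k\<in>J. t k = \<one>" "t i = b" using ab unfolding QJ[symmetric] by (auto elim: Q_E)
    obtain s' where s': "s' \<in> S" "\<forall>i\<in>I. s' i = inv (s i)" using inv_S[OF s(1)] by blast
    obtain t' where t': "t' \<in> S" "\<forall>i\<in>I. t' i = inv (t i)" using inv_S[OF t(1)] by blast
    obtain r where r: "r \<in> S" "\<forall>i\<in>I. r i = s i \<otimes> t i" using mult_S[OF s(1) t(1)] by blast
    obtain q where q: "q \<in> S" "\<forall>i\<in>I. q i = s' i \<otimes> t' i" using mult_S[OF s'(1) t'(1)] by blast
    obtain c where c: "c \<in> S" "\<forall>i\<in>I. c i = r i \<otimes> q i" using mult_S[OF r(1) q(1)] by blast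
    have "\<forall>k\<in>insert j J. c k = \<one>"
      using c q r s t s' t' j J in_G by (auto simp: subset_iff)
    then have "c i \<in> Q i (insert j J)" using c by (intro Q_I[of c]) auto
    moreover have "c i \<noteq> \<one>"
    proof
      assume "c i = \<one>"
      then have "(a \<otimes> b) \<otimes> inv (b \<otimes> a) = \<one>"
        using c q r s t s' t' insert.prems ab by (simp add: inv_mult_group)
      then show False using ab by (metis inv_equality inv_inv m_closed inv_closed)
    qed
    ultimately show ?case
      using normal_eq_carrier[OF Q_normal[of i "insert j J"]] insert.prems by auto
  qed
  \<comment> \<open>A target t is assembled one coordinate at a time: a factor from S supported at i
    alone sets coordinate i and leaves the others unchanged.\<close>
  have approx: "\<exists>s\<in>S. (\<forall>i\<in>K. s i = t i) \<and> (\<forall>i\<in>I - K. s i = \<one>)"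
    if t: "t \<in> (\<Pi>\<^sub>E i\<in>I. carrier G)" and K: "finite K" "K \<subseteq> I" for t K
    using K
  proof (induction K)
    case empty
    then show ?case using one_S by auto
  next
    case (insert i K)
    obtain s where s: "s \<in> S" "\<forall>i\<in>K. s i = t i" "\<forall>i\<in>I - K. s i = \<one>" using insert by auto
    have i: "i \<in> I" using insert by simp
    then have "t i \<in> Q i (I - {i})" using Q_full[of "I - {i}" i] fin t by auto
    then obtain r where r: "r \<in> S" "\<forall>j\<in>I - {i}. r j = \<one>" "t i = r i"
      by (rule Q_E)
    obtain q where "q \<in> S" "\<forall>i\<in>I. q i = s i \<otimes> r i" using mult_S[OF s(1) r(1)] by blast
    then have q: "q \<in> S" "\<And>j. j \<in> I \<Longrightarrow> q j = s j \<otimes> r j" by auto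
    have "q j = t j" if "j \<in> insert i K" for j
      using that in_G[OF s(1), of j] in_G[OF r(1), of j] q(2)[of j] s r insert.hyps insert.prems by (cases "j = i") (auto simp: subset_iff)
    moreover have "q j = \<one>" if "j \<in> I - insert i K" for j
      using that q(2)[of j] s(3) r(2) by auto
    ultimately show ?case using q(1) by blast
  qed
  have "t \<in> S" if t: "t \<in> (\<Pi>\<^sub>E i\<in>I. carrier G)" for t
  proof -
    obtain s where s: "s \<in> S" "\<forall>i\<in>I. s i = t i" using approx[OF t fin] by auto
    then have "s \<in> (\<Pi>\<^sub>E i\<in>I. carrier G)" using S.subset by auto
    then have "s = t" using t s(2) by (intro PiE_ext) auto
    then show ?thesis using s(1) by simp
  qed
  then show ?thesis using S.subset by auto
qed

end


section \<open>Groups generated by an involution and an element of odd order\<close>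

text \<open>The words \<open>u\<close>, \<open>v\<close>, \<open>w\<close> and their inverses are the coordinates of the relator
  \<open>(h\<^sub>1 h\<^sub>2 g)\<^sup>3\<close>; \<open>Phi2\<close> prescribes that \<open>\<phi>\<close> swaps \<open>u\<close> and \<open>v\<close> and inverts \<open>w\<close>.\<close>

locale two_generated = simple_nonabelian G for G (structure) +
  fixes x y
  assumes x [simp]: "x \<in> carrier G" and y [simp]: "y \<in> carrier G"
    and x_sq [simp]: "x \<otimes> x = \<one>" and x_neq_one: "x \<noteq> \<one>"
    and odd_ord_y: "odd (ord y)"
    and generate_xy: "generate G {x, y} = carrier G"
begin

definition u where "u = y \<otimes> x \<otimes> y"
definition v where "v = y \<otimes> y \<otimes> x"
definition w where "w = x \<otimes> y \<otimes> y"

lemma uvw_closed [simp]: "u \<in> carrier G" "v \<in> carrier G" "w \<in> carrier G"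
  by (simp_all add: u_def v_def w_def)

lemma inv_x [simp]: "inv x = x"
  by (rule inv_equality) simp_all

lemma x_cancel [simp]: "a \<in> carrier G \<Longrightarrow> x \<otimes> (x \<otimes> a) = a"
  by (simp flip: m_assoc)

lemmas word_simps = u_def v_def w_def m_assoc inv_mult_group inv_cancel_left

text \<open>Otherwise x would centralize a generating set, hence be central and therefore
  trivial.\<close>

lemma xy_not_commute: "x \<otimes> y \<noteq> y \<otimes> x"
proof
  assume xy: "x \<otimes> y = y \<otimes> x"
  have "b \<otimes> x = x \<otimes> b" if "b \<in> generate G {x, y}" for b
    using that
  proof induction
    case (inv h)
    then show ?case using xy by (auto intro!: commute_inv)
  next
    case (eng a b)
    then show ?case by (intro commute_mult) (simp_all add: generate_xy)
  qed (use xy in auto)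
  then have "x = \<one>" by (intro central_eq_one) (simp_all add: generate_xy)
  then show False using x_neq_one by simp
qed

text \<open>If y x y is trivial, then x y and y x both equal the inverse of y, so x and y commute.
  The lemma later shows that \<open>rel\<close>, and with it \<open>M\<close>, is
  nontrivial.\<close>

lemma u_neq_one: "u \<noteq> \<one>"
proof
  assume "u = \<one>"
  then have "y \<otimes> (x \<otimes> y) = \<one>" "y \<otimes> x \<otimes> y = \<one>" by (simp_all add: u_def m_assoc)
  then have "x \<otimes> y = inv y" "y \<otimes> x = inv y" by (metis inv_comm inv_equality m_closed x y)+
  then show False using xy_not_commute by simp
qed

text \<open>The product v w is the fourth power of y, which generates the same cyclic group as y
  because the order of y is odd; then x is recovered from u. Elements of \<open>Phi2\<close> are
  thus determined by the three values prescribed for them.\<close>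

lemma generate_uvw: "generate G {u, v, w} = carrier G"
proof -
  let ?K = "generate G {u, v, w}"
  have K: "subgroup ?K G" by (rule generate_is_subgroup) simp
  interpret K: subgroup ?K G by (rule K)
  obtain n where n: "ord y = 2 * n + 1" using odd_ord_y by (blast elim: oddE)
  then have "y [^] (2 * n + 1) = \<one>" using pow_ord_eq_1[of y] by simp
  then have y1: "y [^] (2 * n + 2) = y" by simp
  have "v \<otimes> w = y [^] (4::nat)" by (simp add: word_simps numeral_eq_Suc)
  moreover have "v \<otimes> w \<in> ?K" by (simp add: generate.incl)
  \<comment> \<open>With order 2n+1, the exponent 2n+2 fixes y; applying it twice gives the exponent
    4(n+1)(n+1).\<close>
  ultimately have "(y [^] (4::nat)) [^] ((n + 1) * (n + 1)) \<in> ?K"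
    using subgroup_int_pow_closed[OF K, of _ "int ((n + 1) * (n + 1))"] by (simp only: int_pow_int)
  also have "(y [^] (4::nat)) [^] ((n + 1) * (n + 1)) = y [^] (4 * ((n + 1) * (n + 1)))"
    by (simp only: nat_pow_pow y)
  also have "4 * ((n + 1) * (n + 1)) = (2 * n + 2) * (2 * n + 2)"
    by (simp add: algebra_simps)
  also have "y [^] \<dots> = (y [^] (2 * n + 2)) [^] (2 * n + 2)"
    by (simp only: nat_pow_pow y)
  finally have yK: "y \<in> ?K" by (simp only: y1)
  have "x = inv y \<otimes> u \<otimes> inv y" by (simp add: word_simps)
  moreover have "inv y \<otimes> u \<otimes> inv y \<in> ?K"
    by (intro K.m_closed K.m_inv_closed yK) (simp add: generate.incl)
  ultimately have "x \<in> ?K" by simp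
  then have "generate G {x, y} \<subseteq> ?K" using yK K by (intro generate_subgroup_incl) auto
  then show ?thesis using K.subset by (simp add: generate_xy)
qed

lemma hom_eq_uvw:
  assumes "f \<in> hom G G" "g \<in> hom G G" "f u = g u" "f v = g v" "f w = g w" "s \<in> carrier G"
  shows "f s = g s"
  using hom_eq_on_generate[OF is_group assms(1,2), of "{u, v, w}" s] assms by (auto simp: generate_uvw)

lemma hom_comp: "f \<in> hom G G \<Longrightarrow> g \<in> hom G G \<Longrightarrow> (\<lambda>s. g (f s)) \<in> hom G G"
  by (auto simp: hom_def Pi_iff)

lemma conj_hom: "a \<in> carrier G \<Longrightarrow> (\<lambda>s. a \<otimes> s \<otimes> inv a) \<in> hom G G"
  by (auto simp: hom_def m_assoc inv_cancel_left)

lemma conj_hom': "a \<in> carrier G \<Longrightarrow> (\<lambda>s. inv a \<otimes> s \<otimes> a) \<in> hom G G"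
  by (auto simp: hom_def m_assoc inv_cancel_left)

lemma y_pow: "y [^] (2::nat) = y \<otimes> y" "y [^] (-2::int) = inv y \<otimes> inv y"
proof -
  show "y [^] (2::nat) = y \<otimes> y" by (simp add: numeral_eq_Suc)
  then show "y [^] (-2::int) = inv y \<otimes> inv y"
    using int_pow_neg_int[of y 2] by (simp add: inv_mult_group)
qed

text \<open>An element is determined by its inner automorphism, since a times the inverse of b is
  central. This recovers twists and coordinates from their conjugation action.\<close>

lemma conj_eqD:
  assumes a: "a \<in> carrier G" and b: "b \<in> carrier G"
    and eq: "\<And>t. t \<in> carrier G \<Longrightarrow> inv a \<otimes> t \<otimes> a = inv b \<otimes> t \<otimes> b"
  shows "a = b"
proof -
  have "(a \<otimes> inv b) \<otimes> t = t \<otimes> (a \<otimes> inv b)" if t: "t \<in> carrier G" for t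
  proof -
    have "t \<otimes> (a \<otimes> inv b) = a \<otimes> (inv a \<otimes> t \<otimes> a) \<otimes> inv b"
      using a b t by (simp add: m_assoc inv_cancel_left)
    also have "\<dots> = (a \<otimes> inv b) \<otimes> t"
      unfolding eq[OF t] using a b t by (simp add: m_assoc)
    finally show ?thesis by simp
  qed
  then have "a \<otimes> inv b = \<one>" using a b by (intro central_eq_one) simp_all
  then show ?thesis using a b inv_equality[of a "inv b"] by simp
qed

end

section \<open>Relations between elements of \<open>Phi1\<close> and \<open>Phi2\<close>\<close>

locale two_generated_Phi = two_generated G x y for G (structure) and x y +
  fixes p1 p2
  assumes p1: "p1 \<in> Phi1 G x y" and p2: "p2 \<in> Phi2 G x y"
begin

lemma p1_hom: "p1 \<in> hom G G" and p2_hom: "p2 \<in> hom G G"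
  using p1 p2 by (auto simp: Phi1_def Phi2_def auto_def)

sublocale P1: group_hom G G p1
  using p1_hom by unfold_locales

sublocale P2: group_hom G G p2
  using p2_hom by unfold_locales

lemma p_gen [simp]:
  "p1 x = x" "p1 y = inv y" "p2 u = v" "p2 v = u" "p2 w = inv w"
proof -
  show "p1 x = x" "p1 y = inv y" using p1 by (auto simp: Phi1_def)
  show "p2 u = v" "p2 v = u" "p2 w = inv w"
    using p2 by (auto simp: Phi2_def y_pow u_def v_def w_def m_assoc inv_mult_group)
qed

lemma p1_uvw [simp]: "p1 u = inv u" "p1 v = inv w" "p1 w = inv v"
  by (simp_all add: word_simps)

lemma p1_p1 [simp]: "s \<in> carrier G \<Longrightarrow> p1 (p1 s) = s"
  by (rule hom_eq_uvw[where f = "\<lambda>s. p1 (p1 s)" and g = "\<lambda>s. s"]) (auto simp: hom_def)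

lemma p2_p2 [simp]: "s \<in> carrier G \<Longrightarrow> p2 (p2 s) = s"
  by (rule hom_eq_uvw[where f = "\<lambda>s. p2 (p2 s)" and g = "\<lambda>s. s"]) (auto simp: hom_def)

text \<open>Both maps permute u, v, w and their inverses, so the identity is checked on these
  generators. Together with \<open>p1_p1\<close> and \<open>p2_p2\<close> these are the Coxeter
  relations of S_3.\<close>

lemma p_braid: "s \<in> carrier G \<Longrightarrow> p2 (p1 (p2 s)) = p1 (p2 (p1 s))"
  by (rule hom_eq_uvw[where f = "\<lambda>s. p2 (p1 (p2 s))" and g = "\<lambda>s. p1 (p2 (p1 s))"])
    (auto simp: hom_def)

text \<open>This identity and \<open>p1_p2_conj_y\<close> express the compatibility of the twists of
  g with p1 and p2 that \<open>link_if_Phi12\<close> requires. Both sides are homomorphisms, hence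
  compared on u, v, w.\<close>

lemma p2_conj_y:
  assumes "s \<in> carrier G"
  shows "p2 (inv y \<otimes> s \<otimes> y) = x \<otimes> p2 (p1 s) \<otimes> x"
proof (rule hom_eq_uvw[where f = "\<lambda>s. p2 (inv y \<otimes> s \<otimes> y)" and g = "\<lambda>s. x \<otimes> p2 (p1 s) \<otimes> x"])
  show "(\<lambda>s. p2 (inv y \<otimes> s \<otimes> y)) \<in> hom G G"
    using hom_comp[OF conj_hom'[OF y] p2_hom] by simp
  show "(\<lambda>s. x \<otimes> p2 (p1 s) \<otimes> x) \<in> hom G G"
    using hom_comp[OF hom_comp[OF p1_hom p2_hom] conj_hom[OF x]] by simp
  \<comment> \<open>The values of p2 are known on u, v, w only, so each conjugate is first rewritten
    as a word in these.\<close>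
  have "inv y \<otimes> u \<otimes> y = w" by (simp add: word_simps)
  then show "p2 (inv y \<otimes> u \<otimes> y) = x \<otimes> p2 (p1 u) \<otimes> x"
    by simp (simp add: word_simps)
  have "inv y \<otimes> v \<otimes> y = u" by (simp add: word_simps)
  then show "p2 (inv y \<otimes> v \<otimes> y) = x \<otimes> p2 (p1 v) \<otimes> x"
    by simp (simp add: word_simps)
  have "inv y \<otimes> w \<otimes> y = inv u \<otimes> (v \<otimes> w)" by (simp add: word_simps)
  then show "p2 (inv y \<otimes> w \<otimes> y) = x \<otimes> p2 (p1 w) \<otimes> x"
    by simp (simp add: word_simps)
qed (use assms in simp)

lemma p1_p2_conj_y:
  assumes "s \<in> carrier G"
  shows "y \<otimes> p1 (p2 s) \<otimes> inv y = p2 (y \<otimes> p1 s \<otimes> inv y)"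
proof (rule hom_eq_uvw[where f = "\<lambda>s. y \<otimes> p1 (p2 s) \<otimes> inv y" and g = "\<lambda>s. p2 (y \<otimes> p1 s \<otimes> inv y)"])
  show "(\<lambda>s. y \<otimes> p1 (p2 s) \<otimes> inv y) \<in> hom G G"
    using hom_comp[OF hom_comp[OF p2_hom p1_hom] conj_hom[OF y]] by simp
  show "(\<lambda>s. p2 (y \<otimes> p1 s \<otimes> inv y)) \<in> hom G G"
    using hom_comp[OF p1_hom hom_comp[OF conj_hom[OF y] p2_hom]] by simp
  have "y \<otimes> inv u \<otimes> inv y = inv v" by (simp add: word_simps)
  then show "y \<otimes> p1 (p2 u) \<otimes> inv y = p2 (y \<otimes> p1 u \<otimes> inv y)"
    by simp (simp add: word_simps)
  have "y \<otimes> inv w \<otimes> inv y = inv u" by (simp add: word_simps)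
  then show "y \<otimes> p1 (p2 v) \<otimes> inv y = p2 (y \<otimes> p1 v \<otimes> inv y)"
    by simp (simp add: word_simps)
  have "y \<otimes> inv v \<otimes> inv y = u \<otimes> (inv w \<otimes> inv v)" by (simp add: word_simps)
  then show "y \<otimes> p1 (p2 w) \<otimes> inv y = p2 (y \<otimes> p1 w \<otimes> inv y)"
    by simp (simp add: word_simps)
qed (use assms in simp)

end


section \<open>The copy of \<open>S\<^sub>4\<close> in \<open>S\<^sub>6\<close>\<close>

text \<open>The three permutations generate a copy of \<open>S\<^sub>4\<close> acting on 6 points (the faces of a cube).
  Each of its elements is listed with its image under the isomorphism to \<open>S\<^sub>4\<close> that sends the
  generators to \<open>(2 3 4)\<close>, \<open>(3 4)\<close>, \<open>(1 2)\<close>; a permutation is given by its list of values.\<close>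

definition S4_table :: "(nat list \<times> nat list) list" where
  "S4_table = [
    ([1, 2, 3, 4, 5, 6], [1, 2, 3, 4]),
    ([4, 3, 5, 6, 2, 1], [1, 3, 4, 2]),
    ([3, 4, 1, 2, 6, 5], [1, 2, 4, 3]),
    ([4, 3, 2, 1, 6, 5], [2, 1, 3, 4]),
    ([6, 5, 2, 1, 3, 4], [1, 4, 2, 3]),
    ([2, 1, 6, 5, 4, 3], [1, 4, 3, 2]),
    ([1, 2, 6, 5, 3, 4], [2, 3, 4, 1]),
    ([5, 6, 4, 3, 1, 2], [1, 3, 2, 4]),
    ([2, 1, 4, 3, 5, 6], [2, 1, 4, 3]),
    ([6, 5, 3, 4, 1, 2], [3, 1, 4, 2]),
    ([5, 6, 3, 4, 2, 1], [2, 4, 1, 3]),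
    ([3, 4, 5, 6, 1, 2], [2, 4, 3, 1]),
    ([4, 3, 1, 2, 5, 6], [3, 4, 2, 1]),
    ([6, 5, 1, 2, 4, 3], [2, 3, 1, 4]),
    ([3, 4, 6, 5, 2, 1], [3, 1, 2, 4]),
    ([1, 2, 5, 6, 4, 3], [4, 1, 2, 3]),
    ([5, 6, 1, 2, 3, 4], [4, 1, 3, 2]),
    ([5, 6, 2, 1, 4, 3], [3, 2, 4, 1]),
    ([2, 1, 5, 6, 3, 4], [3, 2, 1, 4]),
    ([6, 5, 4, 3, 2, 1], [4, 2, 3, 1]),
    ([2, 1, 3, 4, 6, 5], [4, 3, 2, 1]),
    ([1, 2, 4, 3, 6, 5], [3, 4, 1, 2]),
    ([4, 3, 6, 5, 1, 2], [4, 2, 1, 3]),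
    ([3, 4, 2, 1, 5, 6], [4, 3, 1, 2])]"

definition sig1 :: "nat \<Rightarrow> nat" where "sig1 = h1_perm"
definition sig2 :: "nat \<Rightarrow> nat" where "sig2 = h2_perm"
definition sig3 :: "nat \<Rightarrow> nat" where "sig3 = delta_perm"
definition tau1 :: "nat \<Rightarrow> nat" where "tau1 = transpose 2 3 \<circ> transpose 3 4"
definition tau2 :: "nat \<Rightarrow> nat" where "tau2 = transpose 3 4"
definition tau3 :: "nat \<Rightarrow> nat" where "tau3 = transpose 1 2"

lemmas sig_defs = sig1_def sig2_def sig3_def
lemmas tau_defs = tau1_def tau2_def tau3_def

definition plist :: "(nat \<Rightarrow> nat) \<Rightarrow> nat list" where
  "plist \<sigma> = map \<sigma> [1, 2, 3, 4, 5, 6]"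

definition S4_perm :: "(nat \<Rightarrow> nat) \<Rightarrow> bool" where
  "S4_perm \<sigma> \<longleftrightarrow> \<sigma> permutes {1..6} \<and> plist \<sigma> \<in> fst ` set S4_table"

text \<open>The identity outside {1..4} makes \<open>theta \<sigma>\<close> a permutation in the
  sense of \<open>permutes\<close>. Only permutations listed in the table give a meaningful
  value.\<close>

definition theta :: "(nat \<Rightarrow> nat) \<Rightarrow> nat \<Rightarrow> nat" where
  "theta \<sigma> = (\<lambda>k. if k \<in> {1..4} then the (map_of S4_table (plist \<sigma>)) ! (k - 1) else k)"

lemma ball_six: "(\<forall>i\<in>{1..6::nat}. P i) \<longleftrightarrow> P 1 \<and> P 2 \<and> P 3 \<and> P 4 \<and> P 5 \<and> P 6"
proof -
  have "{1..6::nat} = {1, 2, 3, 4, 5, 6}" by auto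
  then show ?thesis by simp
qed

lemma ball_four: "(\<forall>i\<in>{1..4::nat}. P i) \<longleftrightarrow> P 1 \<and> P 2 \<and> P 3 \<and> P 4"
proof -
  have "{1..4::nat} = {1, 2, 3, 4}" by auto
  then show ?thesis by simp
qed

lemma perm_values:
  "sig1 1 = 4" "sig1 2 = 3" "sig1 3 = 5" "sig1 4 = 6" "sig1 5 = 2" "sig1 6 = 1"
  "sig2 1 = 3" "sig2 2 = 4" "sig2 3 = 1" "sig2 4 = 2" "sig2 5 = 6" "sig2 6 = 5"
  "sig3 1 = 4" "sig3 2 = 3" "sig3 3 = 2" "sig3 4 = 1"
  "sig3 5 = 6" "sig3 6 = 5"
  by (simp_all add: sig_defs transpose_def)

lemma perm_permutes:
  "sig1 permutes {1..6}" "sig2 permutes {1..6}" "sig3 permutes {1..6}"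
  unfolding sig_defs by (intro permutes_compose permutes_subset[OF cycle_permutes]; simp)+

lemma k_permutes:
  "tau1 permutes {1..4}" "tau2 permutes {1..4}" "tau3 permutes {1..4}"
  unfolding tau_defs by (intro permutes_compose permutes_swap_id; simp)+

lemma k_values:
  "tau1 1 = 1" "tau1 2 = 3" "tau1 3 = 4" "tau1 4 = 2"
  "tau2 1 = 1" "tau2 2 = 2" "tau2 3 = 4" "tau2 4 = 3"
  "tau3 1 = 2" "tau3 2 = 1" "tau3 3 = 3" "tau3 4 = 4"
  by (simp_all add: tau_defs transpose_def)

text \<open>A check of the 24 rows. As permutations act on the right, applying a generator to the
  values is right multiplication, so closure propagates membership and the values of
  \<open>theta\<close> to all words in the generators.\<close>

lemma S4_table_closed:
  assumes "(l, q) \<in> set S4_table"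
  shows "(map sig1 l, map tau1 q) \<in> set S4_table"
    and "(map sig2 l, map tau2 q) \<in> set S4_table"
    and "(map sig3 l, map tau3 q) \<in> set S4_table"
proof -
  have "\<forall>p\<in>set S4_table. (map sig1 (fst p), map tau1 (snd p)) \<in> set S4_table"
    "\<forall>p\<in>set S4_table. (map sig2 (fst p), map tau2 (snd p)) \<in> set S4_table"
    "\<forall>p\<in>set S4_table. (map sig3 (fst p), map tau3 (snd p)) \<in> set S4_table"
    by (simp_all add: S4_table_def perm_values k_values del: One_nat_def)
  then show "(map sig1 l, map tau1 q) \<in> set S4_table"
    "(map sig2 l, map tau2 q) \<in> set S4_table"
    "(map sig3 l, map tau3 q) \<in> set S4_table"
    using assms by fastforce+
qed

lemma S4_table_distinct: "distinct (map fst S4_table)" "distinct (map snd S4_table)"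
  by (simp_all add: S4_table_def)

lemma S4_table_length: "(l, q) \<in> set S4_table \<Longrightarrow> length q = 4"
  unfolding S4_table_def by auto

lemma theta_table:
  assumes "(plist \<sigma>, q) \<in> set S4_table"
  shows "map (theta \<sigma>) [1, 2, 3, 4] = q"
proof -
  have "map_of S4_table (plist \<sigma>) = Some q"
    using S4_table_distinct(1) assms by simp
  moreover have "length q = 4" using S4_table_length assms .
  then obtain a b c d where "q = [a, b, c, d]"
    by (auto simp: numeral_eq_Suc length_Suc_conv)
  ultimately show ?thesis by (simp add: theta_def)
qed

lemma S4_permE:
  assumes "S4_perm \<sigma>"
  shows "(plist \<sigma>, map (theta \<sigma>) [1, 2, 3, 4]) \<in> set S4_table"
  using assms theta_table unfolding S4_perm_def by force

lemma theta_eqI: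
  assumes "map (theta \<sigma>) [1, 2, 3, 4] = map k [1, 2, 3, 4]" "k permutes {1..4}"
  shows "theta \<sigma> = k"
proof
  fix i
  show "theta \<sigma> i = k i"
  proof (cases "i \<in> {1..4}")
    case True
    moreover have "\<forall>i\<in>{1..4}. theta \<sigma> i = k i" unfolding ball_four using assms(1) by simp
    ultimately show ?thesis by blast
  next
    case False
    then have "theta \<sigma> i = i" by (simp only: theta_def if_False)
    then show ?thesis using permutes_not_in[OF assms(2) False] by simp
  qed
qed

lemma S4_perm_step_aux:
  assumes \<sigma>: "S4_perm \<sigma>" and th: "theta \<sigma> permutes {1..4}"
    and s: "s permutes {1..6}" and k: "k permutes {1..4}"
    and closed: "\<And>l q. (l, q) \<in> set S4_table \<Longrightarrow> (map s l, map k q) \<in> set S4_table"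
  shows "S4_perm (s \<circ> \<sigma>)" "theta (s \<circ> \<sigma>) = k \<circ> theta \<sigma>"
proof -
  have *: "(plist (s \<circ> \<sigma>), map (k \<circ> theta \<sigma>) [1, 2, 3, 4]) \<in> set S4_table"
    using closed[OF S4_permE[OF \<sigma>]] by (simp add: plist_def)
  show "S4_perm (s \<circ> \<sigma>)"
    using \<sigma> s * by (force simp: S4_perm_def intro: permutes_compose)
  show "theta (s \<circ> \<sigma>) = k \<circ> theta \<sigma>"
    using theta_table[OF *] permutes_compose[OF th k] by (rule theta_eqI)
qed

lemmas S4_perm_step =
  S4_perm_step_aux[OF _ _ perm_permutes(1) k_permutes(1) S4_table_closed(1)]
  S4_perm_step_aux[OF _ _ perm_permutes(2) k_permutes(2) S4_table_closed(2)]
  S4_perm_step_aux[OF _ _ perm_permutes(3) k_permutes(3) S4_table_closed(3)]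

lemma S4_perm_id: "S4_perm id"
  by (simp add: S4_perm_def plist_def S4_table_def)

lemma theta_id: "theta id = id"
proof (rule theta_eqI)
  have "(plist id, [1, 2, 3, 4]) \<in> set S4_table"
    by (simp add: plist_def S4_table_def)
  from theta_table[OF this] show "map (theta id) [1, 2, 3, 4] = map id [1, 2, 3, 4]" by simp
qed (rule permutes_id)

lemma plist_inj:
  assumes "\<sigma> permutes {1..6}" "\<tau> permutes {1..6}" "plist \<sigma> = plist \<tau>"
  shows "\<sigma> = \<tau>"
proof
  fix i
  have "\<forall>i\<in>{1..6}. \<sigma> i = \<tau> i" unfolding ball_six using assms(3) by (simp add: plist_def)
  then show "\<sigma> i = \<tau> i"
    using permutes_not_in[OF assms(1)] permutes_not_in[OF assms(2)] by (cases "i \<in> {1..6}") auto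
qed

text \<open>The second column of the table has no repetitions, so only the identity row can map to
  the identity.\<close>

lemma theta_eq_id_imp:
  assumes "S4_perm \<sigma>" "theta \<sigma> = id"
  shows "\<sigma> = id"
proof -
  have "(plist \<sigma>, [1, 2, 3, 4]) \<in> set S4_table" using S4_permE[OF assms(1)] assms(2) by simp
  moreover have "(plist id, [1, 2, 3, 4]) \<in> set S4_table"
    by (simp add: plist_def S4_table_def)
  ultimately have "plist \<sigma> = plist id"
    using S4_table_distinct(2) by (metis distinct_map inj_onD prod.inject snd_conv)
  then show ?thesis using assms(1) by (intro plist_inj) (auto simp: S4_perm_def permutes_id)
qed

lemma perm_relations:
  "sig1 \<circ> (sig1 \<circ> sig1) = id" "sig2 \<circ> sig2 = id" "sig3 \<circ> sig3 = id"
  "sig2 \<circ> sig1 = sig1 \<circ> (sig1 \<circ> sig2)" "sig2 \<circ> sig3 = sig3 \<circ> sig2"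
  by (rule plist_inj; (intro permutes_compose perm_permutes permutes_id)?;
      simp add: plist_def perm_values del: One_nat_def)+


section \<open>The group \<open>Y\<close> and its quotient \<open>S\<^sub>4\<close>\<close>

context group
begin

text \<open>The rule of \<open>generate\<close> multiplies two arbitrary words. Strengthening the
  claim to preservation of P under right multiplication by b turns it into an induction on the last
  letter.\<close>

lemma generate_induct_right [consumes 2, case_names one right inv]:
  assumes S: "S \<subseteq> carrier G" and b: "b \<in> generate G S" and one: "P \<one>"
    and right: "\<And>a s. a \<in> generate G S \<Longrightarrow> P a \<Longrightarrow> s \<in> S \<Longrightarrow> P (a \<otimes> s)"
    and inv: "\<And>a s. a \<in> generate G S \<Longrightarrow> P a \<Longrightarrow> s \<in> S \<Longrightarrow> P (a \<otimes> inv s)"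
  shows "P b"
proof -
  have G: "a \<in> carrier G" if "a \<in> generate G S" for a
    using generate_in_carrier[OF S that] .
  have "\<forall>a\<in>generate G S. P a \<longrightarrow> P (a \<otimes> b)"
    using b
  proof induction
    case (eng c d)
    show ?case
    proof (intro ballI impI)
      fix a assume "a \<in> generate G S" "P a"
      then have "P (a \<otimes> c \<otimes> d)"
        using eng.IH eng.hyps generate.eng[of a G S c] by simp
      then show "P (a \<otimes> (c \<otimes> d))" using G \<open>a \<in> generate G S\<close> eng.hyps by (simp add: m_assoc)
    qed
  qed (use G right inv in auto)
  then have "P (\<one> \<otimes> b)" using one generate.one by blast
  then show ?thesis using G b by simp
qed

lemma generate_induct_left [consumes 2, case_names one left inv]:
  assumes S: "S \<subseteq> carrier G" and b: "b \<in> generate G S" and one: "P \<one>"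
    and left: "\<And>a s. a \<in> generate G S \<Longrightarrow> P a \<Longrightarrow> s \<in> S \<Longrightarrow> P (s \<otimes> a)"
    and inv: "\<And>a s. a \<in> generate G S \<Longrightarrow> P a \<Longrightarrow> s \<in> S \<Longrightarrow> P (inv s \<otimes> a)"
  shows "P b"
proof -
  have G: "a \<in> carrier G" if "a \<in> generate G S" for a
    using generate_in_carrier[OF S that] .
  have "\<forall>a\<in>generate G S. P a \<longrightarrow> P (b \<otimes> a)"
    using b
  proof induction
    case (eng c d)
    show ?case
    proof (intro ballI impI)
      fix a assume "a \<in> generate G S" "P a"
      then have "P (c \<otimes> (d \<otimes> a))"
        using eng.IH eng.hyps generate.eng[of d G S a] by simp
      then show "P (c \<otimes> d \<otimes> a)" using G \<open>a \<in> generate G S\<close> eng.hyps by (simp add: m_assoc)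
    qed
  qed (use G left inv in auto)
  then have "P (b \<otimes> \<one>)" using one generate.one by blast
  then show ?thesis using G b by simp
qed

section \<open>The wreath product as a group\<close>

lemma wreath_carrier:
  "a \<in> carrier (wreath_sym n G) \<longleftrightarrow> fst a \<in> (\<Pi>\<^sub>E i\<in>{1..n}. carrier G) \<and> snd a permutes {1..n}"
  by (cases a) (simp add: wreath_sym_def)

lemma wreath_one: "\<one>\<^bsub>wreath_sym n G\<^esub> = (\<lambda>i\<in>{1..n}. \<one>, id)"
  by (simp add: wreath_sym_def)

text \<open>The two inversions in the definition cancel, so coordinate i of the product takes the
  second factor at the image of i.\<close>

lemma wreath_mult:
  assumes "snd a permutes {1..n}"
  shows "a \<otimes>\<^bsub>wreath_sym n G\<^esub> b = (\<lambda>i\<in>{1..n}. fst a i \<otimes> fst b (snd a i), snd b \<circ> snd a)"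
proof -
  have "inv_into UNIV (inv_into UNIV (snd a)) = snd a"
    using assms permutes_bij inv_inv_eq by blast
  then show ?thesis
    by (cases a; cases b) (auto simp: wreath_sym_def coord_perm_def)
qed

lemma group_wreath: "group (wreath_sym n G)"
proof (rule groupI)
  let ?W = "wreath_sym n G"
  have in_n: "\<sigma> i \<in> {1..n}" if "\<sigma> permutes {1..n}" "i \<in> {1..n}" for \<sigma> :: "nat \<Rightarrow> nat" and i
    using that(2) permutes_in_image[OF that(1)] by simp
  show "a \<otimes>\<^bsub>?W\<^esub> b \<in> carrier ?W" if "a \<in> carrier ?W" "b \<in> carrier ?W" for a b
    using that in_n by (auto simp: wreath_carrier wreath_mult PiE_iff permutes_compose simp del: atLeastAtMost_iff)
  show "\<one>\<^bsub>?W\<^esub> \<in> carrier ?W" by (simp add: wreath_carrier wreath_one permutes_id)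
  show "a \<otimes>\<^bsub>?W\<^esub> b \<otimes>\<^bsub>?W\<^esub> c = a \<otimes>\<^bsub>?W\<^esub> (b \<otimes>\<^bsub>?W\<^esub> c)"
    if abc: "a \<in> carrier ?W" "b \<in> carrier ?W" "c \<in> carrier ?W" for a b c
  proof -
    have perms: "snd a permutes {1..n}" "snd b permutes {1..n}" "snd b \<circ> snd a permutes {1..n}"
      using abc by (simp_all add: wreath_carrier permutes_compose)
    have "fst a i \<otimes> fst b (snd a i) \<otimes> fst c (snd b (snd a i))
        = fst a i \<otimes> (fst b (snd a i) \<otimes> fst c (snd b (snd a i)))" if "i \<in> {1..n}" for i
      using abc that in_n[OF perms(1)] in_n[OF perms(2)]
      by (intro m_assoc) (auto simp: wreath_carrier PiE_iff simp del: atLeastAtMost_iff)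
    then show ?thesis
      using in_n[OF perms(1)] perms
      by (simp add: wreath_mult o_assoc cong: restrict_cong del: atLeastAtMost_iff)
  qed
  show "\<one>\<^bsub>?W\<^esub> \<otimes>\<^bsub>?W\<^esub> a = a" if a: "a \<in> carrier ?W" for a
  proof -
    have "fst a i \<in> carrier G" if "i \<in> {1..n}" for i
      using a that by (auto simp: wreath_carrier)
    then have "(\<lambda>i\<in>{1..n}. \<one> \<otimes> fst a i) = (\<lambda>i\<in>{1..n}. fst a i)"
      by (intro restrict_ext) simp
    also have "\<dots> = fst a"
      using a by (simp add: wreath_carrier PiE_iff extensional_restrict)
    finally show ?thesis
      by (simp add: wreath_mult wreath_one permutes_id cong: restrict_cong)
  qed
  show "\<exists>b\<in>carrier ?W. b \<otimes>\<^bsub>?W\<^esub> a = \<one>\<^bsub>?W\<^esub>" if a: "a \<in> carrier ?W" for a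
  proof -
    let ?\<tau> = "inv_into UNIV (snd a)"
    \<comment> \<open>In the product with a, coordinate i of this element meets coordinate
      \<open>?\<tau> i\<close> of a.\<close>
    let ?b = "(\<lambda>i\<in>{1..n}. inv (fst a (?\<tau> i)), ?\<tau>)"
    have \<tau>: "?\<tau> permutes {1..n}" using a permutes_inv by (auto simp: wreath_carrier)
    have a_in: "fst a i \<in> carrier G" if "i \<in> {1..n}" for i
      using a that by (auto simp: wreath_carrier)
    have "?b \<in> carrier ?W"
      using a_in in_n[OF \<tau>] \<tau> by (simp add: wreath_carrier del: atLeastAtMost_iff)
    moreover have "?b \<otimes>\<^bsub>?W\<^esub> a = \<one>\<^bsub>?W\<^esub>"
    proof -
      have "snd a \<circ> ?\<tau> = id" using a permutes_inv_o(1) by (auto simp: wreath_carrier)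
      moreover have "inv (fst a (?\<tau> i)) \<otimes> fst a (?\<tau> i) = \<one>" if "i \<in> {1..n}" for i
        using a_in[OF in_n[OF \<tau> that]] by simp
      ultimately show ?thesis
        using \<tau> by (simp add: wreath_mult wreath_one cong: restrict_cong)
    qed
    ultimately show ?thesis by blast
  qed
qed

lemma finite_wreath: "finite (carrier G) \<Longrightarrow> finite (carrier (wreath_sym n G))"
  by (simp add: wreath_sym_def finite_PiE finite_permutations)

end

declare One_nat_def [simp del] atLeastAtMost_iff [simp del]

lemma in_six [simp]: "1 \<in> {1..6::nat}" "2 \<in> {1..6::nat}" "3 \<in> {1..6::nat}" "4 \<in> {1..6::nat}"
    "5 \<in> {1..6::nat}" "6 \<in> {1..6::nat}"
  and in_four [simp]: "1 \<in> {1..4::nat}" "2 \<in> {1..4::nat}" "3 \<in> {1..4::nat}" "4 \<in> {1..4::nat}"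
  by (simp_all add: atLeastAtMost_iff)

section \<open>Generators and relations of \<open>Y\<close>\<close>

locale cover = two_generated G x y for G (structure) and x y +
  assumes finite_G: "finite (carrier G)"
begin

abbreviation "W \<equiv> wreath_sym 6 G"
abbreviation "Y \<equiv> Y_grp G x y"
abbreviation "H \<equiv> H_grp G"
abbreviation "g \<equiv> g_elt G x y"
abbreviation "f \<equiv> f_elt G x y"
abbreviation th :: "(nat \<Rightarrow> 'a) \<times> (nat \<Rightarrow> nat) \<Rightarrow> nat \<Rightarrow> nat" where "th a \<equiv> theta (snd a)"

text \<open>\<open>a1\<close> and \<open>a2\<close> are h1 and h2 as elements of the wreath
  product.\<close>

definition "a1 = wr_top 6 G sig1"
definition "a2 = wr_top 6 G sig2"

lemma H_def: "H = generate W {a1, a2}"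
  by (simp add: H_grp_def a1_def a2_def sig1_def sig2_def)

sublocale W: group "wreath_sym 6 G"
  by (rule group_wreath)

sublocale Y: group "Y_grp G x y"
  unfolding Y_grp_def by (rule W.group_subgroup_generated)

lemma f_values: "f 1 = y" "f 2 = inv y" "f 3 = y" "f 4 = inv y" "f 5 = x" "f 6 = x"
  by (simp_all add: f_elt_def)

lemma f_PiE: "f \<in> (\<Pi>\<^sub>E i\<in>{1..6}. carrier G)"
proof -
  have "\<forall>i\<in>{1..6}. f i \<in> carrier G" unfolding ball_six by (simp only: f_values) simp
  then show ?thesis by (auto simp: PiE_iff f_elt_def)
qed

lemma top_eq: "wr_top 6 G \<sigma> = (\<lambda>i\<in>{1..6}. \<one>, \<sigma>)"
  by (simp add: wr_top_def)

lemma g_eq: "g = (f, sig3)"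
proof -
  have "(\<lambda>i\<in>{1..6}. f i \<otimes> \<one>) = (\<lambda>i\<in>{1..6}. f i)"
    using f_PiE by (intro restrict_ext) (auto simp: PiE_iff)
  also have "\<dots> = f" using f_PiE by (simp add: PiE_iff extensional_restrict)
  finally show ?thesis
    unfolding g_elt_def sig3_def
    by (simp add: wreath_mult wr_base_def permutes_id top_eq cong: restrict_cong)
qed

lemma gens_W: "a1 \<in> carrier W" "a2 \<in> carrier W" "g \<in> carrier W"
  using perm_permutes f_PiE by (simp_all add: wreath_carrier a1_def a2_def top_eq g_eq)

lemma H_sub_W: "H \<subseteq> carrier W"
  unfolding H_def by (rule W.generate_incl) (use gens_W in simp)

lemma carrier_Y: "carrier Y = generate W {a1, a2, g}"
proof -
  have "carrier Y = generate W (H \<union> {g})"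
    using H_sub_W gens_W by (simp add: Y_grp_def carrier_subgroup_generated Int_absorb1)
  also have "\<dots> = generate W {a1, a2, g}"
  proof
    have "H \<subseteq> generate W {a1, a2, g}"
      unfolding H_def by (rule W.mono_generate) simp
    then show "generate W (H \<union> {g}) \<subseteq> generate W {a1, a2, g}"
      using gens_W by (intro W.generate_subgroup_incl W.generate_is_subgroup) (auto intro: generate.incl)
    have "{a1, a2} \<subseteq> H" unfolding H_def by (auto intro: generate.incl)
    then show "generate W {a1, a2, g} \<subseteq> generate W (H \<union> {g})"
      by (intro W.mono_generate) auto
  qed
  finally show ?thesis .
qed

lemma mult_Y [simp]: "(\<otimes>\<^bsub>Y\<^esub>) = (\<otimes>\<^bsub>W\<^esub>)" and one_Y: "\<one>\<^bsub>Y\<^esub> = \<one>\<^bsub>W\<^esub>"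
  by (simp_all add: Y_grp_def)

lemma gens_Y [simp]: "a1 \<in> carrier Y" "a2 \<in> carrier Y" "g \<in> carrier Y"
  unfolding carrier_Y by (simp_all add: generate.incl)

lemma Y_sub_W: "carrier Y \<subseteq> carrier W"
  unfolding carrier_Y by (rule W.generate_incl) (use gens_W in simp)

lemma finite_Y: "finite (carrier Y)"
  using finite_subset[OF Y_sub_W] finite_wreath finite_G by blast

lemma Y_perm: "a \<in> carrier Y \<Longrightarrow> snd a permutes {1..6}"
  and Y_coord: "a \<in> carrier Y \<Longrightarrow> i \<in> {1..6} \<Longrightarrow> fst a i \<in> carrier G"
  using subsetD[OF Y_sub_W, of a] by (auto simp: wreath_carrier)

lemma Y_perm_in: "a \<in> carrier Y \<Longrightarrow> i \<in> {1..6} \<Longrightarrow> snd a i \<in> {1..6}"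
  using permutes_in_image[OF Y_perm] by simp

lemma snd_mult: "a \<in> carrier Y \<Longrightarrow> snd (a \<otimes>\<^bsub>W\<^esub> b) = snd b \<circ> snd a"
  and fst_mult: "a \<in> carrier Y \<Longrightarrow> i \<in> {1..6} \<Longrightarrow> fst (a \<otimes>\<^bsub>W\<^esub> b) i = fst a i \<otimes> fst b (snd a i)"
  using Y_perm by (simp_all add: wreath_mult)

lemma snd_one: "snd \<one>\<^bsub>Y\<^esub> = id" and fst_one: "i \<in> {1..6} \<Longrightarrow> fst \<one>\<^bsub>Y\<^esub> i = \<one>"
  by (simp_all add: one_Y wreath_one)

lemma snd_gens [simp]: "snd a1 = sig1" "snd a2 = sig2" "snd g = sig3"
  and fst_a: "i \<in> {1..6} \<Longrightarrow> fst a1 i = \<one>" "i \<in> {1..6} \<Longrightarrow> fst a2 i = \<one>"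
  and fst_g: "fst g = f"
  by (simp_all add: a1_def a2_def top_eq g_eq)

lemma Y_eqI:
  assumes "a \<in> carrier Y" "b \<in> carrier Y" "snd a = snd b" "\<And>i. i \<in> {1..6} \<Longrightarrow> fst a i = fst b i"
  shows "a = b"
proof -
  have "fst a \<in> (\<Pi>\<^sub>E i\<in>{1..6}. carrier G)" "fst b \<in> (\<Pi>\<^sub>E i\<in>{1..6}. carrier G)"
    using subsetD[OF Y_sub_W, of a] subsetD[OF Y_sub_W, of b] assms(1,2) by (auto simp: wreath_carrier)
  then have "fst a = fst b" using assms(4) by (rule PiE_ext)
  then show ?thesis using assms(3) by (simp add: prod_eq_iff)
qed

lemma Y_closed [simp]: "a \<in> carrier Y \<Longrightarrow> b \<in> carrier Y \<Longrightarrow> a \<otimes>\<^bsub>W\<^esub> b \<in> carrier Y"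
  using Y.m_closed by simp

lemma Y_assoc: "a \<in> carrier Y \<Longrightarrow> b \<in> carrier Y \<Longrightarrow> c \<in> carrier Y
    \<Longrightarrow> a \<otimes>\<^bsub>W\<^esub> b \<otimes>\<^bsub>W\<^esub> c = a \<otimes>\<^bsub>W\<^esub> (b \<otimes>\<^bsub>W\<^esub> c)"
  using Y.m_assoc by simp

lemma Y_one [simp]: "a \<in> carrier Y \<Longrightarrow> a \<otimes>\<^bsub>W\<^esub> \<one>\<^bsub>Y\<^esub> = a" "a \<in> carrier Y \<Longrightarrow> \<one>\<^bsub>Y\<^esub> \<otimes>\<^bsub>W\<^esub> a = a"
  using Y.r_one Y.l_one by simp_all

lemma sig_in [simp]: "i \<in> {1..6} \<Longrightarrow> sig1 i \<in> {1..6}" "i \<in> {1..6} \<Longrightarrow> sig2 i \<in> {1..6}"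
  "i \<in> {1..6} \<Longrightarrow> sig3 i \<in> {1..6}"
  using Y_perm_in[OF gens_Y(1)] Y_perm_in[OF gens_Y(2)] Y_perm_in[OF gens_Y(3)] by simp_all

lemma top_relations:
  "a1 \<otimes>\<^bsub>W\<^esub> (a1 \<otimes>\<^bsub>W\<^esub> a1) = \<one>\<^bsub>Y\<^esub>" "a2 \<otimes>\<^bsub>W\<^esub> a2 = \<one>\<^bsub>Y\<^esub>"
  "a1 \<otimes>\<^bsub>W\<^esub> a2 = a2 \<otimes>\<^bsub>W\<^esub> (a1 \<otimes>\<^bsub>W\<^esub> a1)"
  by (rule Y_eqI; simp add: snd_mult fst_mult fst_one snd_one fst_a perm_relations o_assoc[symmetric])+

text \<open>Both hold by the pattern of \<open>f\<close>: its values at i and at the image of i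
  under \<open>sig3\<close> are mutually inverse, and it is constant on the cycles of
  \<open>sig2\<close>.\<close>

lemma g_relations: "g \<otimes>\<^bsub>W\<^esub> g = \<one>\<^bsub>Y\<^esub>" "g \<otimes>\<^bsub>W\<^esub> a2 = a2 \<otimes>\<^bsub>W\<^esub> g"
proof -
  have "\<forall>i\<in>{1..6}. fst (g \<otimes>\<^bsub>W\<^esub> g) i = \<one>"
    unfolding ball_six by (simp add: fst_mult fst_g perm_values f_values)
  then show "g \<otimes>\<^bsub>W\<^esub> g = \<one>\<^bsub>Y\<^esub>"
    by (intro Y_eqI) (simp_all add: snd_mult snd_one perm_relations fst_one)
  have "\<forall>i\<in>{1..6}. fst (g \<otimes>\<^bsub>W\<^esub> a2) i = fst (a2 \<otimes>\<^bsub>W\<^esub> g) i"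
    unfolding ball_six by (simp add: fst_mult fst_g fst_a perm_values f_values)
  then show "g \<otimes>\<^bsub>W\<^esub> a2 = a2 \<otimes>\<^bsub>W\<^esub> g"
    by (intro Y_eqI) (simp_all add: snd_mult perm_relations)
qed

lemma inv_gens:
  "inv\<^bsub>W\<^esub> a1 = a1 \<otimes>\<^bsub>W\<^esub> a1" "inv\<^bsub>W\<^esub> a2 = a2" "inv\<^bsub>W\<^esub> g = g"
  using top_relations g_relations Y_assoc[of a1 a1 a1] gens_W
  by (auto simp: one_Y intro!: W.inv_equality)

text \<open>The generators have finite order, so their inverses are positive words and need no cases
  of their own.\<close>

lemma Y_induct_right [consumes 1, case_names one h1 h2 g]:
  assumes b: "b \<in> carrier Y" and one: "P \<one>\<^bsub>Y\<^esub>"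
    and h1: "\<And>a. a \<in> carrier Y \<Longrightarrow> P a \<Longrightarrow> P (a \<otimes>\<^bsub>W\<^esub> a1)"
    and h2: "\<And>a. a \<in> carrier Y \<Longrightarrow> P a \<Longrightarrow> P (a \<otimes>\<^bsub>W\<^esub> a2)"
    and g: "\<And>a. a \<in> carrier Y \<Longrightarrow> P a \<Longrightarrow> P (a \<otimes>\<^bsub>W\<^esub> g)"
  shows "P b"
proof (rule W.generate_induct_right[of "{a1, a2, g}"])
  show "P (a \<otimes>\<^bsub>W\<^esub> inv\<^bsub>W\<^esub> s)" if "a \<in> generate W {a1, a2, g}" "P a" "s \<in> {a1, a2, g}" for a s
    using that h1[of a] h1[of "a \<otimes>\<^bsub>W\<^esub> a1"] h2[of a] g[of a] by (auto simp: inv_gens Y_assoc simp flip: carrier_Y)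
qed (use assms gens_W in \<open>auto simp: one_Y simp flip: carrier_Y\<close>)

lemma Y_induct_left [consumes 1, case_names one h1 h2 g]:
  assumes b: "b \<in> carrier Y" and one: "P \<one>\<^bsub>Y\<^esub>"
    and h1: "\<And>a. a \<in> carrier Y \<Longrightarrow> P a \<Longrightarrow> P (a1 \<otimes>\<^bsub>W\<^esub> a)"
    and h2: "\<And>a. a \<in> carrier Y \<Longrightarrow> P a \<Longrightarrow> P (a2 \<otimes>\<^bsub>W\<^esub> a)"
    and g: "\<And>a. a \<in> carrier Y \<Longrightarrow> P a \<Longrightarrow> P (g \<otimes>\<^bsub>W\<^esub> a)"
  shows "P b"
proof (rule W.generate_induct_left[of "{a1, a2, g}"])
  show "P (inv\<^bsub>W\<^esub> s \<otimes>\<^bsub>W\<^esub> a)" if "a \<in> generate W {a1, a2, g}" "P a" "s \<in> {a1, a2, g}" for a s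
    using that h1[of a] h1[of "a1 \<otimes>\<^bsub>W\<^esub> a"] h2[of a] g[of a] by (auto simp: inv_gens Y_assoc simp flip: carrier_Y)
qed (use assms gens_W in \<open>auto simp: one_Y simp flip: carrier_Y\<close>)

lemma H_sub_Y: "H \<subseteq> carrier Y"
  unfolding H_def carrier_Y by (rule W.mono_generate) simp

lemma subgroup_H: "subgroup H Y"
proof -
  have "subgroup H W" "subgroup (carrier Y) W"
    unfolding H_def carrier_Y by (rule W.generate_is_subgroup; use gens_W in simp)+
  then have "subgroup H (W\<lparr>carrier := carrier Y\<rparr>)"
    using H_sub_Y by (rule W.subgroup_incl)
  moreover have "W\<lparr>carrier := carrier Y\<rparr> = Y"
    by (simp add: Y_grp_def subgroup_generated_def)
  ultimately show ?thesis by simp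
qed

lemma a_in_H [simp]: "a1 \<in> H" "a2 \<in> H"
  unfolding H_def by (simp_all add: generate.incl)

text \<open>A new letter \<open>a2\<close> is pushed to the front by
  \<open>a1 a2 = a2 a1 a1\<close>. The normal forms are those of the dihedral group of order
  6.\<close>

lemma top_normal_form:
  assumes "e \<in> {\<one>\<^bsub>Y\<^esub>, a2}" "k \<in> {\<one>\<^bsub>Y\<^esub>, a1, a1 \<otimes>\<^bsub>W\<^esub> a1}" "s \<in> {a1, a2}"
  shows "\<exists>e'\<in>{\<one>\<^bsub>Y\<^esub>, a2}. \<exists>k'\<in>{\<one>\<^bsub>Y\<^esub>, a1, a1 \<otimes>\<^bsub>W\<^esub> a1}. e \<otimes>\<^bsub>W\<^esub> k \<otimes>\<^bsub>W\<^esub> s = e' \<otimes>\<^bsub>W\<^esub> k'"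
proof -
  have r: "a1 \<otimes>\<^bsub>W\<^esub> (a1 \<otimes>\<^bsub>W\<^esub> (a1 \<otimes>\<^bsub>W\<^esub> z)) = z" "a2 \<otimes>\<^bsub>W\<^esub> (a2 \<otimes>\<^bsub>W\<^esub> z) = z"
    "a1 \<otimes>\<^bsub>W\<^esub> (a2 \<otimes>\<^bsub>W\<^esub> z) = a2 \<otimes>\<^bsub>W\<^esub> (a1 \<otimes>\<^bsub>W\<^esub> (a1 \<otimes>\<^bsub>W\<^esub> z))" if "z \<in> carrier Y" for z
    using that by (simp_all add: top_relations flip: Y_assoc)
  show ?thesis
    using assms by (auto simp: Y_assoc top_relations r)
qed

lemma H_cases:
  assumes "h \<in> H"
  shows "\<exists>e\<in>{\<one>\<^bsub>Y\<^esub>, a2}. \<exists>k\<in>{\<one>\<^bsub>Y\<^esub>, a1, a1 \<otimes>\<^bsub>W\<^esub> a1}. h = e \<otimes>\<^bsub>W\<^esub> k"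
proof (rule W.generate_induct_right[of "{a1, a2}"])
  show "h \<in> generate W {a1, a2}" using assms by (simp add: H_def)
  fix a s
  assume a: "\<exists>e\<in>{\<one>\<^bsub>Y\<^esub>, a2}. \<exists>k\<in>{\<one>\<^bsub>Y\<^esub>, a1, a1 \<otimes>\<^bsub>W\<^esub> a1}. a = e \<otimes>\<^bsub>W\<^esub> k" and s: "s \<in> {a1, a2}"
  then show *: "\<exists>e\<in>{\<one>\<^bsub>Y\<^esub>, a2}. \<exists>k\<in>{\<one>\<^bsub>Y\<^esub>, a1, a1 \<otimes>\<^bsub>W\<^esub> a1}. a \<otimes>\<^bsub>W\<^esub> s = e \<otimes>\<^bsub>W\<^esub> k"
    using top_normal_form by blast
  have "a \<in> carrier Y" using a by auto
  then have "a \<otimes>\<^bsub>W\<^esub> inv\<^bsub>W\<^esub> s = (if s = a1 then a \<otimes>\<^bsub>W\<^esub> s \<otimes>\<^bsub>W\<^esub> a1 else a \<otimes>\<^bsub>W\<^esub> s)"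
    using s by (auto simp: inv_gens Y_assoc)
  moreover have "\<exists>e\<in>{\<one>\<^bsub>Y\<^esub>, a2}. \<exists>k\<in>{\<one>\<^bsub>Y\<^esub>, a1, a1 \<otimes>\<^bsub>W\<^esub> a1}. a \<otimes>\<^bsub>W\<^esub> s \<otimes>\<^bsub>W\<^esub> a1 = e \<otimes>\<^bsub>W\<^esub> k"
  proof -
    obtain e k where "e \<in> {\<one>\<^bsub>Y\<^esub>, a2}" "k \<in> {\<one>\<^bsub>Y\<^esub>, a1, a1 \<otimes>\<^bsub>W\<^esub> a1}" "a \<otimes>\<^bsub>W\<^esub> s = e \<otimes>\<^bsub>W\<^esub> k"
      using * by (elim bexE)
    then show ?thesis using top_normal_form[of e k a1] by (simp only: insertI1)
  qed
  ultimately show "\<exists>e\<in>{\<one>\<^bsub>Y\<^esub>, a2}. \<exists>k\<in>{\<one>\<^bsub>Y\<^esub>, a1, a1 \<otimes>\<^bsub>W\<^esub> a1}. a \<otimes>\<^bsub>W\<^esub> inv\<^bsub>W\<^esub> s = e \<otimes>\<^bsub>W\<^esub> k"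
    using * by (cases "s = a1") (simp_all only: if_True if_False simp_thms)
next
  show "\<exists>e\<in>{\<one>\<^bsub>Y\<^esub>, a2}. \<exists>k\<in>{\<one>\<^bsub>Y\<^esub>, a1, a1 \<otimes>\<^bsub>W\<^esub> a1}. \<one>\<^bsub>W\<^esub> = e \<otimes>\<^bsub>W\<^esub> k"
    by (auto simp: one_Y[symmetric])
qed (use gens_W in simp)

section \<open>The homomorphism from \<open>Y\<close> onto S_4 and its kernel
  \<open>M\<close>\<close>

lemma Y_S4: "a \<in> carrier Y \<Longrightarrow> S4_perm (snd a) \<and> th a permutes {1..4}"
proof (induction rule: Y_induct_right)
  case one
  then show ?case unfolding snd_one theta_id by (intro conjI S4_perm_id permutes_id)
next
  case (h1 a)
  then show ?case
    using S4_perm_step(1,2)[of "snd a"] permutes_compose[OF _ k_permutes(1), of "th a"]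
    by (simp only: snd_mult snd_gens)
next
  case (h2 a)
  then show ?case
    using S4_perm_step(3,4)[of "snd a"] permutes_compose[OF _ k_permutes(2), of "th a"]
    by (simp only: snd_mult snd_gens)
next
  case (g a)
  then show ?case
    using S4_perm_step(5,6)[of "snd a"] permutes_compose[OF _ k_permutes(3), of "th a"]
    by (simp only: snd_mult snd_gens)
qed

lemma th_permutes: "a \<in> carrier Y \<Longrightarrow> th a permutes {1..4}"
  using Y_S4 by blast

lemma th_step:
  assumes "a \<in> carrier Y"
  shows "th (a \<otimes>\<^bsub>W\<^esub> a1) = tau1 \<circ> th a" "th (a \<otimes>\<^bsub>W\<^esub> a2) = tau2 \<circ> th a" "th (a \<otimes>\<^bsub>W\<^esub> g) = tau3 \<circ> th a"
  using Y_S4[OF assms] assms by (simp_all add: snd_mult S4_perm_step)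

lemma th_one: "th \<one>\<^bsub>Y\<^esub> = id"
  by (simp add: snd_one theta_id)

lemma th_gens: "theta sig1 = tau1" "theta sig2 = tau2" "theta sig3 = tau3"
  using th_step[OF Y.one_closed] by (simp_all add: th_one)

lemma th_mult:
  assumes a: "a \<in> carrier Y" and b: "b \<in> carrier Y"
  shows "th (a \<otimes>\<^bsub>W\<^esub> b) = th b \<circ> th a"
  using b
proof (induction rule: Y_induct_right)
  case (h1 b)
  then show ?case using a by (simp add: th_step o_assoc flip: Y_assoc)
next
  case (h2 b)
  then show ?case using a by (simp add: th_step o_assoc flip: Y_assoc)
next
  case (g b)
  then show ?case using a by (simp add: th_step o_assoc flip: Y_assoc)
qed (use a th_one in simp)

definition "M = {a \<in> carrier Y. snd a = id}"

lemma M_iff_th: "a \<in> carrier Y \<Longrightarrow> a \<in> M \<longleftrightarrow> th a = id"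
  using theta_eq_id_imp[of "snd a"] Y_S4[of a] theta_id by (auto simp: M_def)

text \<open>Transpositions generate the symmetric group. The general B and S cover both
  \<open>Y\<close> acting on {1..4} and \<open>H\<close> acting on {2..4}.\<close>

lemma th_attains:
  assumes B: "B \<subseteq> carrier Y" "\<one>\<^bsub>Y\<^esub> \<in> B" "\<And>a b. a \<in> B \<Longrightarrow> b \<in> B \<Longrightarrow> a \<otimes>\<^bsub>W\<^esub> b \<in> B"
    and S: "finite S" "\<And>i j. i \<in> S \<Longrightarrow> j \<in> S \<Longrightarrow> i < j \<Longrightarrow> \<exists>a\<in>B. th a = transpose i j"
    and \<pi>: "\<pi> permutes S"
  shows "\<exists>a\<in>B. th a = \<pi>"
  using \<pi> S(1)
proof (induction rule: permutes_induct)
  case id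
  then show ?case using B(2) th_one by blast
next
  case (swap i j p)
  then obtain a where a: "a \<in> B" "th a = p" by blast
  obtain b where b: "b \<in> B" "th b = transpose i j"
    using S(2)[of i j] S(2)[of j i] swap.hyps transpose_commute[of i j] by (metis linorder_neqE_nat)
  have "th (a \<otimes>\<^bsub>W\<^esub> b) = transpose i j \<circ> p"
    using a b th_mult[OF subsetD[OF B(1) a(1)] subsetD[OF B(1) b(1)]] by simp
  then show ?case using B(3) a b by blast
qed

lemma perm_four_eqI:
  assumes "\<sigma> permutes {1..4::nat}" "\<tau> permutes {1..4}"
    "\<sigma> 1 = \<tau> 1" "\<sigma> 2 = \<tau> 2" "\<sigma> 3 = \<tau> 3" "\<sigma> 4 = \<tau> 4"
  shows "\<sigma> = \<tau>"
proof
  fix i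
  have "\<forall>i\<in>{1..4}. \<sigma> i = \<tau> i" unfolding ball_four using assms(3-6) by simp
  then show "\<sigma> i = \<tau> i"
    using permutes_not_in[OF assms(1)] permutes_not_in[OF assms(2)] by (cases "i \<in> {1..4}") auto
qed

text \<open>One word for every transposition of four points: three from \<open>H\<close>, then g and
  its conjugates by the powers of \<open>a1\<close>.\<close>

lemma th_words: "th (a2 \<otimes>\<^bsub>W\<^esub> a1) = transpose 2 3" "th (a1 \<otimes>\<^bsub>W\<^esub> a2) = transpose 2 4"
  "th a2 = transpose 3 4" "th g = transpose 1 2"
  "th (a1 \<otimes>\<^bsub>W\<^esub> (a1 \<otimes>\<^bsub>W\<^esub> (g \<otimes>\<^bsub>W\<^esub> a1))) = transpose 1 3"
  "th (a1 \<otimes>\<^bsub>W\<^esub> (g \<otimes>\<^bsub>W\<^esub> (a1 \<otimes>\<^bsub>W\<^esub> a1))) = transpose 1 4"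
  by (rule perm_four_eqI; (intro th_permutes permutes_swap_id)?;
      simp add: th_mult th_gens k_values)+

lemma th_surj: "\<pi> permutes {1..4} \<Longrightarrow> \<exists>a\<in>carrier Y. th a = \<pi>"
proof (rule th_attains[of "carrier Y" "{1..4}"])
  have "\<forall>i\<in>{1..4}. \<forall>j\<in>{1..4}. i < j \<longrightarrow> (\<exists>a\<in>carrier Y. th a = transpose i j)"
    unfolding ball_four
    using th_words[THEN bexI[of "\<lambda>a. th a = _"]] by simp
  then show "\<exists>a\<in>carrier Y. th a = transpose i j" if "i \<in> {1..4}" "j \<in> {1..4}" "i < j" for i j
    using that by blast
qed auto

lemma th_surj_H: "\<pi> permutes {2..4} \<Longrightarrow> \<exists>h\<in>H. th h = \<pi>"
proof (rule th_attains[of H "{2..4}"])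
  have "{2..4::nat} = {2, 3, 4}" by (auto simp: atLeastAtMost_iff)
  moreover have H: "a \<otimes>\<^bsub>W\<^esub> b \<in> H" if "a \<in> H" "b \<in> H" for a b
    using that subgroup.m_closed[OF subgroup_H] by simp
  ultimately show "\<exists>a\<in>H. th a = transpose i j" if "i \<in> {2..4}" "j \<in> {2..4}" "i < j" for i j
    using that th_words(1-3)[THEN bexI[of "\<lambda>a. th a = _"], of H] by auto
  show "a \<otimes>\<^bsub>W\<^esub> b \<in> H" if "a \<in> H" "b \<in> H" for a b
    using that by (rule H)
qed (use H_sub_Y subgroup.one_closed[OF subgroup_H] in auto)

text \<open>By \<open>th_mult\<close> the map \<open>th\<close> reverses the order of products used
  in \<open>sym_group\<close>; taking inverses restores it.\<close>

lemma hom_S4: "group_hom Y (sym_group 4) (\<lambda>a. inv_into UNIV (th a))"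
proof (rule group_hom.intro[OF Y.is_group sym_group_is_group], rule group_hom_axioms.intro, rule homI)
  fix a b
  assume "a \<in> carrier Y" "b \<in> carrier Y"
  then have "bij (th a)" "bij (th b)" using th_permutes permutes_bij by blast+
  then show "inv_into UNIV (th (a \<otimes>\<^bsub>Y\<^esub> b))
      = inv_into UNIV (th a) \<otimes>\<^bsub>sym_group 4\<^esub> inv_into UNIV (th b)"
    using \<open>a \<in> carrier Y\<close> \<open>b \<in> carrier Y\<close> by (simp add: th_mult sym_group_mult o_inv_distrib)
qed (simp add: sym_group_carrier permutes_inv th_permutes)

lemma kernel_S4: "kernel Y (sym_group 4) (\<lambda>a. inv_into UNIV (th a)) = M"
proof -
  have "inv_into UNIV (th a) = id \<longleftrightarrow> a \<in> M" if "a \<in> carrier Y" for a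
    using that permutes_inv_inv[OF th_permutes[OF that]] inv_id by (metis M_iff_th)
  then show ?thesis by (auto simp: kernel_def sym_group_one M_def)
qed

lemma M_normal: "M \<lhd> Y"
  using group_hom.normal_kernel[OF hom_S4] by (simp only: kernel_S4)

lemma quotient_iso: "Y Mod M \<cong> sym_group 4"
proof -
  have "(\<lambda>a. inv_into UNIV (th a)) ` carrier Y = carrier (sym_group 4)"
  proof
    show "carrier (sym_group 4) \<subseteq> (\<lambda>a. inv_into UNIV (th a)) ` carrier Y"
    proof
      fix \<pi> assume "\<pi> \<in> carrier (sym_group 4)"
      then have \<pi>: "\<pi> permutes {1..4}" by (simp add: sym_group_carrier)
      then obtain a where "a \<in> carrier Y" "th a = inv_into UNIV \<pi>"
        using th_surj permutes_inv by blast
      then show "\<pi> \<in> (\<lambda>a. inv_into UNIV (th a)) ` carrier Y"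
        using permutes_inv_inv[OF \<pi>] by (metis image_eqI)
    qed
  qed (use th_permutes permutes_inv in \<open>force simp: sym_group_carrier\<close>)
  from group_hom.FactGroup_iso[OF hom_S4 this] show ?thesis by (simp only: kernel_S4)
qed


section \<open>The coset graph\<close>

abbreviation "\<Gamma> \<equiv> Gamma G x y"

abbreviation vert :: "(nat \<Rightarrow> 'a) \<times> (nat \<Rightarrow> nat) \<Rightarrow> ((nat \<Rightarrow> 'a) \<times> (nat \<Rightarrow> nat)) set" where
  "vert z \<equiv> H #>\<^bsub>Y\<^esub> z"

lemma verts_eq: "pverts \<Gamma> = vert ` carrier Y"
  by (auto simp: Gamma_def coset_graph_def RCOSETS_def)

lemma H_closed: "a \<in> H \<Longrightarrow> b \<in> H \<Longrightarrow> a \<otimes>\<^bsub>W\<^esub> b \<in> H" "\<one>\<^bsub>Y\<^esub> \<in> H" "a \<in> H \<Longrightarrow> inv\<^bsub>Y\<^esub> a \<in> H"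
  using subgroup.m_closed[OF subgroup_H] subgroup.one_closed[OF subgroup_H]
    subgroup.m_inv_closed[OF subgroup_H] by simp_all

lemma H_in_Y [simp]: "h \<in> H \<Longrightarrow> h \<in> carrier Y"
  using H_sub_Y by blast

lemma vert_mult: "z \<in> carrier Y \<Longrightarrow> a \<in> carrier Y \<Longrightarrow> vert z #>\<^bsub>Y\<^esub> a = vert (z \<otimes>\<^bsub>W\<^esub> a)"
  using Y.coset_mult_assoc[OF H_sub_Y] by simp

lemma vert_absorb: "h \<in> H \<Longrightarrow> z \<in> carrier Y \<Longrightarrow> vert (h \<otimes>\<^bsub>W\<^esub> z) = vert z"
  using vert_mult[of h z] Y.coset_join2[OF _ subgroup_H, of h] Y.coset_mult_one[OF H_sub_Y] vert_mult[OF Y.one_closed, of z]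
  by simp

lemma vert_eqD:
  assumes "vert z = vert z'" "z \<in> carrier Y" "z' \<in> carrier Y"
  shows "\<exists>h\<in>H. z = h \<otimes>\<^bsub>W\<^esub> z'"
proof -
  have "z \<in> vert z" using Y.rcos_self[OF assms(2) subgroup_H] .
  then show ?thesis unfolding assms(1) by (auto simp: r_coset_def)
qed

text \<open>Since \<open>th\<close> maps \<open>H\<close> into the stabilizer of 1, this depends
  only on the vertex \<open>vert z\<close>.\<close>

definition pos :: "(nat \<Rightarrow> 'a) \<times> (nat \<Rightarrow> nat) \<Rightarrow> nat" where "pos z = th z 1"

lemma th_H_one: "h \<in> H \<Longrightarrow> th h 1 = 1"
proof -
  have "\<forall>e\<in>{\<one>\<^bsub>Y\<^esub>, a2}. \<forall>k\<in>{\<one>\<^bsub>Y\<^esub>, a1, a1 \<otimes>\<^bsub>W\<^esub> a1}. th (e \<otimes>\<^bsub>W\<^esub> k) 1 = 1"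
    by (simp add: th_mult th_gens k_values snd_one theta_id)
  then show "h \<in> H \<Longrightarrow> th h 1 = 1" using H_cases by metis
qed

lemma pos_mult: "z \<in> carrier Y \<Longrightarrow> a \<in> carrier Y \<Longrightarrow> pos (z \<otimes>\<^bsub>W\<^esub> a) = th a (pos z)"
  by (simp add: pos_def th_mult)

lemma pos_H: "h \<in> H \<Longrightarrow> z \<in> carrier Y \<Longrightarrow> pos (h \<otimes>\<^bsub>W\<^esub> z) = pos z"
  using H_sub_Y th_H_one by (simp add: pos_def th_mult subset_iff)

lemma pos_in: "z \<in> carrier Y \<Longrightarrow> pos z \<in> {1..4}"
  using permutes_in_image[OF th_permutes] by (simp add: pos_def)

lemma th_inj: "z \<in> carrier Y \<Longrightarrow> th z i = th z j \<longleftrightarrow> i = j"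
  using inj_eq[OF permutes_inj[OF th_permutes[of z]]] .

text \<open>The double coset \<open>H g H\<close> consists of three right cosets of \<open>H\<close> because \<open>g\<close> commutes
  with \<open>h\<^sub>2\<close>.\<close>

abbreviation "R3 \<equiv> {\<one>\<^bsub>Y\<^esub>, a1, a1 \<otimes>\<^bsub>W\<^esub> a1}"

lemma R3_H: "k \<in> R3 \<Longrightarrow> k \<in> H"
  using H_closed(1)[of a1 a1] H_closed(2) by auto

lemma g_move:
  assumes "h \<in> H"
  shows "\<exists>e\<in>H. \<exists>k\<in>R3. g \<otimes>\<^bsub>W\<^esub> h = e \<otimes>\<^bsub>W\<^esub> (g \<otimes>\<^bsub>W\<^esub> k)"
proof -
  obtain e k where ek: "e \<in> {\<one>\<^bsub>Y\<^esub>, a2}" "k \<in> R3" "h = e \<otimes>\<^bsub>W\<^esub> k"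
    using H_cases[OF assms] by blast
  have e: "e \<in> H" using ek(1) H_closed by auto
  have k: "k \<in> carrier Y" using R3_H[OF ek(2)] by simp
  have "g \<otimes>\<^bsub>W\<^esub> e = e \<otimes>\<^bsub>W\<^esub> g" using ek(1) g_relations by auto
  then have "g \<otimes>\<^bsub>W\<^esub> h = e \<otimes>\<^bsub>W\<^esub> (g \<otimes>\<^bsub>W\<^esub> k)"
    using ek(3) e k by (simp flip: Y_assoc)
  then show ?thesis using e ek(2) by blast
qed

text \<open>The arc relation allows any representatives of both cosets. Passing to z multiplies by
  an element of \<open>H\<close> next to g, and \<open>g_move\<close> shifts all of it except a
  factor in \<open>R3\<close> to the left, where the coset absorbs it.\<close>

lemma adj_iff:
  assumes "z \<in> carrier Y" "z' \<in> carrier Y"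
  shows "(vert z, vert z') \<in> parcs \<Gamma> \<longleftrightarrow> (\<exists>k\<in>R3. vert z' = vert (g \<otimes>\<^bsub>W\<^esub> (k \<otimes>\<^bsub>W\<^esub> z)))"
proof
  assume "(vert z, vert z') \<in> parcs \<Gamma>"
  then obtain z0 z1 where z: "vert z = vert z0" "vert z' = vert z1" "z0 \<in> carrier Y" "z1 \<in> carrier Y"
    and "z1 \<otimes>\<^bsub>W\<^esub> inv\<^bsub>Y\<^esub> z0 \<in> (H #>\<^bsub>Y\<^esub> g) <#>\<^bsub>Y\<^esub> H"
    by (auto simp: Gamma_def coset_graph_def)
  then obtain h h' where h: "h \<in> H" "h' \<in> H" "z1 \<otimes>\<^bsub>W\<^esub> inv\<^bsub>Y\<^esub> z0 = h \<otimes>\<^bsub>W\<^esub> g \<otimes>\<^bsub>W\<^esub> h'"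
    by (auto simp: set_mult_def r_coset_def)
  obtain l where l: "l \<in> H" "z0 = l \<otimes>\<^bsub>W\<^esub> z" using vert_eqD[of z0 z] z assms by auto
  have "h' \<otimes>\<^bsub>W\<^esub> l \<in> H" using H_closed h l by blast
  then obtain e k where ek: "e \<in> H" "k \<in> R3" "g \<otimes>\<^bsub>W\<^esub> (h' \<otimes>\<^bsub>W\<^esub> l) = e \<otimes>\<^bsub>W\<^esub> (g \<otimes>\<^bsub>W\<^esub> k)"
    using g_move by blast
  have k: "k \<in> carrier Y" using R3_H[OF ek(2)] by simp
  have "z1 = z1 \<otimes>\<^bsub>W\<^esub> inv\<^bsub>Y\<^esub> z0 \<otimes>\<^bsub>W\<^esub> z0"
    using z Y.inv_closed[of z0] Y.l_inv[of z0] by (simp add: Y_assoc)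
  also have "\<dots> = h \<otimes>\<^bsub>W\<^esub> ((g \<otimes>\<^bsub>W\<^esub> (h' \<otimes>\<^bsub>W\<^esub> l)) \<otimes>\<^bsub>W\<^esub> z)"
    using h l assms by (simp add: Y_assoc)
  also have "\<dots> = (h \<otimes>\<^bsub>W\<^esub> e) \<otimes>\<^bsub>W\<^esub> (g \<otimes>\<^bsub>W\<^esub> (k \<otimes>\<^bsub>W\<^esub> z))"
    unfolding ek(3) using h ek k assms by (simp add: Y_assoc)
  finally have "vert z' = vert (g \<otimes>\<^bsub>W\<^esub> (k \<otimes>\<^bsub>W\<^esub> z))"
    using z(2) vert_absorb[of "h \<otimes>\<^bsub>W\<^esub> e"] H_closed(1)[OF h(1) ek(1)] k assms by simp
  then show "\<exists>k\<in>R3. vert z' = vert (g \<otimes>\<^bsub>W\<^esub> (k \<otimes>\<^bsub>W\<^esub> z))" using ek(2) by blast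
next
  assume "\<exists>k\<in>R3. vert z' = vert (g \<otimes>\<^bsub>W\<^esub> (k \<otimes>\<^bsub>W\<^esub> z))"
  then obtain k where k: "k \<in> R3" "vert z' = vert (g \<otimes>\<^bsub>W\<^esub> (k \<otimes>\<^bsub>W\<^esub> z))" by blast
  have kH: "k \<in> H" using R3_H[OF k(1)] .
  let ?z' = "g \<otimes>\<^bsub>W\<^esub> (k \<otimes>\<^bsub>W\<^esub> z)"
  have "?z' \<otimes>\<^bsub>W\<^esub> inv\<^bsub>Y\<^esub> z = (\<one>\<^bsub>Y\<^esub> \<otimes>\<^bsub>W\<^esub> g) \<otimes>\<^bsub>W\<^esub> k"
    using kH assms Y.inv_closed[of z] Y.r_inv[of z] by (simp add: Y_assoc)
  moreover have "(\<one>\<^bsub>Y\<^esub> \<otimes>\<^bsub>W\<^esub> g) \<otimes>\<^bsub>W\<^esub> k \<in> (H #>\<^bsub>Y\<^esub> g) <#>\<^bsub>Y\<^esub> H"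
    unfolding set_mult_def r_coset_def mult_Y using kH H_closed(2) by blast
  ultimately have "(vert z, vert ?z') \<in> parcs \<Gamma>"
    unfolding Gamma_def coset_graph_def pair_pre_digraph.simps mult_Y using assms kH
    by (intro CollectI exI[of _ z] exI[of _ ?z'] conjI refl) simp_all
  then show "(vert z, vert z') \<in> parcs \<Gamma>" using k(2) by simp
qed

lemma arcs_verts: "(A, B) \<in> parcs \<Gamma> \<Longrightarrow> \<exists>z\<in>carrier Y. \<exists>z'\<in>carrier Y. A = vert z \<and> B = vert z'"
  by (auto simp: Gamma_def coset_graph_def)

lemma arc_iff: "(A, B) \<in> parcs \<Gamma> \<longleftrightarrow>
    (\<exists>z\<in>carrier Y. \<exists>k\<in>R3. A = vert z \<and> B = vert (g \<otimes>\<^bsub>W\<^esub> (k \<otimes>\<^bsub>W\<^esub> z)))"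
proof
  assume AB: "(A, B) \<in> parcs \<Gamma>"
  then obtain z z' where "z \<in> carrier Y" "z' \<in> carrier Y" "A = vert z" "B = vert z'"
    using arcs_verts by blast
  then show "\<exists>z\<in>carrier Y. \<exists>k\<in>R3. A = vert z \<and> B = vert (g \<otimes>\<^bsub>W\<^esub> (k \<otimes>\<^bsub>W\<^esub> z))"
    using AB adj_iff by blast
next
  assume "\<exists>z\<in>carrier Y. \<exists>k\<in>R3. A = vert z \<and> B = vert (g \<otimes>\<^bsub>W\<^esub> (k \<otimes>\<^bsub>W\<^esub> z))"
  then obtain z k where zk: "z \<in> carrier Y" "k \<in> R3" "A = vert z" "B = vert (g \<otimes>\<^bsub>W\<^esub> (k \<otimes>\<^bsub>W\<^esub> z))"
    by blast
  moreover have "k \<in> carrier Y" using R3_H[OF zk(2)] by simp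
  ultimately show "(A, B) \<in> parcs \<Gamma>" using adj_iff[of z "g \<otimes>\<^bsub>W\<^esub> (k \<otimes>\<^bsub>W\<^esub> z)"] by auto
qed

lemma arcE:
  assumes "(A, B) \<in> parcs \<Gamma>"
  obtains z k where "z \<in> carrier Y" "k \<in> R3" "A = vert z" "B = vert (g \<otimes>\<^bsub>W\<^esub> (k \<otimes>\<^bsub>W\<^esub> z))"
  using assms unfolding arc_iff by (elim bexE conjE)

lemma arcI:
  assumes "z \<in> carrier Y" "k \<in> R3"
  shows "(vert z, vert (g \<otimes>\<^bsub>W\<^esub> (k \<otimes>\<^bsub>W\<^esub> z))) \<in> parcs \<Gamma>"
  unfolding arc_iff using assms by (intro bexI[of _ z] bexI[of _ k] conjI refl)

text \<open>Because g is an involution, g applied to the neighbour \<open>g k z\<close> returns to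
  \<open>k z\<close>, a representative of the original vertex.\<close>

lemma arc_sym: "(A, B) \<in> parcs \<Gamma> \<Longrightarrow> (B, A) \<in> parcs \<Gamma>"
proof -
  assume AB: "(A, B) \<in> parcs \<Gamma>"
  obtain z k where zk: "z \<in> carrier Y" "k \<in> R3" "A = vert z" "B = vert (g \<otimes>\<^bsub>W\<^esub> (k \<otimes>\<^bsub>W\<^esub> z))"
    by (rule arcE[OF AB])
  have k: "k \<in> H" using R3_H[OF zk(2)] .
  let ?z = "g \<otimes>\<^bsub>W\<^esub> (k \<otimes>\<^bsub>W\<^esub> z)"
  have "g \<otimes>\<^bsub>W\<^esub> (\<one>\<^bsub>Y\<^esub> \<otimes>\<^bsub>W\<^esub> ?z) = k \<otimes>\<^bsub>W\<^esub> z"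
    using zk(1) k g_relations by (simp flip: Y_assoc)
  then have "A = vert (g \<otimes>\<^bsub>W\<^esub> (\<one>\<^bsub>Y\<^esub> \<otimes>\<^bsub>W\<^esub> ?z))" using vert_absorb[OF k zk(1)] zk(3) by simp
  then show "(B, A) \<in> parcs \<Gamma>"
    using adj_iff[of ?z z] zk k by auto
qed

text \<open>As \<open>th z\<close> is a permutation and \<open>pos z\<close> is
  \<open>th z 1\<close>, a vertex and its three neighbours occupy all four positions. This excludes
  loops and makes the valency exactly 3.\<close>

lemma pos_neighbour:
  assumes z: "z \<in> carrier Y"
  shows "pos (g \<otimes>\<^bsub>W\<^esub> (\<one>\<^bsub>Y\<^esub> \<otimes>\<^bsub>W\<^esub> z)) = th z 2" "pos (g \<otimes>\<^bsub>W\<^esub> (a1 \<otimes>\<^bsub>W\<^esub> z)) = th z 3"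
    "pos (g \<otimes>\<^bsub>W\<^esub> ((a1 \<otimes>\<^bsub>W\<^esub> a1) \<otimes>\<^bsub>W\<^esub> z)) = th z 4"
  using z by (simp_all add: pos_def th_mult th_gens k_values)

lemma pos_neighbour_inj:
  assumes "z \<in> carrier Y" "k \<in> R3" "k' \<in> R3"
    "pos (g \<otimes>\<^bsub>W\<^esub> (k \<otimes>\<^bsub>W\<^esub> z)) = pos (g \<otimes>\<^bsub>W\<^esub> (k' \<otimes>\<^bsub>W\<^esub> z))"
  shows "k = k'"
  using assms(2-4) pos_neighbour[OF assms(1)] th_inj[OF assms(1)] by auto

lemma pos_vert: "vert z = vert z' \<Longrightarrow> z \<in> carrier Y \<Longrightarrow> z' \<in> carrier Y \<Longrightarrow> pos z = pos z'"
  using vert_eqD pos_H by metis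

lemma pos_neighbour_neq:
  assumes "z \<in> carrier Y" "k \<in> R3"
  shows "pos (g \<otimes>\<^bsub>W\<^esub> (k \<otimes>\<^bsub>W\<^esub> z)) \<noteq> pos z"
  using assms(2) pos_neighbour[OF assms(1)] th_inj[OF assms(1)] by (auto simp: pos_def)

section \<open>Connectedness and valency\<close>

lemma finite_verts: "finite (pverts \<Gamma>)"
  using finite_Y by (simp add: verts_eq)

lemma graph_Gamma: "Digraph.graph (with_proj \<Gamma>)"
proof -
  have sub: "parcs \<Gamma> \<subseteq> pverts \<Gamma> \<times> pverts \<Gamma>"
    using arcs_verts by (auto simp: verts_eq)
  then have fin: "finite (parcs \<Gamma>)"
    using finite_verts finite_subset by blast
  have loop: "A \<noteq> B" if AB: "(A, B) \<in> parcs \<Gamma>" for A B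
  proof
    assume "A = B"
    obtain z k where zk: "z \<in> carrier Y" "k \<in> R3" "A = vert z" "B = vert (g \<otimes>\<^bsub>W\<^esub> (k \<otimes>\<^bsub>W\<^esub> z))"
      by (rule arcE[OF AB])
    then have "k \<in> carrier Y" using R3_H[OF zk(2)] by simp
    then show False
      using pos_neighbour_neq[OF zk(1,2)] pos_vert[of z "g \<otimes>\<^bsub>W\<^esub> (k \<otimes>\<^bsub>W\<^esub> z)"] zk \<open>A = B\<close> by auto
  qed
  show ?thesis
  proof (unfold_locales)
    show "symmetric (with_proj \<Gamma>)"
      using arc_sym by (auto simp: symmetric_def sym_def)
  qed (use sub fin loop finite_verts in \<open>auto simp: arc_to_ends_def\<close>)
qed

text \<open>\<open>Y\<close> is generated by \<open>H\<close> and g: left multiplication by an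
  element of \<open>H\<close> keeps the vertex, and by g moves to an adjacent one.\<close>

lemma connected_Gamma: "Digraph_Component.connected (with_proj \<Gamma>)"
proof -
  interpret D: Digraph.graph "with_proj \<Gamma>" by (rule graph_Gamma)
  let ?V = "pverts \<Gamma>"
  have reach: "(vert \<one>\<^bsub>Y\<^esub>, vert z) \<in> rtrancl_on ?V (parcs \<Gamma>)" if "z \<in> carrier Y" for z
    using that
  proof (induction rule: Y_induct_left)
    case one
    then show ?case by (intro rtrancl_on_refl) (simp add: verts_eq)
  next
    case (g z)
    have "(vert z, vert (g \<otimes>\<^bsub>W\<^esub> z)) \<in> parcs \<Gamma>"
      using adj_iff[of z "g \<otimes>\<^bsub>W\<^esub> z"] g.hyps by auto
    moreover have "vert (g \<otimes>\<^bsub>W\<^esub> z) \<in> ?V" using g.hyps by (auto simp: verts_eq)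
    ultimately show ?case
      by (rule rtrancl_on_into_rtrancl_on[OF g.IH])
  qed (simp_all add: vert_absorb)
  have symcl: "symcl (parcs \<Gamma>) = parcs \<Gamma>" and "sym (parcs \<Gamma>)"
    using arc_sym by (auto simp: symcl_def sym_def)
  then have sym: "sym (rtrancl_on ?V (parcs \<Gamma>))" by (intro rtrancl_on_sym)
  have "(A, B) \<in> rtrancl_on ?V (parcs \<Gamma>)" if "A \<in> ?V" "B \<in> ?V" for A B
  proof -
    have "(vert \<one>\<^bsub>Y\<^esub>, A) \<in> rtrancl_on ?V (parcs \<Gamma>)" "(vert \<one>\<^bsub>Y\<^esub>, B) \<in> rtrancl_on ?V (parcs \<Gamma>)"
      using reach that by (auto simp: verts_eq)
    then show ?thesis by (rule rtrancl_on_trans[OF symD[OF sym]])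
  qed
  moreover have "?V \<noteq> {}" using Y.one_closed by (auto simp: verts_eq)
  ultimately show ?thesis by (simp add: connected_conv symcl)
qed

lemma valency_Gamma: "has_valency \<Gamma> 3"
  unfolding has_valency_def
proof
  fix A assume "A \<in> pverts \<Gamma>"
  then obtain z where z: "z \<in> carrier Y" "A = vert z" by (auto simp: verts_eq)
  let ?n = "\<lambda>k. (A, vert (g \<otimes>\<^bsub>W\<^esub> (k \<otimes>\<^bsub>W\<^esub> z)))"
  have "out_arcs (with_proj \<Gamma>) A = ?n ` R3"
  proof (intro equalityI subsetI)
    fix e assume "e \<in> out_arcs (with_proj \<Gamma>) A"
    then obtain B where e: "e = (A, B)" "(A, B) \<in> parcs \<Gamma>" by (cases e) auto
    then obtain z' where "z' \<in> carrier Y" "B = vert z'" using arcs_verts by blast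
    then have "\<exists>k\<in>R3. B = vert (g \<otimes>\<^bsub>W\<^esub> (k \<otimes>\<^bsub>W\<^esub> z))" using e z adj_iff by blast
    then show "e \<in> ?n ` R3" using e by blast
  next
    fix e assume "e \<in> ?n ` R3"
    then obtain k where k: "e = ?n k" "k \<in> R3" by (rule imageE)
    then show "e \<in> out_arcs (with_proj \<Gamma>) A" using arcI[OF z(1) k(2)] z(2) by simp
  qed
  moreover have "inj_on ?n R3"
  proof (rule inj_onI)
    fix k k' assume k: "k \<in> R3" "k' \<in> R3" "?n k = ?n k'"
    have kY: "k \<in> carrier Y" "k' \<in> carrier Y" using R3_H[OF k(1)] R3_H[OF k(2)] by simp_all
    have "vert (g \<otimes>\<^bsub>W\<^esub> (k \<otimes>\<^bsub>W\<^esub> z)) = vert (g \<otimes>\<^bsub>W\<^esub> (k' \<otimes>\<^bsub>W\<^esub> z))"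
      using k(3) by (simp only: prod.inject)
    then have "pos (g \<otimes>\<^bsub>W\<^esub> (k \<otimes>\<^bsub>W\<^esub> z)) = pos (g \<otimes>\<^bsub>W\<^esub> (k' \<otimes>\<^bsub>W\<^esub> z))"
      by (rule pos_vert) (use kY z(1) in simp_all)
    then show "k = k'" by (rule pos_neighbour_inj[OF z(1) k(1,2)])
  qed
  moreover have "card R3 = 3"
  proof -
    have "th a1 2 = 3" "th (a1 \<otimes>\<^bsub>W\<^esub> a1) 2 = 4" "th \<one>\<^bsub>Y\<^esub> 2 = 2"
      by (simp_all add: th_mult th_gens k_values snd_one theta_id)
    then have "a1 \<noteq> \<one>\<^bsub>Y\<^esub>" "a1 \<otimes>\<^bsub>W\<^esub> a1 \<noteq> \<one>\<^bsub>Y\<^esub>" "a1 \<otimes>\<^bsub>W\<^esub> a1 \<noteq> a1" by auto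
    then show ?thesis by (auto simp: card_insert_if)
  qed
  ultimately show "out_degree (with_proj \<Gamma>) A = 3"
    by (simp only: out_degree_def card_image)
qed

section \<open>Transitivity on 2-arcs\<close>

lemma standard_two_arc:
  assumes "k \<in> R3" "k' \<in> R3" "k \<noteq> k'"
  shows "\<exists>h\<in>H. vert (g \<otimes>\<^bsub>W\<^esub> h) = vert (g \<otimes>\<^bsub>W\<^esub> k) \<and> vert (g \<otimes>\<^bsub>W\<^esub> (a1 \<otimes>\<^bsub>W\<^esub> h)) = vert (g \<otimes>\<^bsub>W\<^esub> k')"
proof -
  have kH: "k \<in> H" using R3_H[OF assms(1)] .
  have r: "a1 \<otimes>\<^bsub>W\<^esub> (a1 \<otimes>\<^bsub>W\<^esub> (a1 \<otimes>\<^bsub>W\<^esub> z)) = z"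
    "a1 \<otimes>\<^bsub>W\<^esub> (a2 \<otimes>\<^bsub>W\<^esub> z) = a2 \<otimes>\<^bsub>W\<^esub> (a1 \<otimes>\<^bsub>W\<^esub> (a1 \<otimes>\<^bsub>W\<^esub> z))"
    "g \<otimes>\<^bsub>W\<^esub> (a2 \<otimes>\<^bsub>W\<^esub> z) = a2 \<otimes>\<^bsub>W\<^esub> (g \<otimes>\<^bsub>W\<^esub> z)" if "z \<in> carrier Y" for z
    using that by (simp_all add: top_relations g_relations flip: Y_assoc)
  \<comment> \<open>The set \<open>R3\<close> is the cyclic group generated by \<open>a1\<close>. In
    the first case h = k works. In the second h = \<open>a2 k\<close> does: \<open>a2\<close>
    commutes with g and inverts \<open>a1\<close>, so it interchanges the two remaining
    neighbours.\<close>
  consider "k' = a1 \<otimes>\<^bsub>W\<^esub> k" | "k' = a1 \<otimes>\<^bsub>W\<^esub> (a1 \<otimes>\<^bsub>W\<^esub> k)"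
    using assms by (auto simp: top_relations r)
  then show ?thesis
  proof cases
    case 1
    then show ?thesis using kH by blast
  next
    case 2
    then show ?thesis
      using kH H_closed(1)[of a2 k] by (intro bexI[of _ "a2 \<otimes>\<^bsub>W\<^esub> k"]) (simp_all add: r vert_absorb)
  qed
qed

text \<open>A representative z of the middle vertex turns the outer vertices into
  \<open>g k z\<close> and \<open>g k' z\<close>; an element of \<open>H\<close> from
  \<open>standard_two_arc\<close> then adjusts z. All 2-arcs are translates of a single one, which
  is the required transitivity.\<close>

lemma two_arc_from_standard:
  assumes "p \<in> s_arcs 2 \<Gamma>"
  shows "\<exists>a\<in>carrier Y. p = [vert (g \<otimes>\<^bsub>W\<^esub> a), vert a, vert (g \<otimes>\<^bsub>W\<^esub> (a1 \<otimes>\<^bsub>W\<^esub> a))]"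
proof -
  have "length p = Suc (Suc (Suc 0))" using assms by (simp add: s_arcs_def)
  then obtain A B C where p: "p = [A, B, C]" by (auto simp: length_Suc_conv)
  have arcs: "\<And>i. i + 1 < length p \<Longrightarrow> (p ! i, p ! (i + 1)) \<in> parcs \<Gamma>"
    and dist: "\<And>i. i + 2 < length p \<Longrightarrow> distinct [p ! i, p ! (i + 1), p ! (i + 2)]"
    using assms unfolding s_arcs_def by blast+
  have "(A, B) \<in> parcs \<Gamma>" "(B, C) \<in> parcs \<Gamma>" "A \<noteq> C"
    using arcs[of 0] arcs[of 1] dist[of 0] p by (simp_all add: One_nat_def numeral_2_eq_2)
  then have BA: "(B, A) \<in> parcs \<Gamma>" and BC: "(B, C) \<in> parcs \<Gamma>" using arc_sym by blast+
  then obtain z z1 z2 where z: "z \<in> carrier Y" "B = vert z" "z1 \<in> carrier Y" "A = vert z1"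
    "z2 \<in> carrier Y" "C = vert z2"
    using arcs_verts[OF BA] arcs_verts[OF BC] by auto
  obtain k where k: "k \<in> R3" "A = vert (g \<otimes>\<^bsub>W\<^esub> (k \<otimes>\<^bsub>W\<^esub> z))"
    using BA unfolding z(2,4) adj_iff[OF z(1,3)] by (elim bexE)
  obtain k' where k': "k' \<in> R3" "C = vert (g \<otimes>\<^bsub>W\<^esub> (k' \<otimes>\<^bsub>W\<^esub> z))"
    using BC unfolding z(2,6) adj_iff[OF z(1,5)] by (elim bexE)
  have "k \<noteq> k'" using k k' \<open>A \<noteq> C\<close> by blast
  then obtain h where h: "h \<in> H" "vert (g \<otimes>\<^bsub>W\<^esub> h) = vert (g \<otimes>\<^bsub>W\<^esub> k)"
    "vert (g \<otimes>\<^bsub>W\<^esub> (a1 \<otimes>\<^bsub>W\<^esub> h)) = vert (g \<otimes>\<^bsub>W\<^esub> k')"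
    using standard_two_arc k(1) k'(1) by blast
  have kY: "k \<in> carrier Y" "k' \<in> carrier Y" "h \<in> carrier Y"
    using R3_H[OF k(1)] R3_H[OF k'(1)] h(1) by simp_all
  have "A = vert (g \<otimes>\<^bsub>W\<^esub> (h \<otimes>\<^bsub>W\<^esub> z))"
    using vert_mult[of "g \<otimes>\<^bsub>W\<^esub> k" z] vert_mult[of "g \<otimes>\<^bsub>W\<^esub> h" z] h(2) k(2) kY z(1)
    by (simp add: Y_assoc)
  moreover have "C = vert (g \<otimes>\<^bsub>W\<^esub> (a1 \<otimes>\<^bsub>W\<^esub> (h \<otimes>\<^bsub>W\<^esub> z)))"
    using vert_mult[of "g \<otimes>\<^bsub>W\<^esub> k'" z] vert_mult[of "g \<otimes>\<^bsub>W\<^esub> (a1 \<otimes>\<^bsub>W\<^esub> h)" z] h(3) k'(2) kY z(1)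
    by (simp add: Y_assoc)
  moreover have "B = vert (h \<otimes>\<^bsub>W\<^esub> z)" using vert_absorb[OF h(1) z(1)] z(2) by simp
  ultimately show ?thesis using p kY z by (intro bexI[of _ "h \<otimes>\<^bsub>W\<^esub> z"]) simp_all
qed

lemma two_arc_transitive: "s_arc_transitive 2 (carrier Y) (r_coset Y) \<Gamma>"
  unfolding s_arc_transitive_def
proof (intro ballI)
  fix p q assume "p \<in> s_arcs 2 \<Gamma>" "q \<in> s_arcs 2 \<Gamma>"
  then obtain a b where ab: "a \<in> carrier Y" "b \<in> carrier Y"
    and p: "p = [vert (g \<otimes>\<^bsub>W\<^esub> a), vert a, vert (g \<otimes>\<^bsub>W\<^esub> (a1 \<otimes>\<^bsub>W\<^esub> a))]"
    and q: "q = [vert (g \<otimes>\<^bsub>W\<^esub> b), vert b, vert (g \<otimes>\<^bsub>W\<^esub> (a1 \<otimes>\<^bsub>W\<^esub> b))]"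
    using two_arc_from_standard by meson
  let ?c = "inv\<^bsub>Y\<^esub> a \<otimes>\<^bsub>W\<^esub> b"
  have c: "?c \<in> carrier Y" using ab by simp
  have "a \<otimes>\<^bsub>W\<^esub> ?c = b"
    using ab Y.r_inv[of a] by (simp flip: Y_assoc)
  then have "map (\<lambda>v. v #>\<^bsub>Y\<^esub> ?c) p = q"
    using ab c by (simp add: p q vert_mult Y_assoc)
  then show "\<exists>c\<in>carrier Y. map (\<lambda>v. v #>\<^bsub>Y\<^esub> c) p = q" using c by blast
qed

section \<open>Orbits of \<open>M\<close> and the quotient graph\<close>

definition "orb k = {vert z |z. z \<in> carrier Y \<and> pos z = k}"

lemma orb_eq: "pos z = k \<Longrightarrow> z \<in> carrier Y \<Longrightarrow> vert z \<in> orb k"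
  unfolding orb_def by blast

lemma orb_D: "A \<in> orb k \<Longrightarrow> \<exists>z\<in>carrier Y. A = vert z \<and> pos z = k"
  unfolding orb_def by blast

text \<open>If z and z' have the same position, \<open>th\<close> of z' times the inverse of z fixes
  1, hence agrees with \<open>th h\<close> for some h in \<open>H\<close>; dividing by h leaves an
  element of the kernel \<open>M\<close>.\<close>

lemma M_orbit:
  assumes z: "z \<in> carrier Y"
  shows "(\<lambda>m. vert z #>\<^bsub>Y\<^esub> m) ` M = orb (pos z)"
proof (intro equalityI subsetI)
  fix A assume "A \<in> (\<lambda>m. vert z #>\<^bsub>Y\<^esub> m) ` M"
  then obtain m where m: "m \<in> M" "A = vert z #>\<^bsub>Y\<^esub> m" by blast
  have mY: "m \<in> carrier Y" using m(1) by (simp add: M_def)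
  then have "A = vert (z \<otimes>\<^bsub>W\<^esub> m)" "pos (z \<otimes>\<^bsub>W\<^esub> m) = pos z"
    using m z M_iff_th by (simp_all add: vert_mult pos_mult)
  then show "A \<in> orb (pos z)" using orb_eq[of "z \<otimes>\<^bsub>W\<^esub> m" "pos z"] z mY by simp
next
  fix A assume "A \<in> orb (pos z)"
  then obtain z' where z': "z' \<in> carrier Y" "pos z' = pos z" "A = vert z'" by (auto simp: orb_def)
  let ?k = "z' \<otimes>\<^bsub>W\<^esub> inv\<^bsub>Y\<^esub> z"
  have k: "?k \<in> carrier Y" using z z' by simp
  have kz: "?k \<otimes>\<^bsub>W\<^esub> z = z'" using z z' Y.l_inv[of z] by (simp add: Y_assoc)
  have "th z (th ?k 1) = th z 1"
    using th_mult[OF k z] z'(2) by (simp add: kz pos_def)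
  then have fix1: "th ?k 1 = 1" using th_inj[OF z] by simp
  have "th ?k permutes {2..4}"
  proof (rule permutes_superset[OF th_permutes[OF k]])
    fix i :: nat assume "i \<in> {1..4} - {2..4}"
    then have "i = 1" by (auto simp: atLeastAtMost_iff)
    then show "th ?k i = i" using fix1 by simp
  qed
  then obtain h where h: "h \<in> H" "th h = th ?k" using th_surj_H by blast
  let ?m = "inv\<^bsub>Y\<^esub> h \<otimes>\<^bsub>W\<^esub> ?k"
  have hY: "h \<in> carrier Y" using h(1) by simp
  have m: "?m \<in> carrier Y" using k hY by simp
  have hm: "h \<otimes>\<^bsub>W\<^esub> ?m = ?k" using k hY Y.r_inv[of h] by (simp flip: Y_assoc)
  have "th ?m \<circ> th h = th h" using th_mult[OF hY m] h(2) by (simp only: hm)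
  then have "th ?m = id"
    using permutes_bij[OF th_permutes[OF hY]] by (metis bij_is_surj comp_id o_assoc surj_iff)
  then have mM: "?m \<in> M" using M_iff_th[OF m] by simp
  \<comment> \<open>The element found stands to the left of z; its conjugate by z lies in the normal
    subgroup \<open>M\<close> and acts from the right.\<close>
  let ?m' = "inv\<^bsub>Y\<^esub> z \<otimes>\<^bsub>W\<^esub> ?m \<otimes>\<^bsub>W\<^esub> z"
  have m': "?m' \<in> M" using normal.inv_op_closed1[OF M_normal z mM] by simp
  have m'Y: "?m' \<in> carrier Y" using m' by (simp add: M_def)
  have "z \<otimes>\<^bsub>W\<^esub> ?m' = ?m \<otimes>\<^bsub>W\<^esub> z"
    using z m Y.inv_closed[OF z] Y.r_inv[OF z] by (simp flip: Y_assoc)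
  then have "h \<otimes>\<^bsub>W\<^esub> (z \<otimes>\<^bsub>W\<^esub> ?m') = z'"
    using hm kz hY m z by (simp flip: Y_assoc)
  then have "A = vert z #>\<^bsub>Y\<^esub> ?m'"
    using vert_absorb[OF h(1), of "z \<otimes>\<^bsub>W\<^esub> ?m'"] z m'Y z'(3) by (simp add: vert_mult)
  then show "A \<in> (\<lambda>m. vert z #>\<^bsub>Y\<^esub> m) ` M" using m' by blast
qed

abbreviation "\<Gamma>M \<equiv> normal_quotient \<Gamma> M (r_coset Y)"

lemma pos_surj: "j \<in> {1..4} \<Longrightarrow> k \<in> {1..4} \<Longrightarrow> j \<noteq> k \<Longrightarrow> \<exists>z\<in>carrier Y. th z 1 = j \<and> th z 2 = k"
proof -
  assume jk: "j \<in> {1..4}" "k \<in> {1..4}" "j \<noteq> k"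
  \<comment> \<open>The first transposition takes 1 to j; the second takes the image of 2 to k and
    fixes j, as j differs from both.\<close>
  let ?\<pi> = "transpose (transpose 1 j 2) k \<circ> transpose 1 j"
  have "transpose 1 j 2 \<in> {1..4}" using jk by (auto simp: transpose_def)
  then have "?\<pi> permutes {1..4}"
    using jk by (intro permutes_compose permutes_swap_id) simp_all
  then obtain z where z: "z \<in> carrier Y" "th z = ?\<pi>" using th_surj by blast
  have "transpose 1 j 2 \<noteq> j" by (auto simp: transpose_def)
  then have "?\<pi> 1 = j" using jk(3) by simp
  moreover have "?\<pi> 2 = k" by simp
  ultimately show ?thesis using z by (intro bexI[of _ z]) simp_all
qed

lemma pos_surj1: "k \<in> {1..4} \<Longrightarrow> \<exists>z\<in>carrier Y. pos z = k"
proof (cases "k = 1")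
  case True
  then show ?thesis using pos_surj[of 1 2] by (auto simp: pos_def)
next
  case False
  assume "k \<in> {1..4}"
  then show ?thesis using pos_surj[of k 1] False by (auto simp: pos_def)
qed

lemma orb_inj: "inj_on orb {1..4}"
proof (rule inj_onI)
  fix j k assume jk: "j \<in> {1..4}" "k \<in> {1..4}" "orb j = orb k"
  obtain z where z: "z \<in> carrier Y" "pos z = j" using pos_surj1[OF jk(1)] by (elim bexE)
  then have "vert z \<in> orb k" using orb_eq[OF z(2,1)] jk(3) by simp
  then obtain z' where z': "z' \<in> carrier Y" "vert z = vert z'" "pos z' = k"
    by (elim bexE[OF orb_D] conjE)
  then show "j = k" using pos_vert[OF z'(2) z(1) z'(1)] z(2) by simp
qed

lemma quotient_verts: "pverts \<Gamma>M = orb ` {1..4}"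
proof -
  have "pverts \<Gamma>M = (\<lambda>z. orb (pos z)) ` carrier Y"
    by (simp add: normal_quotient_def Let_def verts_eq image_image M_orbit cong: image_cong)
  also have "\<dots> = orb ` {1..4}"
    using pos_in pos_surj1 by (auto simp: image_iff Bex_def) metis+
  finally show ?thesis .
qed

text \<open>For distinct positions j and k, 2-transitivity of S_4 gives a vertex
  \<open>vert z\<close> at j whose neighbour \<open>vert (g z)\<close> is at k.\<close>

lemma quotient_arcs: "parcs \<Gamma>M = {(A, B). A \<in> pverts \<Gamma>M \<and> B \<in> pverts \<Gamma>M \<and> A \<noteq> B}"
proof -
  have adj: "\<exists>u\<in>A. \<exists>v\<in>B. (u, v) \<in> parcs \<Gamma>" if AB: "A \<in> orb ` {1..4}" "B \<in> orb ` {1..4}" "A \<noteq> B" for A B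
  proof -
    obtain j k where jk: "j \<in> {1..4}" "k \<in> {1..4}" "A = orb j" "B = orb k" using AB by blast
    then have "j \<noteq> k" using AB by blast
    then obtain z where z: "z \<in> carrier Y" "th z 1 = j" "th z 2 = k" using pos_surj jk by blast
    have "(vert z, vert (g \<otimes>\<^bsub>W\<^esub> (\<one>\<^bsub>Y\<^esub> \<otimes>\<^bsub>W\<^esub> z))) \<in> parcs \<Gamma>"
      using arcI[OF z(1)] by simp
    moreover have "vert z \<in> orb j" using z by (intro orb_eq) (simp_all add: pos_def)
    moreover have "vert (g \<otimes>\<^bsub>W\<^esub> (\<one>\<^bsub>Y\<^esub> \<otimes>\<^bsub>W\<^esub> z)) \<in> orb k"
      using z pos_neighbour(1)[OF z(1)] by (intro orb_eq) simp_all
    ultimately show ?thesis using jk by blast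
  qed
  have arcs: "parcs \<Gamma>M = {(A, B). A \<in> pverts \<Gamma>M \<and> B \<in> pverts \<Gamma>M \<and> A \<noteq> B
      \<and> (\<exists>u\<in>A. \<exists>v\<in>B. (u, v) \<in> parcs \<Gamma>)}"
    by (simp add: normal_quotient_def Let_def)
  show ?thesis
  proof (intro equalityI subsetI)
    fix e assume "e \<in> {(A, B). A \<in> pverts \<Gamma>M \<and> B \<in> pverts \<Gamma>M \<and> A \<noteq> B}"
    then obtain A B where "e = (A, B)" "A \<in> pverts \<Gamma>M" "B \<in> pverts \<Gamma>M" "A \<noteq> B" by auto
    then show "e \<in> parcs \<Gamma>M"
      using adj[of A B] unfolding arcs quotient_verts by simp
  qed (simp add: arcs split: prod.splits)
qed

lemma quotient_card: "card (pverts \<Gamma>M) = 4"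
  unfolding quotient_verts using card_image[OF orb_inj] by simp

lemma quotient_complete: "complete_digraph 4 (with_proj \<Gamma>M)"
proof -
  have "finite (pverts \<Gamma>M)" by (simp add: quotient_verts)
  then show ?thesis
    unfolding complete_digraph_pair_def using quotient_card quotient_arcs by auto
qed

lemma quotient_valency: "has_valency \<Gamma>M 3"
  unfolding has_valency_def
proof
  fix A assume A: "A \<in> pverts \<Gamma>M"
  have "out_arcs (with_proj \<Gamma>M) A = Pair A ` (pverts \<Gamma>M - {A})"
    using A by (auto simp: out_arcs_def quotient_arcs)
  moreover have "card (Pair A ` (pverts \<Gamma>M - {A})) = card (pverts \<Gamma>M - {A})"
    by (intro card_image inj_onI) simp
  moreover have "card (pverts \<Gamma>M - {A}) = 3"
    using A quotient_card by (simp add: card_Diff_singleton)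
  ultimately show "out_degree (with_proj \<Gamma>M) A = 3" by (simp add: out_degree_def)
qed

lemma normal_cover: "is_normal_cover \<Gamma> M (r_coset Y)"
  unfolding is_normal_cover_def using quotient_card valency_Gamma quotient_valency by auto


section \<open>Linked coordinates\<close>

lemma M_in_Y [simp]: "m \<in> M \<Longrightarrow> m \<in> carrier Y" and M_snd: "m \<in> M \<Longrightarrow> snd m = id"
  by (simp_all add: M_def)

lemma M_coord: "m \<in> M \<Longrightarrow> i \<in> {1..6} \<Longrightarrow> fst m i \<in> carrier G"
  by (simp add: Y_coord)

lemma fst_mult_M: "m \<in> M \<Longrightarrow> i \<in> {1..6} \<Longrightarrow> fst (m \<otimes>\<^bsub>W\<^esub> a) i = fst m i \<otimes> fst a i"
  by (simp add: fst_mult M_snd)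

lemma M_subgroup: "subgroup M Y"
  using M_normal by (rule normal_imp_subgroup)

lemma fst_inv_M:
  assumes m: "m \<in> M" and i: "i \<in> {1..6}"
  shows "fst (inv\<^bsub>Y\<^esub> m) i = inv (fst m i)"
proof -
  have m': "inv\<^bsub>Y\<^esub> m \<in> M" using subgroup.m_inv_closed[OF M_subgroup m] .
  have "fst (inv\<^bsub>Y\<^esub> m) i \<otimes> fst m i = \<one>"
    using fst_mult_M[OF m' i, of m] Y.l_inv[of m] m i by (simp add: fst_one)
  then show ?thesis
    using M_coord[OF m i] M_coord[OF m' i] inv_equality by simp
qed

lemma M_eqI:
  assumes "m \<in> M" "n \<in> M" "\<And>i. i \<in> {1..6} \<Longrightarrow> fst m i = fst n i"
  shows "m = n"
  using assms by (intro Y_eqI) (simp_all add: M_snd)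

text \<open>Read off from multiplying the conjugate by a on the left, which avoids the coordinates
  of the inverse of a. The twist is trivial for \<open>a1\<close> and \<open>a2\<close>, and is
  \<open>f i\<close> for g.\<close>

lemma conj_coord:
  assumes a: "a \<in> carrier Y" and m: "m \<in> M" and i: "i \<in> {1..6}"
  shows "fst (inv\<^bsub>Y\<^esub> a \<otimes>\<^bsub>W\<^esub> m \<otimes>\<^bsub>W\<^esub> a) (snd a i) = inv (fst a i) \<otimes> fst m i \<otimes> fst a i"
proof -
  let ?n = "inv\<^bsub>Y\<^esub> a \<otimes>\<^bsub>W\<^esub> m \<otimes>\<^bsub>W\<^esub> a"
  have n: "?n \<in> carrier Y" using a m by simp
  have "a \<otimes>\<^bsub>W\<^esub> ?n = m \<otimes>\<^bsub>W\<^esub> a"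
    using a m Y.r_inv[OF a] by (simp flip: Y_assoc)
  then have eq: "fst a i \<otimes> fst ?n (snd a i) = fst m i \<otimes> fst a i"
    using fst_mult[OF a i, of ?n] fst_mult_M[OF m i, of a] by simp
  have "fst ?n (snd a i) = inv (fst a i) \<otimes> (fst a i \<otimes> fst ?n (snd a i))"
    using Y_coord[OF a i] Y_coord[OF n Y_perm_in[OF a i]] by (simp add: inv_cancel_left)
  then show ?thesis
    unfolding eq using Y_coord[OF a i] M_coord[OF m i] by (simp add: m_assoc)
qed

text \<open>\<open>S\<^sub>4\<close> is the Coxeter group on \<open>h\<^sub>1 h\<^sub>2\<close>, \<open>h\<^sub>2\<close>, \<open>\<delta>\<close>, and the third power below is the only
  relator that does not already hold in \<open>Y\<close>.\<close>

definition "rel_b = a1 \<otimes>\<^bsub>W\<^esub> (a2 \<otimes>\<^bsub>W\<^esub> g)"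
definition "rel = rel_b \<otimes>\<^bsub>W\<^esub> (rel_b \<otimes>\<^bsub>W\<^esub> rel_b)"

lemma rel_b_Y: "rel_b \<in> carrier Y"
  by (simp add: rel_b_def)

lemma snd_rel_b: "snd rel_b 1 = 3" "snd rel_b 2 = 4" "snd rel_b 3 = 5" "snd rel_b 4 = 6"
  "snd rel_b 5 = 1" "snd rel_b 6 = 2"
  by (simp_all add: rel_b_def snd_mult perm_values)

lemma fst_rel_b: "fst rel_b 1 = inv y" "fst rel_b 2 = y" "fst rel_b 3 = x" "fst rel_b 4 = x"
  "fst rel_b 5 = inv y" "fst rel_b 6 = y"
  by (simp_all add: rel_b_def fst_mult fst_a fst_g perm_values f_values)

lemma rel_M: "rel \<in> M"
proof -
  have Y: "rel \<in> carrier Y" by (simp add: rel_def rel_b_Y)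
  have "snd rel = id"
    by (rule plist_inj[OF Y_perm[OF Y] permutes_id])
      (simp add: plist_def rel_def snd_mult rel_b_Y snd_rel_b)
  then show ?thesis using Y by (simp only: M_def mem_Collect_eq)
qed

lemma fst_rel: "fst rel 1 = inv u" "fst rel 2 = u" "fst rel 3 = inv v" "fst rel 4 = w"
  "fst rel 5 = inv w" "fst rel 6 = v"
  by (simp_all add: rel_def fst_mult rel_b_Y snd_rel_b fst_rel_b word_simps)

text \<open>Conjugation by \<open>H\<close> identifies the sets of coordinate values of N without
  twist, and conjugation by g makes the common set invariant under x and y. It is then a nontrivial
  normal subgroup of G.\<close>

lemma coord_full:
  assumes N: "N \<lhd> Y" "N \<subseteq> M" and n: "n \<in> N" and j: "j \<in> {1..6}" "fst n j \<noteq> \<one>"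
    and i: "i \<in> {1..6}" and t: "t \<in> carrier G"
  shows "\<exists>n\<in>N. fst n i = t"
proof -
  define S where "S i = (\<lambda>n. fst n i) ` N" for i
  have sub: "subgroup N Y" using N(1) by (rule normal_imp_subgroup)
  have conj: "inv (fst a i) \<otimes> q \<otimes> fst a i \<in> S (snd a i)"
    if a: "a \<in> carrier Y" and i: "i \<in> {1..6}" and q: "q \<in> S i" for a i q
  proof -
    obtain n where n: "n \<in> N" "q = fst n i" using q by (auto simp: S_def)
    have "n \<in> M" using n(1) N(2) by (rule set_mp[rotated])
    then have "fst (inv\<^bsub>Y\<^esub> a \<otimes>\<^bsub>W\<^esub> n \<otimes>\<^bsub>W\<^esub> a) (snd a i) = inv (fst a i) \<otimes> q \<otimes> fst a i"
      using conj_coord[OF a _ i] n(2) by simp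
    moreover have "inv\<^bsub>Y\<^esub> a \<otimes>\<^bsub>W\<^esub> n \<otimes>\<^bsub>W\<^esub> a \<in> N"
      using normal.inv_op_closed1[OF N(1) a n(1)] by simp
    ultimately show ?thesis unfolding S_def by (metis imageI)
  qed
  have S_G: "S i \<subseteq> carrier G" if "i \<in> {1..6}" for i
    using M_coord[OF _ that] N(2) by (auto simp: S_def)
  have "S i \<subseteq> S (sig1 i)" "S i \<subseteq> S (sig2 i)" if i: "i \<in> {1..6}" for i
  proof -
    have "q \<in> S (sig1 i) \<and> q \<in> S (sig2 i)" if "q \<in> S i" for q
      using conj[OF gens_Y(1) i that] conj[OF gens_Y(2) i that] subsetD[OF S_G[OF i] that] i
      by (simp add: fst_a)
    then show "S i \<subseteq> S (sig1 i)" "S i \<subseteq> S (sig2 i)" by blast+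
  qed
  then have st: "\<forall>i\<in>{1..6}. S i \<subseteq> S (sig1 i) \<and> S i \<subseteq> S (sig2 i)" by blast
  \<comment> \<open>Along the cycles of \<open>sig1\<close> and \<open>sig2\<close> the inclusions
    become equalities, and these cycles connect all six points.\<close>
  have S1: "S i = S 1" if "i \<in> {1..6}" for i
  proof -
    have "\<forall>i\<in>{1..6}. S i = S 1"
      using st unfolding ball_six perm_values by blast
    then show ?thesis using that by blast
  qed
  let ?Q = "S 1"
  have conj_f: "inv (f i) \<otimes> q \<otimes> f i \<in> ?Q" if "i \<in> {1..6}" "q \<in> ?Q" for i q
    using conj[OF gens_Y(3) that(1), of q] that S1[of i] S1[of "sig3 i"] by (simp add: fst_g)
  \<comment> \<open>The values \<open>f 5\<close>, \<open>f 1\<close> and \<open>f 2\<close> are x,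
    y and the inverse of y, while x is its own inverse.\<close>
  have conj_T: "\<forall>q\<in>?Q. inv t \<otimes> q \<otimes> t \<in> ?Q" if "t \<in> generate G {x, y}" for t
    using that
  proof induction
    case one
    then show ?case using S_G[of 1] by (auto simp: subset_iff)
  next
    case (incl h)
    then show ?case using conj_f[of 5] conj_f[of 1] by (auto simp: f_values)
  next
    case (inv h)
    then show ?case using conj_f[of 5] conj_f[of 2] by (auto simp: f_values)
  next
    case (eng a b)
    then have ab: "a \<in> carrier G" "b \<in> carrier G" by (simp_all add: generate_xy)
    show ?case
    proof
      fix q assume q: "q \<in> ?Q"
      then have "inv b \<otimes> (inv a \<otimes> q \<otimes> a) \<otimes> b \<in> ?Q" using eng.IH by blast
      moreover have "q \<in> carrier G" using S_G[of 1] q by auto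
      ultimately show "inv (a \<otimes> b) \<otimes> q \<otimes> (a \<otimes> b) \<in> ?Q"
        using ab by (simp add: m_assoc inv_mult_group)
    qed
  qed
  have "subgroup ?Q G"
  proof (rule subgroupI)
    show "?Q \<subseteq> carrier G" using S_G by simp
    show "?Q \<noteq> {}" using n by (auto simp: S_def)
    show "inv a \<in> ?Q" if a: "a \<in> ?Q" for a
    proof -
      obtain m where m: "m \<in> N" "a = fst m 1" using a by (auto simp: S_def)
      then have "fst (inv\<^bsub>Y\<^esub> m) 1 = inv a" using N(2) by (auto intro!: fst_inv_M)
      then show ?thesis using subgroup.m_inv_closed[OF sub m(1)] unfolding S_def by (metis imageI)
    qed
    show "a \<otimes> b \<in> ?Q" if a: "a \<in> ?Q" and b: "b \<in> ?Q" for a b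
    proof -
      obtain m where m: "m \<in> N" "a = fst m 1" using a by (auto simp: S_def)
      obtain l where l: "l \<in> N" "b = fst l 1" using b by (auto simp: S_def)
      have "m \<in> M" using m N(2) by blast
      then have "fst (m \<otimes>\<^bsub>W\<^esub> l) 1 = a \<otimes> b" using m l by (simp add: fst_mult_M)
      moreover have "m \<otimes>\<^bsub>W\<^esub> l \<in> N" using subgroup.m_closed[OF sub m(1) l(1)] by simp
      ultimately show ?thesis unfolding S_def by (metis imageI)
    qed
  qed
  then have "?Q \<lhd> G"
  proof (rule normal_invI)
    fix t q assume "t \<in> carrier G" "q \<in> ?Q"
    then have "inv (inv t) \<otimes> q \<otimes> inv t \<in> ?Q"
      using conj_T[of "inv t"] by (simp add: generate_xy)
    then show "t \<otimes> q \<otimes> inv t \<in> ?Q" using \<open>t \<in> carrier G\<close> by simp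
  qed
  moreover have "fst n j \<in> ?Q" using S1[OF j(1)] n unfolding S_def by blast
  ultimately have "?Q = carrier G" using j(2) by (rule normal_eq_carrier)
  then have "t \<in> S i" using S1[OF i] t by simp
  then show ?thesis by (auto simp: S_def)
qed

lemma M_coord_full: "i \<in> {1..6} \<Longrightarrow> t \<in> carrier G \<Longrightarrow> \<exists>m\<in>M. fst m i = t"
  using coord_full[OF M_normal subset_refl rel_M, of 2] u_neq_one by (simp add: fst_rel)

text \<open>Linkage as an inclusion of kernels of coordinate maps on \<open>M\<close>. Symmetry
  comes from \<open>link_orbits\<close>, and an automorphism relating the coordinates from
  \<open>link_automorphism\<close>.\<close>

definition link :: "nat \<Rightarrow> nat \<Rightarrow> bool" where
  "link i j \<longleftrightarrow> (\<forall>m\<in>M. fst m i = \<one> \<longrightarrow> fst m j = \<one>)"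

lemma link_trans: "link i j \<Longrightarrow> link j k \<Longrightarrow> link i k"
  by (simp add: link_def)

lemma conj_back:
  assumes a: "a \<in> carrier Y" and m: "m \<in> M"
  shows "\<exists>n\<in>M. \<forall>i\<in>{1..6}. fst m (snd a i) = inv (fst a i) \<otimes> fst n i \<otimes> fst a i"
proof -
  let ?n = "a \<otimes>\<^bsub>W\<^esub> m \<otimes>\<^bsub>W\<^esub> inv\<^bsub>Y\<^esub> a"
  have n: "?n \<in> M" using normal.inv_op_closed2[OF M_normal a m] by simp
  have "inv\<^bsub>Y\<^esub> a \<otimes>\<^bsub>W\<^esub> ?n \<otimes>\<^bsub>W\<^esub> a = inv\<^bsub>Y\<^esub> a \<otimes>\<^bsub>W\<^esub> a \<otimes>\<^bsub>W\<^esub> (m \<otimes>\<^bsub>W\<^esub> (inv\<^bsub>Y\<^esub> a \<otimes>\<^bsub>W\<^esub> a))"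
    using a m by (simp add: Y_assoc)
  then have "inv\<^bsub>Y\<^esub> a \<otimes>\<^bsub>W\<^esub> ?n \<otimes>\<^bsub>W\<^esub> a = m"
    using a m Y.l_inv[OF a] by simp
  then show ?thesis using conj_coord[OF a n] n by auto
qed

lemma conj_one_iff:
  assumes "a \<in> carrier G" "t \<in> carrier G"
  shows "inv a \<otimes> t \<otimes> a = \<one> \<longleftrightarrow> t = \<one>"
proof
  assume "inv a \<otimes> t \<otimes> a = \<one>"
  then have "a \<otimes> (inv a \<otimes> t \<otimes> a) \<otimes> inv a = \<one>" using assms by simp
  then show "t = \<one>" using assms by (simp add: m_assoc inv_cancel_left)
qed (use assms in simp)

text \<open>Conjugation by a permutes the coordinates up to inner automorphisms, which preserve and
  reflect triviality.\<close>

lemma link_iff: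
  assumes a: "a \<in> carrier Y" and i: "i \<in> {1..6}" and j: "j \<in> {1..6}"
  shows "link (snd a i) (snd a j) \<longleftrightarrow> link i j"
proof
  assume L: "link i j"
  show "link (snd a i) (snd a j)"
    unfolding link_def
  proof (intro ballI impI)
    fix m assume m: "m \<in> M" "fst m (snd a i) = \<one>"
    obtain n where n: "n \<in> M" "\<And>i. i \<in> {1..6} \<Longrightarrow> fst m (snd a i) = inv (fst a i) \<otimes> fst n i \<otimes> fst a i"
      using conj_back[OF a m(1)] by auto
    then have "fst n i = \<one>"
      using m(2) conj_one_iff Y_coord[OF a i] M_coord[OF n(1) i] i by simp
    then have "fst n j = \<one>" using L n(1) by (simp add: link_def)
    then show "fst m (snd a j) = \<one>" using n(2)[OF j] Y_coord[OF a j] by simp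
  qed
next
  assume L: "link (snd a i) (snd a j)"
  show "link i j"
    unfolding link_def
  proof (intro ballI impI)
    fix m assume m: "m \<in> M" "fst m i = \<one>"
    let ?n = "inv\<^bsub>Y\<^esub> a \<otimes>\<^bsub>W\<^esub> m \<otimes>\<^bsub>W\<^esub> a"
    have n: "?n \<in> M" using normal.inv_op_closed1[OF M_normal a m(1)] by simp
    have "fst ?n (snd a i) = \<one>" using conj_coord[OF a m(1) i] m(2) Y_coord[OF a i] by simp
    then have "fst ?n (snd a j) = \<one>" using L n by (simp add: link_def)
    then show "fst m j = \<one>"
      using conj_coord[OF a m(1) j] conj_one_iff Y_coord[OF a j] M_coord[OF m(1) j] by simp
  qed
qed

lemma link_sig:
  assumes "i \<in> {1..6}" "j \<in> {1..6}"
  shows "link (sig1 i) (sig1 j) \<longleftrightarrow> link i j" "link (sig2 i) (sig2 j) \<longleftrightarrow> link i j"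
    "link (sig3 i) (sig3 j) \<longleftrightarrow> link i j"
  using link_iff[OF gens_Y(1) assms] link_iff[OF gens_Y(2) assms] link_iff[OF gens_Y(3) assms] by simp_all

definition partner :: "nat \<Rightarrow> nat" where
  "partner = transpose 1 2 \<circ> (transpose 3 4 \<circ> transpose 5 6)"

lemma partner_values: "partner 1 = 2" "partner 2 = 1" "partner 3 = 4" "partner 4 = 3"
  "partner 5 = 6" "partner 6 = 5"
  by (simp_all add: partner_def transpose_def)

lemma partner_in: "i \<in> {1..6} \<Longrightarrow> partner i \<in> {1..6}"
proof -
  have "\<forall>i\<in>{1..6}. partner i \<in> {1..6}" unfolding ball_six partner_values by simp
  then show "i \<in> {1..6} \<Longrightarrow> partner i \<in> {1..6}" by blast
qed

text \<open>The two orbits of the \<open>S\<^sub>4\<close> on ordered pairs of distinct points: 6 pairs of partners (opposite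
  faces of the cube) and the 24 other pairs.\<close>

lemma link_orbits:
  assumes "i \<in> {1..6}" "j \<in> {1..6}" "i \<noteq> j"
  shows "link i j \<longleftrightarrow> (if j = partner i then link 1 2 else link 2 6)"
proof -
  \<comment> \<open>The instances used form spanning trees of the two orbits, with 5 edges starting
    from (1, 2) and 23 starting from (2, 6).\<close>
  have "\<forall>i\<in>{1..6}. \<forall>j\<in>{1..6}. i \<noteq> j \<longrightarrow> (link i j \<longleftrightarrow> (if j = partner i then link 1 2 else link 2 6))"
    unfolding ball_six using
    link_sig(1)[of 1 2] link_sig(2)[of 1 2] link_sig(1)[of 4 3] link_sig(2)[of 4 3]
    link_sig(1)[of 3 4] link_sig(1)[of 2 6] link_sig(2)[of 2 6] link_sig(3)[of 2 6]
    link_sig(1)[of 3 1] link_sig(2)[of 3 1] link_sig(3)[of 3 1] link_sig(1)[of 4 5]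
    link_sig(3)[of 4 5] link_sig(1)[of 3 5] link_sig(3)[of 5 4] link_sig(3)[of 1 3]
    link_sig(1)[of 2 4] link_sig(3)[of 6 2] link_sig(1)[of 1 6] link_sig(1)[of 5 2]
    link_sig(2)[of 5 2] link_sig(3)[of 5 2] link_sig(1)[of 6 1] link_sig(1)[of 3 6]
    link_sig(2)[of 3 6] link_sig(3)[of 3 6] link_sig(3)[of 2 3] link_sig(1)[of 1 4]
    by (simp add: perm_values partner_values)
  then show ?thesis using assms by blast
qed

text \<open>The pairs (1, 3) and (3, 2) lie in the orbit of (2, 6), so transitivity through 3
  applies.\<close>

lemma link_26_imp_12: "link 2 6 \<Longrightarrow> link 1 2"
  using link_trans[of 1 3 2] link_orbits[of 1 3] link_orbits[of 3 2] by (simp add: partner_values)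

text \<open>The two coordinate maps on \<open>M\<close> have the same kernel and the first is onto
  by \<open>M_coord_full\<close>, so the second factors through it by an injective endomorphism.
  Finiteness of G makes this bijective.\<close>

lemma link_automorphism:
  assumes L: "link i j" "link j i" and i: "i \<in> {1..6}" and j: "j \<in> {1..6}"
  shows "\<exists>\<phi>\<in>auto G. \<forall>m\<in>M. \<phi> (fst m i) = fst m j"
proof -
  \<comment> \<open>Elements of \<open>auto\<close> are extensional, hence the restriction to the
    carrier. By \<open>uniq\<close> the choice of m does not affect the value.\<close>
  define \<phi> where "\<phi> = (\<lambda>t\<in>carrier G. fst (SOME m. m \<in> M \<and> fst m i = t) j)"
  have uniq: "fst m j = fst n j \<longleftrightarrow> fst m i = fst n i" if m: "m \<in> M" and n: "n \<in> M" for m n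
  proof -
    let ?q = "m \<otimes>\<^bsub>W\<^esub> inv\<^bsub>Y\<^esub> n"
    have q: "?q \<in> M"
      using subgroup.m_closed[OF M_subgroup m subgroup.m_inv_closed[OF M_subgroup n]] by simp
    have *: "fst ?q k = \<one> \<longleftrightarrow> fst m k = fst n k" if k: "k \<in> {1..6}" for k
      using M_coord[OF m k] M_coord[OF n k] k
      by (simp add: fst_mult_M[OF m] fst_inv_M[OF n]) (metis inv_equality inv_inv inv_closed r_inv)
    have "fst ?q i = \<one> \<longleftrightarrow> fst ?q j = \<one>" using L q unfolding link_def by blast
    then show ?thesis using *[OF i] *[OF j] by simp
  qed
  have \<phi>: "\<phi> (fst m i) = fst m j" if m: "m \<in> M" for m
  proof -
    let ?n = "SOME n. n \<in> M \<and> fst n i = fst m i"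
    have "?n \<in> M \<and> fst ?n i = fst m i" by (rule someI[of _ m]) (use m in simp)
    then have "fst ?n j = fst m j" using uniq m by blast
    then show ?thesis using M_coord[OF m i] by (simp add: \<phi>_def)
  qed
  have "\<phi> \<in> hom G G"
  proof (rule homI)
    fix s t assume "s \<in> carrier G" "t \<in> carrier G"
    then obtain m n where mn: "m \<in> M" "fst m i = s" "n \<in> M" "fst n i = t"
      using M_coord_full[OF i] by meson
    have "m \<otimes>\<^bsub>W\<^esub> n \<in> M" using subgroup.m_closed[OF M_subgroup mn(1,3)] by simp
    then have "\<phi> (fst (m \<otimes>\<^bsub>W\<^esub> n) i) = fst (m \<otimes>\<^bsub>W\<^esub> n) j" by (rule \<phi>)
    then show "\<phi> (s \<otimes> t) = \<phi> s \<otimes> \<phi> t"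
      using fst_mult_M[OF mn(1) i, of n] fst_mult_M[OF mn(1) j, of n] \<phi>[OF mn(1)] \<phi>[OF mn(3)] mn(2,4) by simp
  next
    fix s assume "s \<in> carrier G"
    then obtain m where "m \<in> M" "fst m i = s" using M_coord_full[OF i] by meson
    then show "\<phi> s \<in> carrier G" using \<phi>[of m] M_coord[OF _ j] by simp
  qed
  moreover have "bij_betw \<phi> (carrier G) (carrier G)"
  proof -
    have "inj_on \<phi> (carrier G)"
    proof (rule inj_onI)
      fix s t assume "s \<in> carrier G" "t \<in> carrier G" and eq: "\<phi> s = \<phi> t"
      then obtain m n where mn: "m \<in> M" "fst m i = s" "n \<in> M" "fst n i = t"
        using M_coord_full[OF i] by meson
      then show "s = t" using uniq[OF mn(1,3)] eq \<phi>[OF mn(1)] \<phi>[OF mn(3)] by simp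
    qed
    moreover have "\<phi> ` carrier G \<subseteq> carrier G" using \<open>\<phi> \<in> hom G G\<close> by (auto simp: hom_def)
    ultimately show ?thesis using finite_G by (simp add: bij_betw_def endo_inj_surj)
  qed
  ultimately have "\<phi> \<in> auto G" by (simp add: auto_def Bij_def \<phi>_def)
  then show ?thesis using \<phi> by blast
qed

section \<open>Linkage and the automorphisms in \<open>Phi1\<close> and \<open>Phi2\<close>\<close>

lemma transport_top:
  assumes \<phi>: "\<forall>m\<in>M. \<phi> (fst m i) = fst m j" and i: "i \<in> {1..6}" and j: "j \<in> {1..6}"
  shows "\<forall>m\<in>M. \<phi> (fst m (sig1 i)) = fst m (sig1 j)" "\<forall>m\<in>M. \<phi> (fst m (sig2 i)) = fst m (sig2 j)"
proof -
  \<comment> \<open>The generators of \<open>H\<close> carry no twist, so \<open>\<phi>\<close>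
    itself links the image coordinates.\<close>
  have "\<phi> (fst m (snd a i)) = fst m (snd a j)"
    if a: "a \<in> {a1, a2}" and m: "m \<in> M" for a m
  proof -
    have aY: "a \<in> carrier Y" and a1: "fst a i = \<one>" "fst a j = \<one>" using a i j by (auto simp: fst_a)
    obtain n where n: "n \<in> M" "\<And>i. i \<in> {1..6} \<Longrightarrow> fst m (snd a i) = inv (fst a i) \<otimes> fst n i \<otimes> fst a i"
      using conj_back[OF aY m] by auto
    then show ?thesis
      using n(2)[OF i] n(2)[OF j] M_coord[OF n(1) i] M_coord[OF n(1) j] \<phi> by (simp add: a1)
  qed
  from this[of a1] this[of a2] show "\<forall>m\<in>M. \<phi> (fst m (sig1 i)) = fst m (sig1 j)"
    "\<forall>m\<in>M. \<phi> (fst m (sig2 i)) = fst m (sig2 j)" by simp_all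
qed

text \<open>Applying \<open>\<phi>\<close> to the coordinates of a conjugate by g shows that
  \<open>\<phi> (f i)\<close> and \<open>f j\<close> induce the same inner automorphism, so they are
  equal.\<close>

lemma transport_g:
  assumes aut: "\<phi> \<in> auto G" and i: "i \<in> {1..6}" and j: "j \<in> {1..6}"
    and \<phi>: "\<forall>m\<in>M. \<phi> (fst m i) = fst m j" and \<phi>': "\<forall>m\<in>M. \<phi> (fst m (sig3 i)) = fst m (sig3 j)"
  shows "\<phi> (f i) = f j"
proof -
  have hom: "\<phi> \<in> hom G G" and bij: "bij_betw \<phi> (carrier G) (carrier G)"
    using aut by (auto simp: auto_def Bij_def)
  interpret \<phi>: group_hom G G \<phi>
    by (intro group_hom.intro group_hom_axioms.intro is_group hom)
  have fG: "f i \<in> carrier G" "f j \<in> carrier G" using f_PiE i j by (auto simp: PiE_iff)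
  show ?thesis
  proof (rule conj_eqD)
    fix t assume "t \<in> carrier G"
    then obtain s where s: "s \<in> carrier G" "\<phi> s = t"
      using bij by (metis bij_betw_imp_surj_on imageE)
    then obtain n where n: "n \<in> M" "fst n i = s" using M_coord_full[OF i] by meson
    let ?m = "inv\<^bsub>Y\<^esub> g \<otimes>\<^bsub>W\<^esub> n \<otimes>\<^bsub>W\<^esub> g"
    have m: "?m \<in> M" using normal.inv_op_closed1[OF M_normal gens_Y(3) n(1)] by simp
    have c: "fst ?m (sig3 k) = inv (f k) \<otimes> fst n k \<otimes> f k" if "k \<in> {1..6}" for k
      using conj_coord[OF gens_Y(3) n(1) that] by (simp add: fst_g)
    have "\<phi> (inv (f i) \<otimes> s \<otimes> f i) = inv (f j) \<otimes> t \<otimes> f j"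
      using \<phi>' m c[OF i] c[OF j] \<phi> n s by auto
    then show "inv (\<phi> (f i)) \<otimes> t \<otimes> \<phi> (f i) = inv (f j) \<otimes> t \<otimes> f j"
      using s fG by simp
  qed (use fG in simp_all)
qed

text \<open>Moving (1, 2) by \<open>H\<close> shows that \<open>\<phi>\<close> also links (4, 3),
  (6, 5) and (5, 6). As \<open>sig3\<close> sends (1, 2) to (4, 3) and (5, 6) to (6, 5), comparing
  twists fixes \<open>\<phi>\<close> on y and x.\<close>

lemma Phi1_if_link:
  assumes "link 1 2"
  shows "Phi1 G x y \<noteq> {}"
proof -
  have "link 2 1" using assms link_orbits[of 2 1] by (simp add: partner_values)
  then obtain \<phi> where \<phi>: "\<phi> \<in> auto G" "\<forall>m\<in>M. \<phi> (fst m 1) = fst m 2"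
    using link_automorphism[OF assms] by auto
  have 43: "\<forall>m\<in>M. \<phi> (fst m 4) = fst m 3"
    using transport_top(1)[OF \<phi>(2)] by (simp add: perm_values)
  have 65: "\<forall>m\<in>M. \<phi> (fst m 6) = fst m 5"
    using transport_top(1)[OF 43] by (simp add: perm_values)
  have 56: "\<forall>m\<in>M. \<phi> (fst m 5) = fst m 6"
    using transport_top(2)[OF 65] by (simp add: perm_values)
  have "\<phi> (f 1) = f 2" "\<phi> (f 5) = f 6"
    using transport_g[OF \<phi>(1) _ _ \<phi>(2)] transport_g[OF \<phi>(1) _ _ 56] 43 65 by (simp_all add: perm_values)
  then have "\<phi> \<in> Phi1 G x y" using \<phi>(1) by (simp add: Phi1_def f_values)
  then show ?thesis by blast
qed

text \<open>Moving (2, 6) by \<open>H\<close> gives (4, 5) and (6, 2) for the same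
  \<open>\<phi>\<close>. Evaluating at \<open>rel\<close>, whose coordinates 2, 6, 4, 5 are u, v, w
  and the inverse of w, yields the prescribed values.\<close>

lemma Phi2_if_link:
  assumes "link 2 6"
  shows "Phi2 G x y \<noteq> {}"
proof -
  have "link 6 2" using assms link_orbits[of 6 2] by (simp add: partner_values)
  then obtain \<phi> where \<phi>: "\<phi> \<in> auto G" "\<forall>m\<in>M. \<phi> (fst m 2) = fst m 6"
    using link_automorphism[OF assms] by auto
  have 45: "\<forall>m\<in>M. \<phi> (fst m 4) = fst m 5"
    using transport_top(2)[OF \<phi>(2)] by (simp add: perm_values)
  have 62: "\<forall>m\<in>M. \<phi> (fst m 6) = fst m 2"
    using transport_top(1)[OF 45] by (simp add: perm_values)
  have "\<phi> u = v" "\<phi> w = inv w" "\<phi> v = u"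
    using \<phi>(2) 45 62 rel_M fst_rel by metis+
  then have "\<phi> \<in> Phi2 G x y"
    using \<phi>(1) by (simp add: Phi2_def y_pow u_def v_def w_def m_assoc inv_mult_group)
  then show ?thesis by blast
qed

text \<open>The invariant \<open>P\<close> says that a commutes with exchanging partner coordinates
  while applying \<open>\<phi>\<close>. It holds for the generators because \<open>f\<close> has
  values matched by \<open>\<phi>\<close> at partners, and it passes to products.\<close>

lemma link_if_Phi1:
  assumes "Phi1 G x y \<noteq> {}"
  shows "link 1 2"
proof -
  obtain \<phi> where \<phi>: "\<phi> \<in> Phi1 G x y" using assms by blast
  have hom: "\<phi> \<in> hom G G" and vals: "\<phi> x = x" "\<phi> y = inv y"
    using \<phi> by (auto simp: Phi1_def auto_def)
  interpret \<phi>: group_hom G G \<phi>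
    by (intro group_hom.intro group_hom_axioms.intro is_group hom)
  define P where "P a \<longleftrightarrow> (\<forall>i\<in>{1..6}. \<phi> (fst a i) = fst a (partner i) \<and> snd a (partner i) = partner (snd a i))" for a
  have step: "P (a \<otimes>\<^bsub>W\<^esub> s)" if a: "a \<in> carrier Y" "P a" and s: "s \<in> carrier Y" "P s" for a s
    unfolding P_def
  proof
    fix i :: nat assume i: "i \<in> {1..6}"
    have \<sigma>i: "snd a i \<in> {1..6}" and zi: "partner i \<in> {1..6}"
      using Y_perm_in[OF a(1) i] partner_in[OF i] .
    have Pa: "\<phi> (fst a i) = fst a (partner i)" "snd a (partner i) = partner (snd a i)"
      using a(2) i by (simp_all add: P_def)
    have Ps: "\<phi> (fst s (snd a i)) = fst s (partner (snd a i))"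
      "snd s (partner (snd a i)) = partner (snd s (snd a i))"
      using s(2) \<sigma>i by (simp_all add: P_def)
    show "\<phi> (fst (a \<otimes>\<^bsub>W\<^esub> s) i) = fst (a \<otimes>\<^bsub>W\<^esub> s) (partner i)
        \<and> snd (a \<otimes>\<^bsub>W\<^esub> s) (partner i) = partner (snd (a \<otimes>\<^bsub>W\<^esub> s) i)"
      using i zi Pa Ps Y_coord[OF a(1) i] Y_coord[OF s(1) \<sigma>i] a(1) by (simp add: fst_mult snd_mult)
  qed
  have gens: "P a1" "P a2" "P g"
    unfolding P_def ball_six by (simp_all add: fst_a fst_g perm_values partner_values f_values vals)
  have "P a" if "a \<in> carrier Y" for a
    using that
  proof (induction rule: Y_induct_right)
    case one
    then show ?case unfolding P_def by (simp add: fst_one snd_one partner_in)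
  qed (use step gens in simp_all)
  then have "\<phi> (fst m 1) = fst m 2" if "m \<in> M" for m
    using that unfolding P_def ball_six partner_values by (simp add: partner_values)
  then show ?thesis unfolding link_def by (metis \<phi>.hom_one)
qed

text \<open>Once the linking maps \<open>A i\<close> are shown compatible with all of
  \<open>Y\<close>, coordinates 2 and 6 of every element of \<open>M\<close> are images of
  coordinate 1 under \<open>p1\<close> and under \<open>p1\<close> followed by \<open>p2\<close>.
  Triviality at 2 thus forces triviality at 6.\<close>

lemma link_if_Phi12:
  assumes "Phi1 G x y \<noteq> {}" "Phi2 G x y \<noteq> {}"
  shows "link 2 6"
proof -
  obtain p1 p2 where p: "p1 \<in> Phi1 G x y" "p2 \<in> Phi2 G x y" using assms by blast
  interpret two_generated_Phi G x y p1 p2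
    by unfold_locales (use p in auto)
  \<comment> \<open>\<open>A\<^sub>i\<close> maps the first coordinate of \<open>rel\<close> to the \<open>i\<close>-th. By \<open>P\<close> below, conjugation by
    \<open>(A\<^sub>1, \<dots>, A\<^sub>6)\<close> in \<open>Aut(T)\<^sup>6\<close> makes all coordinates of an element of \<open>Y\<close> equal to one \<open>B\<close>.\<close>
  define A where "A i = [\<lambda>s. s, p1, p2, \<lambda>s. p1 (p2 s), \<lambda>s. p1 (p2 (p1 s)), \<lambda>s. p2 (p1 s)] ! (i - 1)" for i :: nat
  have A: "A 1 = (\<lambda>s. s)" "A 2 = p1" "A 3 = p2" "A 4 = (\<lambda>s. p1 (p2 s))"
    "A 5 = (\<lambda>s. p1 (p2 (p1 s)))" "A 6 = (\<lambda>s. p2 (p1 s))"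
    by (simp_all add: A_def)
  define P where "P a \<longleftrightarrow> (\<exists>B. (\<forall>s\<in>carrier G. B s \<in> carrier G) \<and>
      (\<forall>i\<in>{1..6}. \<forall>s\<in>carrier G. inv (fst a i) \<otimes> A i s \<otimes> fst a i = A (snd a i) (B s)))" for a
  have A_closed: "A i s \<in> carrier G" if "i \<in> {1..6}" "s \<in> carrier G" for i s
  proof -
    have "\<forall>i\<in>{1..6}. A i s \<in> carrier G" unfolding ball_six by (simp add: A that)
    then show ?thesis using that by blast
  qed
  have step: "P (a \<otimes>\<^bsub>W\<^esub> s)" if a: "a \<in> carrier Y" "P a" and s: "s \<in> carrier Y" "P s" for a s
  proof -
    obtain B where B: "\<And>t. t \<in> carrier G \<Longrightarrow> B t \<in> carrier G"
      "\<And>i t. i \<in> {1..6} \<Longrightarrow> t \<in> carrier G \<Longrightarrow> inv (fst a i) \<otimes> A i t \<otimes> fst a i = A (snd a i) (B t)"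
      using a(2) unfolding P_def by auto
    obtain C where C: "\<And>t. t \<in> carrier G \<Longrightarrow> C t \<in> carrier G"
      "\<And>i t. i \<in> {1..6} \<Longrightarrow> t \<in> carrier G \<Longrightarrow> inv (fst s i) \<otimes> A i t \<otimes> fst s i = A (snd s i) (C t)"
      using s(2) unfolding P_def by auto
    have "inv (fst (a \<otimes>\<^bsub>W\<^esub> s) i) \<otimes> A i t \<otimes> fst (a \<otimes>\<^bsub>W\<^esub> s) i = A (snd (a \<otimes>\<^bsub>W\<^esub> s) i) (C (B t))"
      if i: "i \<in> {1..6}" and t: "t \<in> carrier G" for i t
    proof -
      have \<sigma>i: "snd a i \<in> {1..6}" using Y_perm_in[OF a(1) i] .
      have G: "fst a i \<in> carrier G" "fst s (snd a i) \<in> carrier G" "A i t \<in> carrier G"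
        using Y_coord[OF a(1) i] Y_coord[OF s(1) \<sigma>i] A_closed[OF i t] .
      have "inv (fst (a \<otimes>\<^bsub>W\<^esub> s) i) \<otimes> A i t \<otimes> fst (a \<otimes>\<^bsub>W\<^esub> s) i
          = inv (fst s (snd a i)) \<otimes> (inv (fst a i) \<otimes> A i t \<otimes> fst a i) \<otimes> fst s (snd a i)"
        using G by (simp add: fst_mult[OF a(1) i] inv_mult_group m_assoc)
      also have "\<dots> = A (snd (a \<otimes>\<^bsub>W\<^esub> s) i) (C (B t))"
        using B(2)[OF i t] C(2)[OF \<sigma>i B(1)[OF t]] a(1) by (simp add: snd_mult)
      finally show ?thesis .
    qed
    then show ?thesis using B(1) C(1) unfolding P_def by (intro exI[of _ "\<lambda>t. C (B t)"]) blast
  qed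
  \<comment> \<open>Coordinate 1, where \<open>A 1\<close> is the identity, forces each witness B:
    conjugate s by the first coordinate of a, then invert \<open>A\<close> at the image of
    1.\<close>
  have "P a1"
    unfolding P_def ball_six
    by (rule exI[of _ "\<lambda>s. p2 (p1 s)"]) (simp add: fst_a perm_values A p_braid)
  moreover have "P a2"
    unfolding P_def ball_six
    by (rule exI[of _ p2]) (simp add: fst_a perm_values A p_braid)
  moreover have "P g"
  proof -
    \<comment> \<open>All six coordinate conditions for g are expressed through t, the conjugate of
      \<open>p1 s\<close> by y; the two conjugation identities and the S_3 relations then settle
      them.\<close>
    have "\<exists>t. t \<in> carrier G \<and> p2 (y \<otimes> p1 s \<otimes> inv y) = p2 t \<and> y \<otimes> p1 s \<otimes> inv y = t
        \<and> p1 t = inv y \<otimes> s \<otimes> y \<and> p2 t = y \<otimes> p1 (p2 s) \<otimes> inv y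
        \<and> p2 (p1 t) = x \<otimes> p2 (p1 s) \<otimes> x" if "s \<in> carrier G" for s
      using that p2_conj_y[OF that] p1_p2_conj_y[OF that]
      by (intro exI[of _ "y \<otimes> p1 s \<otimes> inv y"]) simp
    then have ex: thesis if "s \<in> carrier G" "\<And>t. t \<in> carrier G \<Longrightarrow> p2 (y \<otimes> p1 s \<otimes> inv y) = p2 t
        \<Longrightarrow> y \<otimes> p1 s \<otimes> inv y = t \<Longrightarrow> p1 t = inv y \<otimes> s \<otimes> y \<Longrightarrow> p2 t = y \<otimes> p1 (p2 s) \<otimes> inv y
        \<Longrightarrow> p2 (p1 t) = x \<otimes> p2 (p1 s) \<otimes> x \<Longrightarrow> thesis" for s thesis
      using that by blast
    have "\<forall>i\<in>{1..6}. inv (fst g i) \<otimes> A i s \<otimes> fst g i = A (snd g i) (p2 (y \<otimes> p1 s \<otimes> inv y))"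
      if s: "s \<in> carrier G" for s
    proof (rule ex[OF s])
      fix t
      assume t: "t \<in> carrier G" and Bt: "p2 (y \<otimes> p1 s \<otimes> inv y) = p2 t" and t0: "y \<otimes> p1 s \<otimes> inv y = t"
        and t1: "p1 t = inv y \<otimes> s \<otimes> y" and t2: "p2 t = y \<otimes> p1 (p2 s) \<otimes> inv y"
        and t21: "p2 (p1 t) = x \<otimes> p2 (p1 s) \<otimes> x"
      have t12: "p1 (p2 t) = inv y \<otimes> p2 s \<otimes> y" unfolding t2 using s by simp
      have g1: "p1 (p2 (p2 t)) = inv y \<otimes> s \<otimes> y" using t t1 by simp
      have g2: "p2 (p2 t) = y \<otimes> p1 s \<otimes> inv y" using t t0 by simp
      have g5: "p2 (p1 (p2 t)) = x \<otimes> p1 (p2 (p1 s)) \<otimes> x"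
        unfolding p_braid[OF t] t21 using s by simp
      have g6: "p1 (p2 (p1 (p2 t))) = x \<otimes> p2 (p1 s) \<otimes> x"
        unfolding p_braid[OF t] p1_p1[OF P2.hom_closed[OF P1.hom_closed[OF t]]] by (rule t21)
      show "\<forall>i\<in>{1..6}. inv (fst g i) \<otimes> A i s \<otimes> fst g i = A (snd g i) (p2 (y \<otimes> p1 s \<otimes> inv y))"
        unfolding Bt ball_six fst_g snd_gens perm_values f_values A
        unfolding inv_inv[OF y] inv_x
        by (intro conjI g1[symmetric] g2[symmetric] t12[symmetric] t2[symmetric] g5[symmetric] g6[symmetric])
    qed
    then show ?thesis
      unfolding P_def by (intro exI[of _ "\<lambda>s. p2 (y \<otimes> p1 s \<otimes> inv y)"]) simp
  qed
  ultimately have gens: "P a1" "P a2" "P g" by blast+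
  have PY: "P a" if "a \<in> carrier Y" for a
    using that
  proof (induction rule: Y_induct_right)
    case one
    then show ?case
      unfolding P_def by (intro exI[of _ "\<lambda>s. s"]) (simp add: fst_one snd_one A_closed)
  qed (use step gens in simp_all)
  \<comment> \<open>An element of \<open>M\<close> fixes every coordinate index, so coordinate 1
    identifies B as conjugation by \<open>fst m 1\<close>. At i, conjugation by
    \<open>fst m i\<close> and by \<open>A i (fst m 1)\<close> then agree.\<close>
  have main: "fst m i = A i (fst m 1)" if m: "m \<in> M" and i: "i \<in> {2, 6}" for m i
  proof -
    obtain B where B: "\<And>i t. i \<in> {1..6} \<Longrightarrow> t \<in> carrier G \<Longrightarrow> inv (fst m i) \<otimes> A i t \<otimes> fst m i = A i (B t)"
      using PY[of m] m unfolding P_def by (auto simp: M_snd)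
    have i6: "i \<in> {1..6}" using i by auto
    have m1: "fst m 1 \<in> carrier G" and mi: "fst m i \<in> carrier G" using M_coord[OF m] i6 by simp_all
    have B1: "B t = inv (fst m 1) \<otimes> t \<otimes> fst m 1" if "t \<in> carrier G" for t
      using B[of 1 t] that by (simp add: A)
    have hom: "A i \<in> hom G G" using i hom_comp[OF p1_hom p2_hom] p1_hom by (auto simp: A)
    interpret Ai: group_hom G G "A i"
      by (intro group_hom.intro group_hom_axioms.intro is_group hom)
    have surj: "\<exists>s\<in>carrier G. A i s = t" if "t \<in> carrier G" for t
      using i that by (auto simp: A intro: bexI[of _ "p1 t"] bexI[of _ "p1 (p2 t)"])
    show ?thesis
    proof (rule conj_eqD)
      fix t assume "t \<in> carrier G"
      then obtain s where s: "s \<in> carrier G" "A i s = t" using surj by blast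
      show "inv (fst m i) \<otimes> t \<otimes> fst m i = inv (A i (fst m 1)) \<otimes> t \<otimes> A i (fst m 1)"
        using B[OF i6 s(1)] B1[OF s(1)] s m1 by simp
    qed (use m1 mi in simp_all)
  qed
  show ?thesis
    unfolding link_def
  proof (intro ballI impI)
    fix m assume m: "m \<in> M" "fst m 2 = \<one>"
    have m1: "fst m 1 \<in> carrier G" using M_coord[OF m(1)] by simp
    have "p1 (fst m 1) = \<one>" using main[OF m(1), of 2] m(2) by (simp add: A)
    then have "fst m 1 = \<one>" using p1_p1[OF m1] by simp
    then show "fst m 6 = \<one>" using main[OF m(1), of 6] by (simp add: A)
  qed
qed


section \<open>The structure of \<open>M\<close>\<close>

text \<open>The map \<open>e\<close> chooses one representative from each of d linkage
  classes.\<close>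

definition proj :: "(nat \<Rightarrow> nat) \<Rightarrow> nat \<Rightarrow> (nat \<Rightarrow> 'a) \<times> (nat \<Rightarrow> nat) \<Rightarrow> nat \<Rightarrow> 'a" where
  "proj e d m = (\<lambda>k\<in>{1..d}. fst m (e k))"

lemma proj_mult:
  assumes e: "e ` {1..d} \<subseteq> {1..6}" and m: "m \<in> M" and n: "n \<in> M"
  shows "proj e d (m \<otimes>\<^bsub>W\<^esub> n) = proj e d m \<otimes>\<^bsub>product_group {1..d} (\<lambda>_. G)\<^esub> proj e d n"
  unfolding proj_def mult_product_group
  using fst_mult_M[OF m subsetD[OF e imageI]] by (intro restrict_ext) simp

lemma proj_subgroup:
  assumes e: "e ` {1..d} \<subseteq> {1..6}" and N: "subgroup N Y" "N \<subseteq> M"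
  shows "subgroup (proj e d ` N) (product_group {1..d} (\<lambda>_. G))"
proof -
  interpret P: group "product_group {1..d} (\<lambda>_. G)" by (simp add: is_group)
  have eD: "e k \<in> {1..6}" if "k \<in> {1..d}" for k using e that by blast
  have inP: "proj e d m \<in> carrier (product_group {1..d} (\<lambda>_. G))" if "m \<in> M" for m
    using M_coord[OF that eD] by (simp add: proj_def)
  show ?thesis
  proof (rule P.subgroupI)
    show "proj e d ` N \<subseteq> carrier (product_group {1..d} (\<lambda>_. G))" using inP N(2) by blast
    show "proj e d ` N \<noteq> {}" using subgroup.one_closed[OF N(1)] by blast
    fix s assume "s \<in> proj e d ` N"
    then obtain m where m: "m \<in> N" "s = proj e d m" by blast
    then have mM: "m \<in> M" using N(2) by blast
    have "inv\<^bsub>product_group {1..d} (\<lambda>_. G)\<^esub> s = (\<lambda>k\<in>{1..d}. inv (s k))"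
      using inP[OF mM] m(2) by (intro inv_product_group) (auto simp: is_group)
    also have "\<dots> = proj e d (inv\<^bsub>Y\<^esub> m)"
      unfolding m(2) proj_def using eD by (intro restrict_ext) (simp add: fst_inv_M[OF mM])
    finally show "inv\<^bsub>product_group {1..d} (\<lambda>_. G)\<^esub> s \<in> proj e d ` N"
      using subgroup.m_inv_closed[OF N(1) m(1)] by simp
    fix t assume "t \<in> proj e d ` N"
    then obtain n where n: "n \<in> N" "t = proj e d n" by blast
    then have nM: "n \<in> M" using N(2) by blast
    have "s \<otimes>\<^bsub>product_group {1..d} (\<lambda>_. G)\<^esub> t = proj e d (m \<otimes>\<^bsub>W\<^esub> n)"
      unfolding m(2) n(2) by (rule proj_mult[OF e mM nM, symmetric])
    then show "s \<otimes>\<^bsub>product_group {1..d} (\<lambda>_. G)\<^esub> t \<in> proj e d ` N"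
      using subgroup.m_closed[OF N(1) m(1) n(1)] by simp
  qed
qed

text \<open>Commutators with \<open>M\<close> transfer the independence of coordinates from \<open>M\<close> to its normal
  subgroups.\<close>

lemma proj_full:
  fixes e :: "nat \<Rightarrow> nat" and d :: nat
  assumes e: "e ` {1..d} \<subseteq> {1..6}"
    and unlinked: "\<And>k l. k \<in> {1..d} \<Longrightarrow> l \<in> {1..d} \<Longrightarrow> k \<noteq> l \<Longrightarrow> \<not> link (e k) (e l)"
    and N: "N \<lhd> Y" "N \<subseteq> M" and n: "n \<in> N" "j \<in> {1..6}" "fst n j \<noteq> \<one>"
  shows "proj e d ` N = carrier (product_group {1..d} (\<lambda>_. G))"
proof (rule subdirect_product_full)
  have sub: "subgroup N Y" using N(1) by (rule normal_imp_subgroup)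
  then show "subgroup (proj e d ` N) (product_group {1..d} (\<lambda>_. G))"
    using e N(2) by (intro proj_subgroup)
  have eD: "e k \<in> {1..6}" if "k \<in> {1..d}" for k using e that by blast
  show "\<exists>s\<in>proj e d ` N. s k = t" if k: "k \<in> {1..d}" and t: "t \<in> carrier G" for k t
  proof -
    obtain m where "m \<in> N" "fst m (e k) = t" using coord_full[OF N n eD[OF k] t] by blast
    then show ?thesis using k by (intro bexI[of _ "proj e d m"]) (simp_all add: proj_def)
  qed
  show "\<exists>s\<in>proj e d ` N. s l = \<one> \<and> s k \<noteq> \<one>" if k: "k \<in> {1..d}" and l: "l \<in> {1..d}" and "k \<noteq> l" for k l
  proof -
    obtain m where m: "m \<in> M" "fst m (e l) = \<one>" "fst m (e k) \<noteq> \<one>"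
      using unlinked[OF l k] \<open>k \<noteq> l\<close> by (auto simp: link_def simp del: split_paired_All split_paired_Ex)
    have mk: "fst m (e k) \<in> carrier G" using M_coord[OF m(1) eD[OF k]] .
    obtain b where b: "b \<in> carrier G" "fst m (e k) \<otimes> b \<noteq> b \<otimes> fst m (e k)"
      using central_eq_one[OF mk] m(3) by blast
    obtain q where q: "q \<in> N" "fst q (e k) = b" using coord_full[OF N n eD[OF k] b(1)] by blast
    have qM: "q \<in> M" using q(1) N(2) by (rule set_mp[rotated])
    have m': "inv\<^bsub>Y\<^esub> m \<in> M" and q': "inv\<^bsub>Y\<^esub> q \<in> M"
      using subgroup.m_inv_closed[OF M_subgroup] m(1) qM by simp_all
    let ?c = "m \<otimes>\<^bsub>W\<^esub> q \<otimes>\<^bsub>W\<^esub> inv\<^bsub>Y\<^esub> m \<otimes>\<^bsub>W\<^esub> inv\<^bsub>Y\<^esub> q"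
    have "m \<otimes>\<^bsub>W\<^esub> q \<otimes>\<^bsub>W\<^esub> inv\<^bsub>Y\<^esub> m \<in> N"
      using normal.inv_op_closed2[OF N(1) _ q(1), of m] m(1) by simp
    then have c: "?c \<in> N"
      using subgroup.m_closed[OF sub _ subgroup.m_inv_closed[OF sub q(1)]] by simp
    have mq: "m \<otimes>\<^bsub>W\<^esub> q \<in> M" using subgroup.m_closed[OF M_subgroup m(1) qM] by simp
    have mqm: "m \<otimes>\<^bsub>W\<^esub> q \<otimes>\<^bsub>W\<^esub> inv\<^bsub>Y\<^esub> m \<in> M" using subgroup.m_closed[OF M_subgroup mq m'] by simp
    have coord: "fst ?c i = fst m i \<otimes> fst q i \<otimes> inv (fst m i) \<otimes> inv (fst q i)" if "i \<in> {1..6}" for i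
      using that by (simp add: fst_mult_M[OF mqm] fst_mult_M[OF mq] fst_mult_M[OF m(1)]
          fst_inv_M[OF m(1)] fst_inv_M[OF qM])
    have "fst ?c (e l) = \<one>"
      using coord[OF eD[OF l]] m(2) M_coord[OF qM eD[OF l]] by simp
    moreover have "fst ?c (e k) \<noteq> \<one>"
    proof
      assume "fst ?c (e k) = \<one>"
      then have "(fst m (e k) \<otimes> b) \<otimes> inv (b \<otimes> fst m (e k)) = \<one>"
        using coord[OF eD[OF k]] mk b(1) by (simp add: q(2) inv_mult_group m_assoc)
      then have "fst m (e k) \<otimes> b = inv (inv (b \<otimes> fst m (e k)))"
        using mk b(1) by (intro inv_equality[symmetric]) simp_all
      then show False using b mk by simp
    qed
    ultimately show ?thesis
      using k l c by (intro bexI[of _ "proj e d ?c"]) (simp_all add: proj_def)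
  qed
qed simp

text \<open>Coordinates of the chosen representatives determine all others by linkage, so the
  projection is injective on \<open>M\<close>. By \<open>proj_full\<close> it is onto from
  \<open>M\<close> and from every nontrivial normal subgroup inside \<open>M\<close>, which must
  therefore be \<open>M\<close>.\<close>

lemma M_structure:
  fixes e :: "nat \<Rightarrow> nat" and d :: nat
  assumes e: "e ` {1..d} \<subseteq> {1..6}"
    and unlinked: "\<And>k l. k \<in> {1..d} \<Longrightarrow> l \<in> {1..d} \<Longrightarrow> k \<noteq> l \<Longrightarrow> \<not> link (e k) (e l)"
    and cover: "\<And>i. i \<in> {1..6} \<Longrightarrow> \<exists>k\<in>{1..d}. link (e k) i"
  shows "minimal_normal M Y" "Y\<lparr>carrier := M\<rparr> \<cong> product_group {1..d} (\<lambda>_. G)"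
proof -
  have eD: "e k \<in> {1..6}" if "k \<in> {1..d}" for k using e that by blast
  have inj: "m = n" if m: "m \<in> M" and n: "n \<in> M" and eq: "proj e d m = proj e d n" for m n
  proof (rule M_eqI[OF m n])
    fix i :: nat assume i: "i \<in> {1..6}"
    then obtain k where k: "k \<in> {1..d}" "link (e k) i" using cover by blast
    have n': "inv\<^bsub>Y\<^esub> n \<in> M" using subgroup.m_inv_closed[OF M_subgroup n] .
    have q: "m \<otimes>\<^bsub>W\<^esub> inv\<^bsub>Y\<^esub> n \<in> M" using subgroup.m_closed[OF M_subgroup m n'] by simp
    have c: "fst (m \<otimes>\<^bsub>W\<^esub> inv\<^bsub>Y\<^esub> n) j = fst m j \<otimes> inv (fst n j)" if "j \<in> {1..6}" for j
      using that by (simp add: fst_mult_M[OF m] fst_inv_M[OF n])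
    have "fst m (e k) = fst n (e k)"
      using fun_cong[OF eq, of k] k(1) by (simp add: proj_def)
    then have "fst (m \<otimes>\<^bsub>W\<^esub> inv\<^bsub>Y\<^esub> n) (e k) = \<one>"
      using c[OF eD[OF k(1)]] M_coord[OF n eD[OF k(1)]] by simp
    then have "fst m i \<otimes> inv (fst n i) = \<one>" using k(2) q c[OF i] by (simp add: link_def)
    then show "fst m i = fst n i"
      using M_coord[OF m i] M_coord[OF n i] inv_equality[of "fst m i" "inv (fst n i)"] by simp
  qed
  have rel1: "fst rel 2 \<noteq> \<one>" using u_neq_one by (simp add: fst_rel)
  have "proj e d \<in> iso (Y\<lparr>carrier := M\<rparr>) (product_group {1..d} (\<lambda>_. G))"
  proof (rule isoI)
    have full: "proj e d ` M = carrier (product_group {1..d} (\<lambda>_. G))"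
      using proj_full[OF e unlinked M_normal subset_refl rel_M _ rel1] by simp
    then show "bij_betw (proj e d) (carrier (Y\<lparr>carrier := M\<rparr>)) (carrier (product_group {1..d} (\<lambda>_. G)))"
      using inj by (simp add: bij_betw_def inj_on_def)
    show "proj e d \<in> hom (Y\<lparr>carrier := M\<rparr>) (product_group {1..d} (\<lambda>_. G))"
    proof (rule homI)
      show "proj e d m \<in> carrier (product_group {1..d} (\<lambda>_. G))" if "m \<in> carrier (Y\<lparr>carrier := M\<rparr>)" for m
        using that full by auto
    qed (use proj_mult[OF e] in simp)
  qed
  then show "Y\<lparr>carrier := M\<rparr> \<cong> product_group {1..d} (\<lambda>_. G)" by (rule is_isoI)
  have "N = {\<one>\<^bsub>Y\<^esub>} \<or> N = M" if N: "N \<lhd> Y" "N \<subseteq> M" for N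
  proof (cases "\<exists>n\<in>N. \<exists>j\<in>{1..6}. fst n j \<noteq> \<one>")
    case True
    then obtain n j where n: "n \<in> N" "j \<in> {1..6}" "fst n j \<noteq> \<one>" by blast
    have "M \<subseteq> N"
    proof
      fix m assume m: "m \<in> M"
      have "proj e d ` N = proj e d ` M"
        using proj_full[OF e unlinked N n] proj_full[OF e unlinked M_normal subset_refl rel_M _ rel1] by simp
      then obtain q where q: "q \<in> N" "proj e d m = proj e d q" using m by (metis imageE imageI)
      then have "m = q" using inj[OF m] N(2) by blast
      then show "m \<in> N" using q(1) by simp
    qed
    then show ?thesis using N(2) by blast
  next
    case False
    have one: "\<one>\<^bsub>Y\<^esub> \<in> M" using subgroup.one_closed[OF M_subgroup] .
    have "n = \<one>\<^bsub>Y\<^esub>" if "n \<in> N" for n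
      using that False N(2) by (intro M_eqI[OF _ one]) (auto simp: fst_one)
    moreover have "\<one>\<^bsub>Y\<^esub> \<in> N" using subgroup.one_closed[OF normal_imp_subgroup[OF N(1)]] .
    ultimately show ?thesis by blast
  qed
  moreover have "M \<noteq> {\<one>\<^bsub>Y\<^esub>}"
    using rel_M rel1 fst_one[of 2] by auto
  ultimately show "minimal_normal M Y"
    using M_normal by (simp add: minimal_normal_def)
qed

lemma link_refl: "link i i"
  by (simp add: link_def)

text \<open>The linkage classes are the whole set, the three pairs of partners, or singletons. In
  the last case \<open>link_26_imp_12\<close> excludes linkage of non-partners.\<close>

lemma dimension:
  "\<exists>d. minimal_normal M Y \<and> Y\<lparr>carrier := M\<rparr> \<cong> product_group {1..d} (\<lambda>_. G) \<and> d \<in> {1, 3, 6::nat} \<and>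
    (d = 1 \<longleftrightarrow> Phi1 G x y \<noteq> {} \<and> Phi2 G x y \<noteq> {}) \<and>
    (d = 3 \<longleftrightarrow> Phi1 G x y \<noteq> {} \<and> Phi2 G x y = {}) \<and>
    (d = 6 \<longleftrightarrow> Phi1 G x y = {})"
proof -
  have one: "{1..1::nat} = {1}" and three: "{1..3::nat} = {1, 2, 3}" by (auto simp: atLeastAtMost_iff)
  consider (1) "Phi1 G x y \<noteq> {}" "Phi2 G x y \<noteq> {}" | (3) "Phi1 G x y \<noteq> {}" "Phi2 G x y = {}"
    | (6) "Phi1 G x y = {}" by blast
  then show ?thesis
  proof cases
    case 1
    then have L: "link 2 6" "link 1 2" using link_if_Phi12 link_if_Phi1 by blast+
    have "link 1 i" if "i \<in> {1..6}" for i
      using link_orbits[of 1 i] that L link_refl by (cases "i = 1") auto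
    then have "minimal_normal M Y" "Y\<lparr>carrier := M\<rparr> \<cong> product_group {1..1::nat} (\<lambda>_. G)"
      by (intro M_structure[of "\<lambda>_. 1" 1]; simp add: one)+
    then show ?thesis using 1 by (intro exI[of _ 1]) simp
  next
    case 3
    have L12: "link 1 2" using 3 link_if_Phi1 by blast
    have L26: "\<not> link 2 6" using 3 Phi2_if_link by blast
    have L: "link 1 2" "link 3 4" "link 5 6"
      using L12 link_orbits[of 3 4] link_orbits[of 5 6] by (simp_all add: partner_values)
    have U: "\<not> link 1 3" "\<not> link 1 5" "\<not> link 3 1" "\<not> link 3 5" "\<not> link 5 1" "\<not> link 5 3"
      using L26 link_orbits[of 1 3] link_orbits[of 1 5] link_orbits[of 3 1] link_orbits[of 3 5]
        link_orbits[of 5 1] link_orbits[of 5 3] by (simp_all add: partner_values)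
    \<comment> \<open>Odd representatives 1, 3, 5 of the partner classes {1, 2}, {3, 4}, {5,
      6}.\<close>
    define e where "e = (\<lambda>k::nat. 2 * k - 1)"
    have e: "e 1 = 1" "e 2 = 3" "e 3 = 5" by (simp_all add: e_def)
    have A: "e ` {1..3} \<subseteq> {1..6}" unfolding three by (simp add: e)
    have B: "\<not> link (e k) (e l)" if "k \<in> {1..3}" "l \<in> {1..3}" "k \<noteq> l" for k l
      using that U unfolding three by (auto simp: e)
    have C: "\<exists>k\<in>{1..3}. link (e k) i" if "i \<in> {1..6}" for i
    proof -
      have "\<forall>i\<in>{1..6}. \<exists>k\<in>{1..3}. link (e k) i"
        unfolding ball_six three using L link_refl by (simp add: e)
      then show ?thesis using that by blast
    qed
    have "minimal_normal M Y" "Y\<lparr>carrier := M\<rparr> \<cong> product_group {1..3::nat} (\<lambda>_. G)"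
      by (rule M_structure[OF A B C]; assumption)+
    then show ?thesis using 3 by (intro exI[of _ 3]) simp
  next
    case 6
    have U: "\<not> link 1 2" "\<not> link 2 6" using 6 Phi1_if_link link_26_imp_12 by blast+
    have "\<not> link i j" if "i \<in> {1..6}" "j \<in> {1..6}" "i \<noteq> j" for i j
      using link_orbits[OF that] U by simp
    then have "minimal_normal M Y" "Y\<lparr>carrier := M\<rparr> \<cong> product_group {1..6::nat} (\<lambda>_. G)"
      using link_refl by (intro M_structure[of "\<lambda>k. k" 6]; auto)+
    then show ?thesis using 6 by (intro exI[of _ 6]) simp
  qed
qed

end

theorem theorem3p1:
  fixes T :: "('a, 'b) monoid_scheme" and x y :: 'a
  assumes "simple_group T" and "finite (carrier T)" and "\<not> comm_group T"
    and "x \<in> carrier T" and "y \<in> carrier T"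
    and "group.ord T x = 2"
    and "Factorial_Ring.prime (group.ord T y)" and "odd (group.ord T y)"
    and "generate T {x, y} = carrier T"
  shows "\<exists>M d.
      minimal_normal M (Y_grp T x y) \<and>
      (Y_grp T x y)\<lparr>carrier := M\<rparr> \<cong> product_group {1..d} (\<lambda>_. T) \<and>
      Y_grp T x y Mod M \<cong> sym_group 4 \<and>
      Digraph.graph (with_proj (Gamma T x y)) \<and>
      Digraph_Component.connected (with_proj (Gamma T x y)) \<and>
      s_arc_transitive 2 (carrier (Y_grp T x y)) (r_coset (Y_grp T x y)) (Gamma T x y) \<and>
      is_normal_cover (Gamma T x y) M (r_coset (Y_grp T x y)) \<and>
      complete_digraph 4 (with_proj (normal_quotient (Gamma T x y) M (r_coset (Y_grp T x y)))) \<and>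
      d \<in> {1, 3, 6::nat} \<and>
      (d = 1 \<longleftrightarrow> Phi1 T x y \<noteq> {} \<and> Phi2 T x y \<noteq> {}) \<and>
      (d = 3 \<longleftrightarrow> Phi1 T x y \<noteq> {} \<and> Phi2 T x y = {}) \<and>
      (d = 6 \<longleftrightarrow> Phi1 T x y = {})"
proof -
  interpret T: simple_group T by (rule assms(1))
  have "x \<otimes>\<^bsub>T\<^esub> x = \<one>\<^bsub>T\<^esub>"
    using T.pow_ord_eq_1[of x] assms(4,6) by (simp add: numeral_2_eq_2)
  moreover have "x \<noteq> \<one>\<^bsub>T\<^esub>" using assms(6) T.ord_eq_1[OF assms(4)] by auto
  ultimately interpret cover T x y
    using assms by unfold_locales auto
  obtain d where "minimal_normal M Y" "Y\<lparr>carrier := M\<rparr> \<cong> product_group {1..d} (\<lambda>_. T)"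
    "d \<in> {1, 3, 6::nat}" "d = 1 \<longleftrightarrow> Phi1 T x y \<noteq> {} \<and> Phi2 T x y \<noteq> {}"
    "d = 3 \<longleftrightarrow> Phi1 T x y \<noteq> {} \<and> Phi2 T x y = {}" "d = 6 \<longleftrightarrow> Phi1 T x y = {}"
    using dimension by (elim exE conjE)
  with quotient_iso graph_Gamma connected_Gamma two_arc_transitive normal_cover quotient_complete
  show ?thesis
    by (intro exI[of _ M] exI[of _ d] conjI)
qed

end
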